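(* Let $r,s\in\mathbb{N}$, let $\mathtt{x},\mathtt{y}\in\Bbbk^2$ be nonzero with classes $\overline{\mathtt{x}},\overline{\mathtt{y}}\in\mathbb{P}_1(\Bbbk)$, and let $t=\min\{r,s\}$. Then, as $\mathfrak{u}(\mathfrak{m})$-modules: (i) $\mathtt{A}_{\mathtt{x}}(r)\otimes\mathtt{A}_{\mathtt{y}}(s)\simeq P(rs,rs)$ if $\overline{\mathtt{x}}\ne\overline{\mathtt{y}}$, and $\mathtt{A}_{\mathtt{x}}(r)\otimes\mathtt{A}_{\mathtt{y}}(s)\simeq\mathtt{A}_{\mathtt{x}}(t)\oplus\mathtt{B}_{\mathtt{x}}(t)\oplus P(rs-t,rs)$ if $\overline{\mathtt{x}}=\overline{\mathtt{y}}$; (ii) $\mathtt{A}_{\mathtt{x}}(r)\otimes\mathtt{B}_{\mathtt{y}}(s)\simeq 2rsP_1$ if $\overline{\mathtt{x}}\ne\overline{\mathtt{y}}$, and $\mathtt{A}_{\mathtt{x}}(r)\otimes\mathtt{B}_{\mathtt{y}}(s)\simeq\mathtt{A}_{\mathtt{x}}(t)\oplus\mathtt{B}_{\mathtt{x}}(t)\oplus P(0,2rs-t)$ if $\overline{\mathtt{x}}=\overline{\mathtt{y}}$; (iii) $\mathtt{B}_{\mathtt{x}}(r)\otimes\mathtt{B}_{\mathtt{y}}(s)\simeq P(rs,rs)$ if $\overline{\mathtt{x}}\ne\overline{\mathtt{y}}$, and $\mathtt{B}_{\mathtt{x}}(r)\otimes\mathtt{B}_{\mathtt{y}}(s)\simeq\mathtt{A}_{\mathtt{x}}(t)\oplus\mathtt{B}_{\mathtt{x}}(t)\oplus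 P(rs-t,rs)$ if $\overline{\mathtt{x}}=\overline{\mathtt{y}}$.
   Context: $\Bbbk$ is an algebraically closed field of characteristic $2$; $\mathbb{N}=\{1,2,\dots\}$. $\mathfrak{u}(\mathfrak{m})$ is the unital associative $\Bbbk$-algebra generated by $a,b,c$ with relations $ab+ba=c$, $ac+ca=a$, $bc+cb=b$, $a^4=b^4=0$, $c^2+c=0$; it is a Hopf algebra in which $a,b,c$ are primitive; tensor products of modules are over $\Bbbk$ with action through the comultiplication, and the dual $V^*$ of a module has action $(h\cdot\varphi)(v)=\varphi(\mathcal S(h)v)$, $\mathcal S$ the antipode. $V_0$ is the trivial one-dimensional module and $V_1$ is the simple module with basis $v_1,v_2,v_3$ and $av_1=v_2$, $av_2=v_3$, $av_3=0$, $bv_1=0$, $bv_2=v_1$, $bv_3=v_2$, $cv_1=v_1$, $cv_2=0$, $cv_3=v_3$. $P_i$ is the projective cover of $V_i$, $nM$ is the direct sum of $n$ copies of $M$, and $P(m,n)=mP_0\oplus nP_1$. For $r\in\mathbb{N}$ and $0\ne\mathtt{x}=(x_1,x_2)\in\Bbbk^2$, $\mathtt{A}_{\mathtt{x}}(r)$ is the module with basis $z_1,\dots,z_{4r}$ where $cz_i=z_i$ for $i$ even and $cz_i=0$ for $i$ odd; for $i\equiv2\ (4)$: $az_i=z_{i+1}$, $bz_i=0$; for $i\equiv3\ (4)$: $az_i=z_{i+1}$, $bz_i=z_{i-1}$; for $i\equiv0\ (4)$: $az_i=0$, $bz_i=z_{i-1}$; and for $i\equiv1\ (4)$: if $x_1\ne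 x_2$, then $az_1=x_1z_2$, $bz_1=x_2z_4$, and $az_{i}=x_1z_{i+1}+x_2z_{i-3}$, $bz_{i}=x_1z_{i-1}+x_2z_{i+3}$ for $i>1$; if $x_1=x_2$, then (by convention) $az_1=z_2$, $bz_1=z_4$, and $az_i=z_{i+1}$, $bz_i=z_{i-1}+z_{i+3}$ for $i>1$. Moreover $\mathtt{B}_{\mathtt{x}}(r)=\mathtt{A}_{\mathtt{x}}(r)^*$. *)

theory Defs
  imports
    "HOL-Computational_Algebra.Polynomial"
    "Jordan_Normal_Form.Matrix_Kernel"
begin

text \<open>
  Let \<open>u(m)\<close> be the algebra generated by \<open>a, b, c\<close> with relations
  \<open>ab + ba = c\<close>, \<open>ac + ca = a\<close>, \<open>bc + cb = b\<close>, \<open>a\<^sup>4 = b\<^sup>4 = 0\<close>, \<open>c\<^sup>2 + c = 0\<close>.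
  A finite-dimensional module over an algebra given by generators and relations is a vector space
  with one endomorphism per generator such that the relations hold. The underlying space is
  \<open>carrier_vec (mdim M)\<close>; a matrix \<open>X\<close> acts by \<open>v \<mapsto> X *\<^sub>v v\<close>, so the columns of
  \<open>X\<close> are the images of the basis vectors.
\<close>

record 'k um_rep =
  mdim :: nat
  act_a :: "'k mat"
  act_b :: "'k mat"
  act_c :: "'k mat"

definition um_module :: "'k::field um_rep \<Rightarrow> bool" where
  "um_module M \<longleftrightarrow>
    (let n = mdim M; A = act_a M; B = act_b M; C = act_c M in
      A \<in> carrier_mat n n \<and> B \<in> carrier_mat n n \<and> C \<in> carrier_mat n n \<and>
      A * B + B * A = C \<and> A * C + C * A = A \<and> B * C + C * B = B \<and>
      A ^\<^sub>m 4 = 0\<^sub>m n n \<and> B ^\<^sub>m 4 = 0\<^sub>m n n \<and> C ^\<^sub>m 2 + C = 0\<^sub>m n n)"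

definition um_hom :: "'k::field um_rep \<Rightarrow> 'k um_rep \<Rightarrow> 'k mat set" where
  "um_hom M N = {F \<in> carrier_mat (mdim N) (mdim M).
    F * act_a M = act_a N * F \<and> F * act_b M = act_b N * F \<and> F * act_c M = act_c N * F}"

definition um_iso :: "'k::field um_rep \<Rightarrow> 'k um_rep \<Rightarrow> bool" (infix \<open>\<simeq>\<^sub>u\<close> 50) where
  "M \<simeq>\<^sub>u N \<longleftrightarrow> um_module M \<and> um_module N \<and> (\<exists>F \<in> um_hom M N. invertible_mat F)"


subsection \<open>Direct sums, tensor products and duals\<close>

definition diag_sum :: "'k::zero mat \<Rightarrow> 'k mat \<Rightarrow> 'k mat" where
  "diag_sum X Y =
    four_block_mat X (0\<^sub>m (dim_row X) (dim_col Y)) (0\<^sub>m (dim_row Y) (dim_col X)) Y"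

definition um_sum :: "'k::field um_rep \<Rightarrow> 'k um_rep \<Rightarrow> 'k um_rep" (infixr \<open>\<oplus>\<^sub>u\<close> 65) where
  "M \<oplus>\<^sub>u N = \<lparr> mdim = mdim M + mdim N,
    act_a = diag_sum (act_a M) (act_a N),
    act_b = diag_sum (act_b M) (act_b N),
    act_c = diag_sum (act_c M) (act_c N) \<rparr>"

primrec um_copies :: "nat \<Rightarrow> 'k::field um_rep \<Rightarrow> 'k um_rep" where
  "um_copies 0 M = \<lparr> mdim = 0, act_a = 0\<^sub>m 0 0, act_b = 0\<^sub>m 0 0, act_c = 0\<^sub>m 0 0 \<rparr>"
| "um_copies (Suc n) M = M \<oplus>\<^sub>u um_copies n M"

text \<open>
  The matrix of \<open>X \<otimes> Y\<close> in the basis \<open>e\<^sub>i \<otimes> e\<^sub>j\<close>, which is listed lexicographically.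
\<close>

definition kronecker :: "'k::times mat \<Rightarrow> 'k mat \<Rightarrow> 'k mat" where
  "kronecker X Y = mat (dim_row X * dim_row Y) (dim_col X * dim_col Y)
    (\<lambda>(i, j). X $$ (i div dim_row Y, j div dim_col Y) * Y $$ (i mod dim_row Y, j mod dim_col Y))"

text \<open>
  The generators are primitive, so \<open>h \<in> {a, b, c}\<close> acts on a tensor product through
  \<open>\<Delta> h = h \<otimes> 1 + 1 \<otimes> h\<close>, and on a dual through \<open>S h = - h\<close>: in the dual basis,
  \<open>(h \<cdot> \<phi>)(v) = \<phi> (- h v)\<close> is the negative of the transpose.
\<close>

definition um_tensor :: "'k::field um_rep \<Rightarrow> 'k um_rep \<Rightarrow> 'k um_rep" (infixr \<open>\<otimes>\<^sub>u\<close> 70) where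
  "M \<otimes>\<^sub>u N =
    (let prim = (\<lambda>X Y. kronecker X (1\<^sub>m (mdim N)) + kronecker (1\<^sub>m (mdim M)) Y) in
      \<lparr> mdim = mdim M * mdim N,
        act_a = prim (act_a M) (act_a N),
        act_b = prim (act_b M) (act_b N),
        act_c = prim (act_c M) (act_c N) \<rparr>)"

definition um_dual :: "'k::field um_rep \<Rightarrow> 'k um_rep" where
  "um_dual M = \<lparr> mdim = mdim M,
    act_a = - transpose_mat (act_a M),
    act_b = - transpose_mat (act_b M),
    act_c = - transpose_mat (act_c M) \<rparr>"


subsection \<open>Projective covers\<close>

text \<open>
  Projectivity is the lifting property in the category of finite-dimensional modules. As \<open>u(m)\<close> is
  finite-dimensional, finite-dimensional projectives in this sense are the finitely generated
  projective \<open>u(m)\<close>-modules.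
\<close>

definition um_epi :: "'k::field um_rep \<Rightarrow> 'k um_rep \<Rightarrow> 'k mat set" where
  "um_epi M N = {F \<in> um_hom M N. (\<lambda>v. F *\<^sub>v v) ` carrier_vec (mdim M) = carrier_vec (mdim N)}"

definition um_projective :: "'k::field um_rep \<Rightarrow> bool" where
  "um_projective P \<longleftrightarrow> um_module P \<and>
    (\<forall>M N E F. um_module M \<longrightarrow> um_module N \<longrightarrow> E \<in> um_epi M N \<longrightarrow> F \<in> um_hom P N \<longrightarrow>
      (\<exists>G \<in> um_hom P M. E * G = F))"

definition um_submodule :: "'k::field vec set \<Rightarrow> 'k um_rep \<Rightarrow> bool" where
  "um_submodule W M \<longleftrightarrow> W \<subseteq> carrier_vec (mdim M) \<and> 0\<^sub>v (mdim M) \<in> W \<and>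
    (\<forall>v \<in> W. \<forall>w \<in> W. v + w \<in> W) \<and> (\<forall>k. \<forall>v \<in> W. k \<cdot>\<^sub>v v \<in> W) \<and>
    (\<forall>v \<in> W. act_a M *\<^sub>v v \<in> W \<and> act_b M *\<^sub>v v \<in> W \<and> act_c M *\<^sub>v v \<in> W)"

definition um_superfluous :: "'k::field vec set \<Rightarrow> 'k um_rep \<Rightarrow> bool" where
  "um_superfluous K M \<longleftrightarrow> um_submodule K M \<and>
    (\<forall>W. um_submodule W M \<and> {w + k | w k. w \<in> W \<and> k \<in> K} = carrier_vec (mdim M)
      \<longrightarrow> W = carrier_vec (mdim M))"

definition um_projective_cover :: "'k::field um_rep \<Rightarrow> 'k um_rep \<Rightarrow> bool" where
  "um_projective_cover P V \<longleftrightarrow> um_projective P \<and>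
    (\<exists>E \<in> um_epi P V. um_superfluous (mat_kernel E) P)"


subsection \<open>The modules \<open>V\<^sub>0\<close>, \<open>V\<^sub>1\<close>, \<open>A\<^sub>x(r)\<close> and \<open>B\<^sub>x(r)\<close>\<close>

text \<open>Bases are numbered from \<open>1\<close>, whereas vector and matrix indices start at \<open>0\<close>.\<close>

definition basis_vec :: "nat \<Rightarrow> nat \<Rightarrow> 'k::field vec" where
  "basis_vec n i = unit_vec n (i - 1)"

definition endo_mat :: "nat \<Rightarrow> (nat \<Rightarrow> 'k::field vec) \<Rightarrow> 'k mat" where
  "endo_mat n f = mat_of_cols n (map f [1..<n + 1])"

definition um_V0 :: "'k::field um_rep" where
  "um_V0 = \<lparr> mdim = 1, act_a = 0\<^sub>m 1 1, act_b = 0\<^sub>m 1 1, act_c = 0\<^sub>m 1 1 \<rparr>"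

definition um_V1 :: "'k::field um_rep" where
  "um_V1 =
    (let v = basis_vec 3; zero = 0\<^sub>v 3 in
      \<lparr> mdim = 3,
        act_a = endo_mat 3 (\<lambda>i. if i = 1 then v 2 else if i = 2 then v 3 else zero),
        act_b = endo_mat 3 (\<lambda>i. if i = 1 then zero else if i = 2 then v 1 else v 2),
        act_c = endo_mat 3 (\<lambda>i. if i = 2 then zero else v i) \<rparr>)"

definition um_A :: "'k::field \<times> 'k \<Rightarrow> nat \<Rightarrow> 'k um_rep" where
  "um_A x r =
    (let x1 = fst x; x2 = snd x; z = basis_vec (4 * r); zero = 0\<^sub>v (4 * r) in
      \<lparr> mdim = 4 * r,
        act_a = endo_mat (4 * r) (\<lambda>i.
          if i mod 4 = 2 then z (i + 1)
          else if i mod 4 = 3 then z (i + 1)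
          else if i mod 4 = 0 then zero
          else if x1 \<noteq> x2 then
            (if i = 1 then x1 \<cdot>\<^sub>v z 2 else x1 \<cdot>\<^sub>v z (i + 1) + x2 \<cdot>\<^sub>v z (i - 3))
          else (if i = 1 then z 2 else z (i + 1))),
        act_b = endo_mat (4 * r) (\<lambda>i.
          if i mod 4 = 2 then zero
          else if i mod 4 = 3 then z (i - 1)
          else if i mod 4 = 0 then z (i - 1)
          else if x1 \<noteq> x2 then
            (if i = 1 then x2 \<cdot>\<^sub>v z 4 else x1 \<cdot>\<^sub>v z (i - 1) + x2 \<cdot>\<^sub>v z (i + 3))
          else (if i = 1 then z 4 else z (i - 1) + z (i + 3))),
        act_c = endo_mat (4 * r) (\<lambda>i. if even i then z i else zero) \<rparr>)"

definition um_B :: "'k::field \<times> 'k \<Rightarrow> nat \<Rightarrow> 'k um_rep" where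
  "um_B x r = um_dual (um_A x r)"

text \<open>The point of the projective line represented by a nonzero \<open>x\<close>.\<close>

definition proj_point :: "'k::field \<times> 'k \<Rightarrow> ('k \<times> 'k) set" where
  "proj_point x = {(l * fst x, l * snd x) | l. l \<noteq> 0}"

end

theory Submission
  imports Defs "HOL-Library.Product_Plus" "HOL-Library.Function_Algebras"
begin

text \<open>
  Write \<open>A\<^sub>x(r)\<close> as a pair \<open>(p, q)\<close> of commuting pencils in a nilpotent shift: \<open>a\<close> maps the head into the
  first and \<open>b\<close> into the third basis vector of copies of \<open>V\<^sub>1\<close>. Then \<open>A\<^sub>x(r) \<otimes> A\<^sub>y(s)\<close> is defined over the
  commutative ring \<open>k[N, N']/(N\<^sup>r, N'\<^sup>s)\<close>. Since \<open>V\<^sub>1 \<otimes> V\<^sub>1 = V\<^sub>0 \<oplus> P\<^sub>1\<close>, a change of basis over this ring splits off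
  a free summand with fibre \<open>P\<^sub>1\<close> and leaves a module with three layers, described by the Koszul square
  \<open>U \<rightarrow> U\<^sup>2 \<rightarrow> U\<close> of \<open>(p, p')\<close> and \<open>(q, q')\<close>. For different points \<open>p q' - q p'\<close> is invertible and the square is
  projective. For equal points it is a unit multiple of \<open>N + N'\<close>, whose kernel and cokernel are isomorphic to
  \<open>k[N]/(N\<^sup>t)\<close>; they account for the summands \<open>A\<^sub>x(t)\<close> and \<open>B\<^sub>x(t)\<close>. The tensor product \<open>A \<otimes> B\<close> gives the same
  square with the roles of \<open>V\<^sub>0\<close> and \<open>V\<^sub>1\<close> exchanged, and \<open>B \<otimes> B\<close> is dual to \<open>A \<otimes> A\<close>.
\<close>

section \<open>Matrices as operators on finitely supported functions\<close>

text \<open>The statement concerns matrices, while the argument is linear algebra over a commutative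
  ring. The ring is never constructed: matrices act on functions on \<open>nat\<close> that vanish
  from some index on, so N is \<open>f (Suc k)\<close>, truncation is automatic, and linearity over
  the ring means commuting with the shifts. Characteristic 2 enters in three ways. Signs vanish, so
  the adjugate of a 2 by 2 matrix has none. Frobenius makes a high power of a pencil scalar. The
  invariant vector of V1 \<otimes> V1 has value 3 = 1 under the invariant pairing, which is why V0
  splits off. For equal points the obstacle is that kernel and cokernel of N + N' split off over
  k[N] but not over k[N, N']. Hence p' and q' have to leave the square before it is split. If m c1 +
  n c2 = 1, then h = m p + n q is a unit, and an elementary operation with h replaces (p', q') by
  scalar multiples of N + N'. P0 and P1 are arbitrary projective covers; uniqueness reduces them to
  explicit eight-dimensional modules given by one generator and a few relations.\<close>

definition mat_fun :: "'k::field mat \<Rightarrow> (nat \<Rightarrow> 'k) \<Rightarrow> nat \<Rightarrow> 'k" where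
  "mat_fun X f = (\<lambda>i. if i < dim_row X then \<Sum>j<dim_col X. X $$ (i, j) * f j else 0)"

definition supp_below :: "nat \<Rightarrow> (nat \<Rightarrow> 'v::zero) set" where
  "supp_below n = {f. \<forall>i\<ge>n. f i = 0}"

definition delta_fun :: "nat \<Rightarrow> nat \<Rightarrow> 'k::field" where
  "delta_fun j = (\<lambda>i. if i = j then 1 else 0)"

definition fun_mat :: "nat \<Rightarrow> nat \<Rightarrow> ((nat \<Rightarrow> 'k::field) \<Rightarrow> nat \<Rightarrow> 'k) \<Rightarrow> 'k mat" where
  "fun_mat n m \<phi> = mat n m (\<lambda>(i, j). \<phi> (delta_fun j) i)"

lemma fun_mat_carrier [simp]: "fun_mat n m \<phi> \<in> carrier_mat n m"
  by (simp add: fun_mat_def)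

lemma mat_fun_add: "mat_fun X (\<lambda>i. f i + g i) = (\<lambda>i. mat_fun X f i + mat_fun X g i)"
  by (auto simp: mat_fun_def algebra_simps sum.distrib)

lemma mat_fun_plus: "mat_fun X (f + g) = mat_fun X f + mat_fun X g"
  by (auto simp: mat_fun_def algebra_simps sum.distrib plus_fun_def)

lemma mat_fun_smult: "mat_fun X (\<lambda>i. c * f i) = (\<lambda>i. c * mat_fun X f i)"
  by (auto simp: mat_fun_def sum_distrib_left algebra_simps)

lemma mat_fun_supp: "X \<in> carrier_mat n m \<Longrightarrow> mat_fun X f \<in> supp_below n"
  by (auto simp: mat_fun_def supp_below_def)

lemma mat_fun_mult:
  assumes "X \<in> carrier_mat n m" "Y \<in> carrier_mat m l"
  shows "mat_fun (X * Y) f = mat_fun X (mat_fun Y f)"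
proof
  fix i
  show "mat_fun (X * Y) f i = mat_fun X (mat_fun Y f) i"
  proof (cases "i < n")
    case True
    have "mat_fun (X * Y) f i = (\<Sum>j<l. (\<Sum>k<m. X $$ (i, k) * Y $$ (k, j)) * f j)"
      using assms True by (auto simp: mat_fun_def scalar_prod_def atLeast0LessThan intro!: sum.cong)
    also have "\<dots> = (\<Sum>j<l. \<Sum>k<m. X $$ (i, k) * (Y $$ (k, j) * f j))"
      by (simp add: sum_distrib_right mult.assoc)
    also have "\<dots> = (\<Sum>k<m. \<Sum>j<l. X $$ (i, k) * (Y $$ (k, j) * f j))"
      by (rule sum.swap)
    also have "\<dots> = mat_fun X (mat_fun Y f) i"
      using assms True by (auto simp: mat_fun_def sum_distrib_left intro!: sum.cong)
    finally show ?thesis .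
  qed (use assms in \<open>auto simp: mat_fun_def\<close>)
qed

lemma mat_fun_add_mat:
  assumes "X \<in> carrier_mat n m" "Y \<in> carrier_mat n m"
  shows "mat_fun (X + Y) f = (\<lambda>i. mat_fun X f i + mat_fun Y f i)"
  using assms by (auto simp: mat_fun_def algebra_simps sum.distrib intro!: ext)

lemma mat_fun_one: "f \<in> supp_below n \<Longrightarrow> mat_fun (1\<^sub>m n) f = f"
proof
  fix i assume "f \<in> supp_below n"
  have "(\<Sum>j<n. 1\<^sub>m n $$ (i, j) * f j) = (\<Sum>j<n. if j = i then f j else 0)" if "i < n"
    using that by (intro sum.cong) auto
  then show "mat_fun (1\<^sub>m n) f i = f i"
    using \<open>f \<in> supp_below n\<close> by (auto simp: mat_fun_def supp_below_def)
qed

lemma delta_fun_supp: "j < n \<Longrightarrow> delta_fun j \<in> supp_below n"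
  by (auto simp: delta_fun_def supp_below_def)

lemma mat_fun_delta: "j < dim_col X \<Longrightarrow> i < dim_row X \<Longrightarrow> mat_fun X (delta_fun j) i = X $$ (i, j)"
  by (auto simp: mat_fun_def delta_fun_def if_distrib cong: if_cong)

lemma mat_fun_eqI:
  assumes "X \<in> carrier_mat n m" "Y \<in> carrier_mat n m"
    and "\<And>f. f \<in> supp_below m \<Longrightarrow> mat_fun X f = mat_fun Y f"
  shows "X = Y"
proof (rule eq_matI)
  fix i j assume "i < dim_row Y" "j < dim_col Y"
  then show "X $$ (i, j) = Y $$ (i, j)"
    using assms(1,2) assms(3)[OF delta_fun_supp[of j m]] mat_fun_delta[of j X i] mat_fun_delta[of j Y i] by auto
qed (use assms in auto)

lemma zero_supp [simp]: "(\<lambda>_. 0) \<in> supp_below n" "0 \<in> supp_below n"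
  by (auto simp: supp_below_def zero_fun_def)

text \<open>Additivity and homogeneity expand f over the delta functions, by induction on the length
  of an initial segment of f. This turns an abstract linear map between supported functions back
  into a matrix.\<close>

lemma mat_fun_fun_mat:
  fixes \<phi> :: "(nat \<Rightarrow> 'k::field) \<Rightarrow> nat \<Rightarrow> 'k"
  assumes add: "\<And>f g. f \<in> supp_below m \<Longrightarrow> g \<in> supp_below m \<Longrightarrow> \<phi> (f + g) = \<phi> f + \<phi> g"
    and sm: "\<And>c f. f \<in> supp_below m \<Longrightarrow> \<phi> (\<lambda>i. c * f i) = (\<lambda>i. c * \<phi> f i)"
    and cl: "\<And>f. f \<in> supp_below m \<Longrightarrow> \<phi> f \<in> supp_below n"
    and f: "f \<in> supp_below m"
  shows "mat_fun (fun_mat n m \<phi>) f = \<phi> f"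
proof -
  have z: "\<phi> (\<lambda>_. 0) = (\<lambda>_. 0)"
    using sm[of "\<lambda>_. 0" 0] by simp
  have part: "\<phi> (\<lambda>i. if i < l then f i else 0) = (\<lambda>i. \<Sum>j<l. f j * \<phi> (delta_fun j) i)" if "l \<le> m" for l
    using that
  proof (induction l)
    case 0
    then show ?case using z by simp
  next
    case (Suc l)
    have "(\<lambda>i. if i < Suc l then f i else 0)
        = (\<lambda>i. if i < l then f i else 0) + (\<lambda>i. f l * delta_fun l i)"
      by (auto simp: delta_fun_def fun_eq_iff plus_fun_def less_Suc_eq)
    moreover have "(\<lambda>i. f l * delta_fun l i) \<in> supp_below m" "(\<lambda>i. if i < l then f i else 0) \<in> supp_below m"
      using Suc by (auto simp: supp_below_def delta_fun_def)
    moreover have "delta_fun l \<in> supp_below m"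
      using Suc by (auto intro: delta_fun_supp)
    ultimately have "\<phi> (\<lambda>i. if i < Suc l then f i else 0)
        = (\<lambda>i. \<Sum>j<l. f j * \<phi> (delta_fun j) i) + (\<lambda>i. f l * \<phi> (delta_fun l) i)"
      using add sm[of "delta_fun l" "f l"] Suc by simp
    then show ?case
      by (simp add: plus_fun_def)
  qed
  have "(\<lambda>i. if i < m then f i else 0) = f"
    using f by (auto simp: supp_below_def fun_eq_iff)
  then have e: "\<phi> f = (\<lambda>i. \<Sum>j<m. f j * \<phi> (delta_fun j) i)"
    using part[of m] by simp
  have "\<phi> f \<in> supp_below n"
    using cl f by blast
  then show ?thesis
    unfolding mat_fun_def fun_mat_def by (rule_tac ext) (auto simp: e supp_below_def mult.commute)
qed

text \<open>If p < q, padding X with zero rows and Y with zero columns to size q keeps Y' * X' = 1.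
  For square matrices the other product is then 1 as well, but row p of X' is zero, so its entry at
  (p, p) is 0.\<close>

lemma inverse_pair_square:
  fixes F G :: "'k::field mat"
  assumes F: "F \<in> carrier_mat n m" and G: "G \<in> carrier_mat m n"
    and 1: "F * G = 1\<^sub>m n" and 2: "G * F = 1\<^sub>m m"
  shows "n = m"
proof -
  have no: False if X: "X \<in> carrier_mat p q" and Y: "Y \<in> carrier_mat q p" and YX: "Y * X = 1\<^sub>m q" and pq: "p < q"
    for X Y :: "'k mat" and p q
  proof -
    define X' where "X' = mat q q (\<lambda>(i, j). if i < p then X $$ (i, j) else 0)"
    define Y' where "Y' = mat q q (\<lambda>(i, j). if j < p then Y $$ (i, j) else 0)"
    have c: "X' \<in> carrier_mat q q" "Y' \<in> carrier_mat q q"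
      by (auto simp: X'_def Y'_def)
    have "Y' * X' = Y * X"
    proof (rule eq_matI)
      fix i j assume "i < dim_row (Y * X)" "j < dim_col (Y * X)"
      then have ij: "i < q" "j < q" using X Y by auto
      have "(Y' * X') $$ (i, j) = (\<Sum>k<q. Y' $$ (i, k) * X' $$ (k, j))"
        using ij c by (auto simp: scalar_prod_def atLeast0LessThan)
      also have "\<dots> = (\<Sum>k<q. if k < p then Y $$ (i, k) * X $$ (k, j) else 0)"
        using ij by (auto simp: X'_def Y'_def intro!: sum.cong)
      also have "\<dots> = (\<Sum>k<p. Y $$ (i, k) * X $$ (k, j))"
        using pq by (intro sum.mono_neutral_cong_right) auto
      also have "\<dots> = (Y * X) $$ (i, j)"
        using ij X Y by (auto simp: scalar_prod_def atLeast0LessThan)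
      finally show "(Y' * X') $$ (i, j) = (Y * X) $$ (i, j)" .
    qed (use X Y c in auto)
    then have "Y' * X' = 1\<^sub>m q"
      using YX by simp
    then have "X' * Y' = 1\<^sub>m q"
      by (rule mat_mult_left_right_inverse[OF c(2,1)])
    then have "(X' * Y') $$ (p, p) = 1"
      using pq by simp
    moreover have "(X' * Y') $$ (p, p) = 0"
      using c pq by (auto simp: scalar_prod_def X'_def)
    ultimately show False by simp
  qed
  show ?thesis
    using no[OF F G 2] no[OF G F 1] by (meson linorder_neqE_nat)
qed

section \<open>Spaces inside a type, linear isomorphisms and representations by two
  operators\<close>

record ('k, 'v) kspace =
  carr :: "'v set"
  smul :: "'k \<Rightarrow> 'v \<Rightarrow> 'v"

text \<open>Only a and b are recorded: in a module c = ab + ba, so every map that commutes with a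
  and b commutes with c.\<close>

record ('k, 'v) op_rep = "('k, 'v) kspace" +
  opa :: "'v \<Rightarrow> 'v"
  opb :: "'v \<Rightarrow> 'v"

definition lin_map :: "('k, 'v::ab_group_add, 'm) kspace_scheme \<Rightarrow> ('k, 'w::ab_group_add, 'n) kspace_scheme \<Rightarrow> ('v \<Rightarrow> 'w) \<Rightarrow> bool" where
  "lin_map V W f \<longleftrightarrow> (\<forall>x\<in>carr V. f x \<in> carr W \<and> (\<forall>c. f (smul V c x) = smul W c (f x)) \<and>
     (\<forall>y\<in>carr V. f (x + y) = f x + f y))"

definition subsp :: "('k, 'v::ab_group_add, 'm) kspace_scheme \<Rightarrow> bool" where
  "subsp V \<longleftrightarrow> 0 \<in> carr V \<and> (\<forall>x\<in>carr V. (\<forall>c. smul V c x \<in> carr V) \<and> (\<forall>y\<in>carr V. x + y \<in> carr V))"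

text \<open>Linearity is demanded of the domain and of f alone. That W is a subspace and g is linear
  follows, as \<open>lin_iso_sym\<close> shows, which keeps the verification of explicit maps
  short.\<close>

definition lin_iso :: "('v \<Rightarrow> 'w) \<Rightarrow> ('w \<Rightarrow> 'v) \<Rightarrow> ('k, 'v::ab_group_add, 'm) kspace_scheme \<Rightarrow> ('k, 'w::ab_group_add, 'n) kspace_scheme \<Rightarrow> bool" where
  "lin_iso f g V W \<longleftrightarrow> subsp V \<and> lin_map V W f \<and> (\<forall>x\<in>carr V. g (f x) = x) \<and>
     (\<forall>y\<in>carr W. g y \<in> carr V \<and> f (g y) = y)"

definition op_rep_ok :: "('k, 'v::ab_group_add) op_rep \<Rightarrow> bool" where
  "op_rep_ok R \<longleftrightarrow> subsp R \<and> lin_map R R (opa R) \<and> lin_map R R (opb R)"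

definition rep_iso :: "('k, 'v::ab_group_add) op_rep \<Rightarrow> ('k, 'w::ab_group_add) op_rep \<Rightarrow> bool" where
  "rep_iso R S \<longleftrightarrow> op_rep_ok R \<and> (\<exists>f g. lin_iso f g R S \<and>
     (\<forall>x\<in>carr R. f (opa R x) = opa S (f x) \<and> f (opb R x) = opb S (f x)))"

lemma rep_isoI:
  assumes "op_rep_ok R" "lin_iso f g R S" "\<And>x. x \<in> carr R \<Longrightarrow> f (opa R x) = opa S (f x)"
    "\<And>x. x \<in> carr R \<Longrightarrow> f (opb R x) = opb S (f x)"
  shows "rep_iso R S"
  using assms unfolding rep_iso_def by blast

lemma lin_isoI:
  assumes "subsp V" "\<And>x. x \<in> carr V \<Longrightarrow> f x \<in> carr W" "\<And>c x. x \<in> carr V \<Longrightarrow> f (smul V c x) = smul W c (f x)"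
    "\<And>x y. x \<in> carr V \<Longrightarrow> y \<in> carr V \<Longrightarrow> f (x + y) = f x + f y" "\<And>x. x \<in> carr V \<Longrightarrow> g (f x) = x"
    "\<And>y. y \<in> carr W \<Longrightarrow> g y \<in> carr V" "\<And>y. y \<in> carr W \<Longrightarrow> f (g y) = y"
  shows "lin_iso f g V W"
  using assms by (auto simp: lin_iso_def lin_map_def)

lemma lin_map_0: "lin_map V W f \<Longrightarrow> 0 \<in> carr V \<Longrightarrow> f 0 = 0"
  unfolding lin_map_def by (metis add.right_neutral add_left_cancel)

lemma lin_iso_sym: 
  assumes "lin_iso f g V W"
  shows "lin_iso g f W V"
proof -
  have V: "0 \<in> carr V" "\<And>c x. x \<in> carr V \<Longrightarrow> smul V c x \<in> carr V" "\<And>x y. x \<in> carr V \<Longrightarrow> y \<in> carr V \<Longrightarrow> x + y \<in> carr V"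
    and f: "lin_map V W f" 
    and fc: "\<And>x. x \<in> carr V \<Longrightarrow> f x \<in> carr W" "\<And>c x. x \<in> carr V \<Longrightarrow> f (smul V c x) = smul W c (f x)"
       "\<And>x y. x \<in> carr V \<Longrightarrow> y \<in> carr V \<Longrightarrow> f (x + y) = f x + f y" "\<And>x. x \<in> carr V \<Longrightarrow> g (f x) = x"
    and g: "\<And>y. y \<in> carr W \<Longrightarrow> g y \<in> carr V" "\<And>y. y \<in> carr W \<Longrightarrow> f (g y) = y"
    using assms unfolding lin_iso_def lin_map_def subsp_def by blast+
  have s: "smul W c y = f (smul V c (g y))" if "y \<in> carr W" for c y
    using that fc g by metis
  have a: "x + y = f (g x + g y)" if "x \<in> carr W" "y \<in> carr W" for x y
    using that fc g by metis
  have z: "0 \<in> carr W"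
    using lin_map_0[OF f V(1)] fc(1)[OF V(1)] by simp
  have "g (smul W c y) = smul V c (g y)" "smul W c y \<in> carr W" if "y \<in> carr W" for c y
    unfolding s[OF that] using fc(1,4) V(2) g(1) that by auto
  moreover have "g (x + y) = g x + g y" "x + y \<in> carr W" if "x \<in> carr W" "y \<in> carr W" for x y
    unfolding a[OF that] using fc(1,4) V(3) g(1) that by auto
  ultimately show ?thesis
    unfolding lin_iso_def lin_map_def subsp_def using fc(1,4) g z by auto
qed

lemma lin_iso_trans: 
  assumes "lin_iso f g V W" "lin_iso f' g' W X"
  shows "lin_iso (\<lambda>x. f' (f x)) (\<lambda>x. g (g' x)) V X"
  using assms unfolding lin_iso_def lin_map_def subsp_def by auto

text \<open>On the target the operators are conjugates f a g and f b g of linear ones. Thus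
  well-formedness of a complicated representation is inherited along a chain of
  isomorphisms.\<close>

lemma rep_iso_okD: assumes "rep_iso R S" shows "op_rep_ok R" "op_rep_ok S"
proof -
  obtain f g where R: "op_rep_ok R" and iso: "lin_iso f g R S"
    and int: "\<And>x. x\<in>carr R \<Longrightarrow> f (opa R x) = opa S (f x)" "\<And>x. x\<in>carr R \<Longrightarrow> f (opb R x) = opb S (f x)"
    using assms unfolding rep_iso_def by auto
  show "op_rep_ok R" by (rule R)
  have g: "lin_map S R g" and S: "subsp S" and gf: "\<And>x. x \<in> carr R \<Longrightarrow> g (f x) = x" and fg: "\<And>y. y \<in> carr S \<Longrightarrow> f (g y) = y"
     and f: "lin_map R S f"
    using lin_iso_sym[OF iso] iso unfolding lin_iso_def by auto
  have gm: "\<And>y. y \<in> carr S \<Longrightarrow> g y \<in> carr R" using g unfolding lin_map_def by auto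
  have eq: "opa S y = f (opa R (g y))" "opb S y = f (opb R (g y))" if "y \<in> carr S" for y
    using int[OF gm[OF that]] fg[OF that] by auto
  have "lin_map S S (\<lambda>y. f (opa R (g y)))" "lin_map S S (\<lambda>y. f (opb R (g y)))"
    using R f g unfolding op_rep_ok_def lin_map_def by auto
  moreover have "lin_map S S (\<lambda>y. f (opa R (g y))) = lin_map S S (opa S)" 
      "lin_map S S (\<lambda>y. f (opb R (g y))) = lin_map S S (opb S)"
    using eq S unfolding lin_map_def subsp_def by auto
  ultimately show "op_rep_ok S"
    using S unfolding op_rep_ok_def by simp
qed

lemma rep_iso_sym: assumes "rep_iso R S" shows "rep_iso S R"
proof -
  obtain f g where R: "op_rep_ok R" and iso: "lin_iso f g R S"
    and int: "\<And>x. x\<in>carr R \<Longrightarrow> f (opa R x) = opa S (f x)" "\<And>x. x\<in>carr R \<Longrightarrow> f (opb R x) = opb S (f x)"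
    using assms unfolding rep_iso_def by auto
  have inv: "lin_iso g f S R" by (rule lin_iso_sym[OF iso])
  have "g (opa S y) = opa R (g y) \<and> g (opb S y) = opb R (g y)" if "y \<in> carr S" for y
  proof -
    have "g y \<in> carr R" "f (g y) = y"
      using iso that unfolding lin_iso_def by auto
    moreover have "opa R (g y) \<in> carr R" "opb R (g y) \<in> carr R"
      using R \<open>g y \<in> carr R\<close> unfolding op_rep_ok_def lin_map_def by auto
    ultimately show ?thesis
      using int iso unfolding lin_iso_def by metis
  qed
  then show ?thesis
    unfolding rep_iso_def using inv rep_iso_okD[OF assms] by auto
qed

lemma rep_iso_trans [trans]: assumes "rep_iso R S" "rep_iso S T" shows "rep_iso R T"
proof -
  obtain f g where R: "op_rep_ok R" and iso: "lin_iso f g R S"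
    and int: "\<And>x. x\<in>carr R \<Longrightarrow> f (opa R x) = opa S (f x)" "\<And>x. x\<in>carr R \<Longrightarrow> f (opb R x) = opb S (f x)"
    using assms unfolding rep_iso_def by auto
  obtain f' g' where iso': "lin_iso f' g' S T"
    and int': "\<And>x. x\<in>carr S \<Longrightarrow> f' (opa S x) = opa T (f' x)" "\<And>x. x\<in>carr S \<Longrightarrow> f' (opb S x) = opb T (f' x)"
    using assms unfolding rep_iso_def by auto
  have "\<And>x. x \<in> carr R \<Longrightarrow> f x \<in> carr S"
    using iso unfolding lin_iso_def lin_map_def by auto
  then show ?thesis
    unfolding rep_iso_def using R lin_iso_trans[OF iso iso'] int int' by (intro conjI exI) auto
qed

lemma rep_iso_refl: "op_rep_ok R \<Longrightarrow> rep_iso R R"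
  unfolding rep_iso_def lin_iso_def op_rep_ok_def lin_map_def by (intro conjI exI[of _ "\<lambda>x. x"]) auto

section \<open>From matrix modules to operators and back\<close>

definition fun_rep :: "'k::field um_rep \<Rightarrow> ('k, nat \<Rightarrow> 'k) op_rep" where
  "fun_rep M = \<lparr> carr = supp_below (mdim M), smul = (\<lambda>c f i. c * f i), opa = mat_fun (act_a M), opb = mat_fun (act_b M) \<rparr>"

text \<open>This is the part of the module axioms that must be known before an isomorphism is
  available; the remaining relations are then transported from the other side.\<close>

definition um_pre :: "'k::field um_rep \<Rightarrow> bool" where
  "um_pre M \<longleftrightarrow> act_a M \<in> carrier_mat (mdim M) (mdim M) \<and> act_b M \<in> carrier_mat (mdim M) (mdim M) \<and>
    act_c M \<in> carrier_mat (mdim M) (mdim M) \<and> act_a M * act_b M + act_b M * act_a M = act_c M"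

lemma um_module_pre: "um_module M \<Longrightarrow> um_pre M"
  by (auto simp: um_module_def um_pre_def Let_def)

lemma pow_mat_2: "X \<in> carrier_mat n n \<Longrightarrow> X ^\<^sub>m 2 = X * X"
  by (simp add: numeral_2_eq_2)

lemma pow_mat_4: "X \<in> carrier_mat n n \<Longrightarrow> X ^\<^sub>m 4 = X * X * X * X"
  by (simp add: eval_nat_numeral)

lemma subsp_supp: "subsp \<lparr> carr = supp_below n, smul = (\<lambda>c (f::nat \<Rightarrow> 'k::field) i. c * f i), \<dots> = m\<rparr>"
  by (auto simp: subsp_def supp_below_def plus_fun_def zero_fun_def)

lemma fun_rep_ok: "um_pre M \<Longrightarrow> op_rep_ok (fun_rep M)"
  unfolding op_rep_ok_def fun_rep_def um_pre_def
  by (auto simp: subsp_supp lin_map_def mat_fun_smult mat_fun_plus intro: mat_fun_supp)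

text \<open>F intertwines c because c is the anticommutator on both sides. Each remaining relation
  of N pulls back: F times the relation of M equals the relation of N times F, and F cancels on the
  left. So a tensor product needs no separate proof of the module axioms once it is identified with
  a known module.\<close>

lemma um_isoI:
  assumes M: "um_pre M" and N: "um_module N"
    and F: "F \<in> carrier_mat (mdim N) (mdim M)" and G: "G \<in> carrier_mat (mdim M) (mdim N)"
    and FG: "F * G = 1\<^sub>m (mdim N)" and GF: "G * F = 1\<^sub>m (mdim M)"
    and a: "F * act_a M = act_a N * F" and b: "F * act_b M = act_b N * F"
  shows "um_iso M N"
proof -
  let ?n = "mdim M"
  have n: "mdim N = ?n"
    using inverse_pair_square[OF F G FG GF] .
  define A B C where ABC: "A = act_a M" "B = act_b M" "C = act_c M"
  define A' B' C' where ABC': "A' = act_a N" "B' = act_b N" "C' = act_c N"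
  have c: "A \<in> carrier_mat ?n ?n" "B \<in> carrier_mat ?n ?n" "C \<in> carrier_mat ?n ?n" 
      and C: "A * B + B * A = C"
    using M unfolding um_pre_def ABC by auto
  have c': "A' \<in> carrier_mat ?n ?n" "B' \<in> carrier_mat ?n ?n" "C' \<in> carrier_mat ?n ?n"
    and rel: "A' * B' + B' * A' = C'" "A' * C' + C' * A' = A'" "B' * C' + C' * B' = B'"
      "A' ^\<^sub>m 4 = 0\<^sub>m ?n ?n" "B' ^\<^sub>m 4 = 0\<^sub>m ?n ?n" "C' ^\<^sub>m 2 + C' = 0\<^sub>m ?n ?n"
    using N n unfolding um_module_def Let_def ABC' by auto
  have F: "F \<in> carrier_mat ?n ?n" and G: "G \<in> carrier_mat ?n ?n"
    using F G n by auto
  have mm: "F * (X * Y) = X' * Y' * F" if "F * X = X' * F" "F * Y = Y' * F" "X \<in> carrier_mat ?n ?n" "Y \<in> carrier_mat ?n ?n"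
     "X' \<in> carrier_mat ?n ?n" "Y' \<in> carrier_mat ?n ?n" for X Y X' Y'
  proof -
    have "F * (X * Y) = F * X * Y" using that F by (intro assoc_mult_mat[symmetric, of _ ?n ?n _ ?n _ ?n])
    also have "\<dots> = X' * (F * Y)" using that F by (simp add: assoc_mult_mat[of _ ?n ?n _ ?n _ ?n])
    also have "\<dots> = X' * Y' * F" using that F by (simp add: assoc_mult_mat[of _ ?n ?n _ ?n _ ?n])
    finally show ?thesis .
  qed
  have pp: "F * (X + Y) = (X' + Y') * F" if "F * X = X' * F" "F * Y = Y' * F" "X \<in> carrier_mat ?n ?n" "Y \<in> carrier_mat ?n ?n"
     "X' \<in> carrier_mat ?n ?n" "Y' \<in> carrier_mat ?n ?n" for X Y X' Y'
    using that F by (simp add: mult_add_distrib_mat[of _ ?n ?n] add_mult_distrib_mat[of _ ?n ?n])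
  have a: "F * A = A' * F" and b: "F * B = B' * F"
    using a b by (auto simp: ABC ABC')
  have cc: "F * C = C' * F"
    unfolding C[symmetric] rel(1)[symmetric] using c c' by (intro pp mm a b) auto
  have canc: "X = Y" if "F * X = F * Y" "X \<in> carrier_mat ?n ?n" "Y \<in> carrier_mat ?n ?n" for X Y
  proof -
    have "G * F * X = G * F * Y" using that F G by (simp add: assoc_mult_mat[of _ ?n ?n _ ?n _ ?n])
    then show ?thesis using GF that by simp
  qed
  have "F * (A * C + C * A) = (A' * C' + C' * A') * F"
    by (intro pp mm a cc) (use c c' in auto)
  then have "F * (A * C + C * A) = F * A"
    by (simp only: rel(2) a)
  then have 1: "A * C + C * A = A" using c by (rule_tac canc) auto
  have "F * (B * C + C * B) = (B' * C' + C' * B') * F"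
    by (intro pp mm b cc) (use c c' in auto)
  then have "F * (B * C + C * B) = F * B"
    by (simp only: rel(3) b)
  then have 2: "B * C + C * B = B" using c by (rule_tac canc) auto
  have p4: "F * (X ^\<^sub>m 4) = X' ^\<^sub>m 4 * F" if "F * X = X' * F" "X \<in> carrier_mat ?n ?n"
     "X' \<in> carrier_mat ?n ?n" for X X'
    unfolding pow_mat_4[OF that(2)] pow_mat_4[OF that(3)] by (intro mm that(1)) (use that in auto)
  have "F * (A ^\<^sub>m 4) = F * 0\<^sub>m ?n ?n"
    using p4[OF a] c c' F by (simp only: rel(4)) simp
  then have 3: "A ^\<^sub>m 4 = 0\<^sub>m ?n ?n" using c by (rule_tac canc) auto
  have "F * (B ^\<^sub>m 4) = F * 0\<^sub>m ?n ?n"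
    using p4[OF b] c c' F by (simp only: rel(5)) simp
  then have 4: "B ^\<^sub>m 4 = 0\<^sub>m ?n ?n" using c by (rule_tac canc) auto
  have "F * (C ^\<^sub>m 2 + C) = (C' ^\<^sub>m 2 + C') * F"
    unfolding pow_mat_2[OF c(3)] pow_mat_2[OF c'(3)] by (intro pp mm cc) (use c c' in auto)
  then have "F * (C ^\<^sub>m 2 + C) = F * 0\<^sub>m ?n ?n"
    using F by (simp only: rel(6)) simp
  then have 5: "C ^\<^sub>m 2 + C = 0\<^sub>m ?n ?n" using c by (rule_tac canc) auto
  have "um_module M"
    unfolding um_module_def Let_def using c C 1 2 3 4 5 unfolding ABC by blast
  moreover have "F \<in> um_hom M N"
    unfolding um_hom_def using F n a b cc unfolding ABC ABC' by auto
  moreover have "invertible_mat F"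
    using F G FG GF n by (auto simp: invertible_mat_def inverts_mat_def)
  ultimately show ?thesis
    unfolding um_iso_def using N by blast
qed

lemma um_iso_of_rep_iso:
  assumes M: "um_pre M" and N: "um_module N" and iso: "rep_iso (fun_rep M) (fun_rep N)"
  shows "um_iso M N"
proof -
  let ?m = "mdim M" and ?n = "mdim N"
  obtain f g where fg: "lin_iso f g (fun_rep M) (fun_rep N)"
    and int: "\<And>x. x\<in>carr (fun_rep M) \<Longrightarrow> f (opa (fun_rep M) x) = opa (fun_rep N) (f x)" "\<And>x. x\<in>carr (fun_rep M) \<Longrightarrow> f (opb (fun_rep M) x) = opb (fun_rep N) (f x)"
    using iso unfolding rep_iso_def by auto
  have N': "um_pre N" using um_module_pre[OF N] .
  define F where "F = fun_mat ?n ?m f"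
  define G where "G = fun_mat ?m ?n g"
  have c: "F \<in> carrier_mat ?n ?m" "G \<in> carrier_mat ?m ?n" by (auto simp: F_def G_def)
  have lm: "lin_map (fun_rep M) (fun_rep N) f" "lin_map (fun_rep N) (fun_rep M) g"
    using fg lin_iso_sym[OF fg] unfolding lin_iso_def by auto
  have oF: "mat_fun F x = f x" if "x \<in> supp_below ?m" for x
    unfolding F_def using that lm(1) unfolding lin_map_def fun_rep_def by (intro mat_fun_fun_mat) auto
  have oG: "mat_fun G x = g x" if "x \<in> supp_below ?n" for x
    unfolding G_def using that lm(2) unfolding lin_map_def fun_rep_def by (intro mat_fun_fun_mat) auto
  have cl: "x \<in> supp_below ?m \<Longrightarrow> f x \<in> supp_below ?n" "x \<in> supp_below ?n \<Longrightarrow> g x \<in> supp_below ?m" for x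
    using lm unfolding lin_map_def fun_rep_def by auto
  have inv: "x \<in> supp_below ?m \<Longrightarrow> g (f x) = x" "x \<in> supp_below ?n \<Longrightarrow> f (g x) = x" for x
    using fg unfolding lin_iso_def fun_rep_def by auto
  have "F * G = 1\<^sub>m ?n"
    by (rule mat_fun_eqI[of _ ?n ?n]) (use c in \<open>auto simp: mat_fun_mult[OF c] oF oG cl inv mat_fun_one\<close>)
  moreover have "G * F = 1\<^sub>m ?m"
    by (rule mat_fun_eqI[of _ ?m ?m]) (use c in \<open>auto simp: mat_fun_mult[OF c(2,1)] oF oG cl inv mat_fun_one\<close>)
  moreover have "F * X = Y * F" if X: "X \<in> carrier_mat ?m ?m" and Y: "Y \<in> carrier_mat ?n ?n"
    and int: "\<And>x. x \<in> supp_below ?m \<Longrightarrow> f (mat_fun X x) = mat_fun Y (f x)" for X Y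
    by (rule mat_fun_eqI[of _ ?n ?m])
       (use c X Y in \<open>auto simp: mat_fun_mult[OF c(1) X] mat_fun_mult[OF Y c(1)] oF int mat_fun_supp[OF X]\<close>)
  then have "F * act_a M = act_a N * F" "F * act_b M = act_b N * F"
    using M N' int unfolding um_pre_def fun_rep_def by simp_all
  ultimately show ?thesis
    using um_isoI[OF M N c] by blast
qed

lemma invertible_matE:
  assumes "invertible_mat F" "F \<in> carrier_mat n m"
  obtains G where "n = m" "G \<in> carrier_mat n n" "F * G = 1\<^sub>m n" "G * F = 1\<^sub>m n"
proof -
  obtain G where *: "square_mat F" "F * G = 1\<^sub>m (dim_row F)" "G * F = 1\<^sub>m (dim_row G)"
    using assms unfolding invertible_mat_def inverts_mat_def by blast
  have "n = m" using * assms by auto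
  moreover have "dim_col G = n" using *(2) assms by (metis index_mult_mat(3) index_one_mat(3) carrier_matD(1))
  moreover have "dim_row G = n" using *(3) assms \<open>n = m\<close> by (metis index_mult_mat(3) index_one_mat(3) carrier_matD(2))
  ultimately show ?thesis using that[of G] * assms by auto
qed

lemma rep_iso_of_um_iso:
  assumes "um_iso M N"
  shows "rep_iso (fun_rep M) (fun_rep N)"
proof -
  obtain F where M: "um_module M" and N: "um_module N" and F: "F \<in> um_hom M N" and inv: "invertible_mat F"
    using assms unfolding um_iso_def by auto
  let ?m = "mdim M" and ?n = "mdim N"
  have c: "F \<in> carrier_mat ?n ?m" and a: "F * act_a M = act_a N * F" and b: "F * act_b M = act_b N * F"
    using F unfolding um_hom_def by auto
  obtain G where n: "?n = ?m" and G: "G \<in> carrier_mat ?m ?m" and FG: "F * G = 1\<^sub>m ?m" and GF: "G * F = 1\<^sub>m ?m"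
    using invertible_matE[OF inv c] by metis
  have pre: "um_pre M" "um_pre N" using M N by (auto intro: um_module_pre)
  have c: "F \<in> carrier_mat ?m ?m" using c n by simp
  have "lin_iso (mat_fun F) (mat_fun G) (fun_rep M) (fun_rep N)"
    unfolding lin_iso_def lin_map_def
    using c G n FG GF
    by (auto simp: fun_rep_def subsp_supp mat_fun_smult mat_fun_plus intro: mat_fun_supp)
       (auto simp: mat_fun_one simp flip: mat_fun_mult[OF c G] mat_fun_mult[OF G c])
  moreover have "mat_fun F (mat_fun (act_a M) x) = mat_fun (act_a N) (mat_fun F x)" "mat_fun F (mat_fun (act_b M) x) = mat_fun (act_b N) (mat_fun F x)" for x
    using pre c n a b unfolding um_pre_def by (metis mat_fun_mult)+
  ultimately show ?thesis
    unfolding rep_iso_def using fun_rep_ok[OF pre(1)] by (intro conjI exI) (auto simp: fun_rep_def)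
qed


section \<open>Three-layer modules and the generic tensor product\<close>

text \<open>A representation of the quiver with three vertices in a row and two parallel arrows
  between neighbours. The squares used here satisfy qc qa = 0, qd qb = 0 and qc qb = qd qa, but the
  module axioms come from elsewhere, so \<open>quad_ok\<close> records only linearity.\<close>

record ('k, 'u, 'w, 'z) quad =
  qU :: "('k, 'u) kspace"
  qW :: "('k, 'w) kspace"
  qZ :: "('k, 'z) kspace"
  qa :: "'u \<Rightarrow> 'w"
  qb :: "'u \<Rightarrow> 'w"
  qc :: "'w \<Rightarrow> 'z"
  qd :: "'w \<Rightarrow> 'z"

definition quad_ok :: "('k, 'u::ab_group_add, 'w::ab_group_add, 'z::ab_group_add) quad \<Rightarrow> bool" where
  "quad_ok Q \<longleftrightarrow> subsp (qU Q) \<and> subsp (qW Q) \<and> subsp (qZ Q) \<and>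
     lin_map (qU Q) (qW Q) (qa Q) \<and> lin_map (qU Q) (qW Q) (qb Q) \<and>
     lin_map (qW Q) (qZ Q) (qc Q) \<and> lin_map (qW Q) (qZ Q) (qd Q)"

definition quad_iso :: "('k, 'u::ab_group_add, 'w::ab_group_add, 'z::ab_group_add) quad \<Rightarrow>
    ('k, 'u2::ab_group_add, 'w2::ab_group_add, 'z2::ab_group_add) quad \<Rightarrow> bool" where
  "quad_iso Q R \<longleftrightarrow> quad_ok Q \<and> (\<exists>f f' g g' h h'.
     lin_iso f f' (qU Q) (qU R) \<and> lin_iso g g' (qW Q) (qW R) \<and> lin_iso h h' (qZ Q) (qZ R) \<and>
     (\<forall>u\<in>carr (qU Q). g (qa Q u) = qa R (f u) \<and> g (qb Q u) = qb R (f u)) \<and>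
     (\<forall>w\<in>carr (qW Q). h (qc Q w) = qc R (g w) \<and> h (qd Q w) = qd R (g w)))"

text \<open>
  In \<open>layers_010\<close> and \<open>layers_101\<close> the spaces \<open>U\<close>, \<open>W\<close>, \<open>Z\<close> of a quiver representation are the multiplicity
  spaces of the top, middle and bottom layer, whose types are \<open>V\<^sub>0, V\<^sub>1, V\<^sub>0\<close> and \<open>V\<^sub>1, V\<^sub>0, V\<^sub>1\<close>.
\<close>

definition layers_010 :: "('k, 'u::ab_group_add, 'w::ab_group_add, 'z::ab_group_add) quad \<Rightarrow> ('k, 'u \<times> ('w \<times> 'w \<times> 'w) \<times> 'z) op_rep" where
  "layers_010 Q = \<lparr> carr = carr (qU Q) \<times> (carr (qW Q) \<times> carr (qW Q) \<times> carr (qW Q)) \<times> carr (qZ Q),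
     smul = (\<lambda>c (u, (w1, w2, w3), z). (smul (qU Q) c u, (smul (qW Q) c w1, smul (qW Q) c w2, smul (qW Q) c w3), smul (qZ Q) c z)),
     opa = (\<lambda>(u, (w1, w2, w3), z). (0, (qa Q u, w1, w2), qc Q w3)),
     opb = (\<lambda>(u, (w1, w2, w3), z). (0, (w2, w3, qb Q u), qd Q w1)) \<rparr>"

text \<open>The terms qc (qb u) in the action of b are forced by c^2 = c. On the top vector u1 the
  composite a b contributes qc (qb u1) in the bottom layer; without the correction c u1 would be u1
  plus that vector, and c would not be idempotent. With it b a contributes the same vector, and the
  two cancel.\<close>

definition layers_101 :: "('k, 'u::ab_group_add, 'w::ab_group_add, 'z::ab_group_add) quad \<Rightarrow> ('k, ('u \<times> 'u \<times> 'u) \<times> 'w \<times> ('z \<times> 'z \<times> 'z)) op_rep" where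
  "layers_101 Q = \<lparr> carr = (carr (qU Q) \<times> carr (qU Q) \<times> carr (qU Q)) \<times> carr (qW Q) \<times> (carr (qZ Q) \<times> carr (qZ Q) \<times> carr (qZ Q)),
     smul = (\<lambda>c ((u1, u2, u3), w, (z1, z2, z3)). ((smul (qU Q) c u1, smul (qU Q) c u2, smul (qU Q) c u3),
       smul (qW Q) c w, (smul (qZ Q) c z1, smul (qZ Q) c z2, smul (qZ Q) c z3))),
     opa = (\<lambda>((u1, u2, u3), w, (z1, z2, z3)). ((0, u1, u2), qa Q u3, (qc Q w, z1, z2))),
     opb = (\<lambda>((u1, u2, u3), w, (z1, z2, z3)). ((u2, u3, 0), qb Q u1,
       (z2 + qc Q (qb Q u2), z3 + qc Q (qb Q u3), qd Q w))) \<rparr>"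

text \<open>Distributivity of scalars yields smul c 0 = 0. This matters because the operators of a
  layered module put 0 into the top layer.\<close>

definition klin :: "('k, 'v::ab_group_add, 'm) kspace_scheme \<Rightarrow> bool" where
  "klin V \<longleftrightarrow> subsp V \<and> (\<forall>c. \<forall>x\<in>carr V. \<forall>y\<in>carr V. smul V c (x + y) = smul V c x + smul V c y)"

lemma klin_0: "klin V \<Longrightarrow> smul V c 0 = 0"
  unfolding klin_def subsp_def by (metis add.right_neutral add_left_cancel)

lemma layers_010_ok: "quad_ok Q \<Longrightarrow> klin (qU Q) \<Longrightarrow> op_rep_ok (layers_010 Q)"
  using klin_0[of "qU Q"]
  by (auto simp: quad_ok_def op_rep_ok_def layers_010_def subsp_def lin_map_def zero_prod_def)

lemma layers_101_ok: 
  assumes "quad_ok Q" "klin (qU Q)" "klin (qZ Q)"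
  shows "op_rep_ok (layers_101 Q)"
proof -
  have *: "\<And>x y. x \<in> carr (qZ Q) \<Longrightarrow> y \<in> carr (qZ Q) \<Longrightarrow> smul (qZ Q) c (x + y) = smul (qZ Q) c x + smul (qZ Q) c y" for c
    using assms unfolding klin_def by auto
  show ?thesis
    using klin_0[OF assms(2)] assms(1)
    by (auto simp: quad_ok_def op_rep_ok_def layers_101_def subsp_def lin_map_def zero_prod_def * add_ac)
qed

lemma layers_010_cong: 
  assumes "quad_iso Q R" "klin (qU Q)"
  shows "rep_iso (layers_010 Q) (layers_010 R)"
proof -
  obtain f f' g g' h h' where ok: "quad_ok Q" and 
     f: "lin_iso f f' (qU Q) (qU R)" and g: "lin_iso g g' (qW Q) (qW R)" and h: "lin_iso h h' (qZ Q) (qZ R)" and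
     i: "\<And>u. u\<in>carr (qU Q) \<Longrightarrow> g (qa Q u) = qa R (f u)" "\<And>u. u\<in>carr (qU Q) \<Longrightarrow> g (qb Q u) = qb R (f u)"
     "\<And>w. w\<in>carr (qW Q) \<Longrightarrow> h (qc Q w) = qc R (g w)" "\<And>w. w\<in>carr (qW Q) \<Longrightarrow> h (qd Q w) = qd R (g w)"
    using assms(1) unfolding quad_iso_def by auto
  have f0: "f 0 = 0"
    using f lin_map_0 unfolding lin_iso_def subsp_def by metis
  have iso: "lin_iso (\<lambda>(u, (w1, w2, w3), z). (f u, (g w1, g w2, g w3), h z)) (\<lambda>(u, (w1, w2, w3), z). (f' u, (g' w1, g' w2, g' w3), h' z)) (layers_010 Q) (layers_010 R)"
    using f g h by (auto simp: lin_iso_def lin_map_def subsp_def layers_010_def zero_prod_def)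
  show ?thesis
    by (rule rep_isoI[OF layers_010_ok[OF ok assms(2)] iso]) (auto simp: layers_010_def f0 i)
qed

lemma layers_101_cong: 
  assumes "quad_iso Q R" "klin (qU Q)" "klin (qZ Q)"
  shows "rep_iso (layers_101 Q) (layers_101 R)"
proof -
  obtain f f' g g' h h' where ok: "quad_ok Q" and 
     f: "lin_iso f f' (qU Q) (qU R)" and g: "lin_iso g g' (qW Q) (qW R)" and h: "lin_iso h h' (qZ Q) (qZ R)" and
     i: "\<And>u. u\<in>carr (qU Q) \<Longrightarrow> g (qa Q u) = qa R (f u)" "\<And>u. u\<in>carr (qU Q) \<Longrightarrow> g (qb Q u) = qb R (f u)"
     "\<And>w. w\<in>carr (qW Q) \<Longrightarrow> h (qc Q w) = qc R (g w)" "\<And>w. w\<in>carr (qW Q) \<Longrightarrow> h (qd Q w) = qd R (g w)"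
    using assms(1) unfolding quad_iso_def by auto
  have f0: "f 0 = 0"
    using f lin_map_0 unfolding lin_iso_def subsp_def by metis
  have iso: "lin_iso (\<lambda>((u1, u2, u3), w, (z1, z2, z3)). ((f u1, f u2, f u3), g w, (h z1, h z2, h z3))) 
      (\<lambda>((u1, u2, u3), w, (z1, z2, z3)). ((f' u1, f' u2, f' u3), g' w, (h' z1, h' z2, h' z3))) (layers_101 Q) (layers_101 R)"
    using f g h by (auto simp: lin_iso_def lin_map_def subsp_def layers_101_def zero_prod_def)
  have c: "\<And>u. u\<in>carr (qU Q) \<Longrightarrow> qb Q u \<in> carr (qW Q)" "\<And>w. w\<in>carr (qW Q) \<Longrightarrow> qc Q w \<in> carr (qZ Q)"
    using ok unfolding quad_ok_def lin_map_def by auto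
  have ha: "\<And>x y. x \<in> carr (qZ Q) \<Longrightarrow> y \<in> carr (qZ Q) \<Longrightarrow> h (x + y) = h x + h y"
    using h unfolding lin_iso_def lin_map_def by auto
  show ?thesis
    by (rule rep_isoI[OF layers_101_ok[OF ok assms(2,3)] iso]) (auto simp: layers_101_def f0 i c ha)
qed

definition kpair :: "('k, 'v, 'm) kspace_scheme \<Rightarrow> ('k, 'w, 'n) kspace_scheme \<Rightarrow> ('k, 'v \<times> 'w) kspace" where
  "kpair V W = \<lparr> carr = carr V \<times> carr W, smul = (\<lambda>c (x, y). (smul V c x, smul W c y)) \<rparr>"

definition rep_prod :: "('k, 'v) op_rep \<Rightarrow> ('k, 'w) op_rep \<Rightarrow> ('k, 'v \<times> 'w) op_rep" where
  "rep_prod R S = \<lparr> carr = carr R \<times> carr S, smul = (\<lambda>c (x, y). (smul R c x, smul S c y)),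
     opa = (\<lambda>(x, y). (opa R x, opa S y)), opb = (\<lambda>(x, y). (opb R x, opb S y)) \<rparr>"

definition qprod :: "('k, 'u, 'w, 'z) quad \<Rightarrow> ('k, 'u2, 'w2, 'z2) quad \<Rightarrow> ('k, 'u \<times> 'u2, 'w \<times> 'w2, 'z \<times> 'z2) quad" where
  "qprod Q R = \<lparr> qU = kpair (qU Q) (qU R), qW = kpair (qW Q) (qW R), qZ = kpair (qZ Q) (qZ R),
     qa = (\<lambda>(x, y). (qa Q x, qa R y)), qb = (\<lambda>(x, y). (qb Q x, qb R y)),
     qc = (\<lambda>(x, y). (qc Q x, qc R y)), qd = (\<lambda>(x, y). (qd Q x, qd R y)) \<rparr>"

lemma subsp_kpair: "subsp V \<Longrightarrow> subsp W \<Longrightarrow> subsp (kpair V W)"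
  by (auto simp: subsp_def kpair_def zero_prod_def)

lemma klin_kpair: "klin V \<Longrightarrow> klin W \<Longrightarrow> klin (kpair V W)"
  by (auto simp: klin_def subsp_kpair) (auto simp: kpair_def)

lemma rep_prod_ok: "op_rep_ok R \<Longrightarrow> op_rep_ok S \<Longrightarrow> op_rep_ok (rep_prod R S)"
  by (auto simp: op_rep_ok_def rep_prod_def subsp_def lin_map_def zero_prod_def)

lemma rep_prod_cong:
  assumes "rep_iso R R'" "rep_iso S S'"
  shows "rep_iso (rep_prod R S) (rep_prod R' S')"
proof -
  obtain f g where 1: "lin_iso f g R R'" "\<And>x. x\<in>carr R \<Longrightarrow> f (opa R x) = opa R' (f x)" "\<And>x. x\<in>carr R \<Longrightarrow> f (opb R x) = opb R' (f x)"
    using assms(1) unfolding rep_iso_def by auto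
  obtain f' g' where 2: "lin_iso f' g' S S'" "\<And>x. x\<in>carr S \<Longrightarrow> f' (opa S x) = opa S' (f' x)" "\<And>x. x\<in>carr S \<Longrightarrow> f' (opb S x) = opb S' (f' x)"
    using assms(2) unfolding rep_iso_def by auto
  have iso: "lin_iso (\<lambda>(x, y). (f x, f' y)) (\<lambda>(x, y). (g x, g' y)) (rep_prod R S) (rep_prod R' S')"
    using 1(1) 2(1) by (auto simp: lin_iso_def lin_map_def subsp_def rep_prod_def zero_prod_def)
  show ?thesis
    by (rule rep_isoI[OF rep_prod_ok[OF rep_iso_okD(1)[OF assms(1)] rep_iso_okD(1)[OF assms(2)]] iso]) (auto simp: rep_prod_def 1 2)
qed

lemma rep_prod_assoc:
  assumes "op_rep_ok R" "op_rep_ok S" "op_rep_ok T"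
  shows "rep_iso (rep_prod (rep_prod R S) T) (rep_prod R (rep_prod S T))"
  unfolding rep_iso_def
proof (intro conjI exI)
  show "op_rep_ok (rep_prod (rep_prod R S) T)"
    using assms by (intro rep_prod_ok)
  show "lin_iso (\<lambda>((x, y), z). (x, (y, z))) (\<lambda>(x, (y, z)). ((x, y), z)) (rep_prod (rep_prod R S) T) (rep_prod R (rep_prod S T))"
    using assms by (auto simp: lin_iso_def lin_map_def subsp_def rep_prod_def zero_prod_def op_rep_ok_def)
qed (auto simp: rep_prod_def)

lemma rep_prod_swap:
  assumes "op_rep_ok R" "op_rep_ok S"
  shows "rep_iso (rep_prod R S) (rep_prod S R)"
  unfolding rep_iso_def
proof (intro conjI exI)
  show "op_rep_ok (rep_prod R S)"
    using assms by (intro rep_prod_ok)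
  show "lin_iso (\<lambda>(x, y). (y, x)) (\<lambda>(x, y). (y, x)) (rep_prod R S) (rep_prod S R)"
    using assms by (auto simp: lin_iso_def lin_map_def subsp_def rep_prod_def zero_prod_def op_rep_ok_def)
qed (auto simp: rep_prod_def)

lemma quad_ok_qprod: "quad_ok Q \<Longrightarrow> quad_ok R \<Longrightarrow> quad_ok (qprod Q R)"
  by (auto simp: quad_ok_def qprod_def subsp_kpair) (auto simp: lin_map_def kpair_def)

lemma layers_010_qprod:
  assumes "quad_ok Q" "quad_ok R" "klin (qU Q)" "klin (qU R)"
  shows "rep_iso (layers_010 (qprod Q R)) (rep_prod (layers_010 Q) (layers_010 R))"
  unfolding rep_iso_def
proof (intro conjI exI)
  show "op_rep_ok (layers_010 (qprod Q R))"
    using layers_010_ok[OF quad_ok_qprod[OF assms(1,2)]] klin_kpair[OF assms(3,4)] by (simp add: qprod_def)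
  show "lin_iso (\<lambda>((u, u'), ((w1, w1'), (w2, w2'), (w3, w3')), (z, z')). ((u, (w1, w2, w3), z), (u', (w1', w2', w3'), z')))
     (\<lambda>((u, (w1, w2, w3), z), (u', (w1', w2', w3'), z')). ((u, u'), ((w1, w1'), (w2, w2'), (w3, w3')), (z, z')))
     (layers_010 (qprod Q R)) (rep_prod (layers_010 Q) (layers_010 R))"
    using assms by (auto simp: lin_iso_def lin_map_def subsp_def rep_prod_def zero_prod_def quad_ok_def layers_010_def qprod_def kpair_def)
qed (auto simp: rep_prod_def layers_010_def qprod_def zero_prod_def)

lemma layers_101_qprod:
  assumes "quad_ok Q" "quad_ok R" "klin (qU Q)" "klin (qU R)" "klin (qZ Q)" "klin (qZ R)"
  shows "rep_iso (layers_101 (qprod Q R)) (rep_prod (layers_101 Q) (layers_101 R))"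
  unfolding rep_iso_def
proof (intro conjI exI)
  show "op_rep_ok (layers_101 (qprod Q R))"
    using layers_101_ok[OF quad_ok_qprod[OF assms(1,2)]] klin_kpair[OF assms(3,4)] klin_kpair[OF assms(5,6)] by (simp add: qprod_def)
  show "lin_iso (\<lambda>(((u1, u1'), (u2, u2'), (u3, u3')), (w, w'), ((z1, z1'), (z2, z2'), (z3, z3'))).
       (((u1, u2, u3), w, (z1, z2, z3)), ((u1', u2', u3'), w', (z1', z2', z3'))))
     (\<lambda>(((u1, u2, u3), w, (z1, z2, z3)), ((u1', u2', u3'), w', (z1', z2', z3'))).
       (((u1, u1'), (u2, u2'), (u3, u3')), (w, w'), ((z1, z1'), (z2, z2'), (z3, z3'))))
     (layers_101 (qprod Q R)) (rep_prod (layers_101 Q) (layers_101 R))"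
    using assms by (auto simp: lin_iso_def lin_map_def subsp_def rep_prod_def zero_prod_def quad_ok_def layers_101_def qprod_def kpair_def)
qed (auto simp: rep_prod_def layers_101_def qprod_def zero_prod_def)

section \<open>Pencil modules and the squares that describe them\<close>

definition A_pencil :: "('u \<Rightarrow> 'u) \<Rightarrow> ('u \<Rightarrow> 'u) \<Rightarrow> ('k, 'u::ab_group_add) kspace \<Rightarrow> ('k, 'u \<times> 'u \<times> 'u \<times> 'u) op_rep" where
  "A_pencil p q V = \<lparr> carr = carr V \<times> carr V \<times> carr V \<times> carr V,
     smul = (\<lambda>c (w, x, y, z). (smul V c w, smul V c x, smul V c y, smul V c z)),
     opa = (\<lambda>(w, x, y, z). (0, p w, x, y)), opb = (\<lambda>(w, x, y, z). (0, y, z, q w)) \<rparr>"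

text \<open>Here V1 is on top and V0 below: a leaves V1 through its third basis vector by p, and b
  through its first by q.\<close>

definition B_pencil :: "('u \<Rightarrow> 'u) \<Rightarrow> ('u \<Rightarrow> 'u) \<Rightarrow> ('k, 'u::ab_group_add) kspace \<Rightarrow> ('k, 'u \<times> 'u \<times> 'u \<times> 'u) op_rep" where
  "B_pencil p q V = \<lparr> carr = carr V \<times> carr V \<times> carr V \<times> carr V,
     smul = (\<lambda>c (x, y, z, w). (smul V c x, smul V c y, smul V c z, smul V c w)),
     opa = (\<lambda>(x, y, z, w). (0, x, y, p z)), opb = (\<lambda>(x, y, z, w). (y, z, 0, q x)) \<rparr>"

text \<open>A zero space over the same type lets the degenerate squares with Z = 0 or U = 0 be
  written as ordinary ones.\<close>

definition kzero :: "('k, 'u::ab_group_add, 'm) kspace_scheme \<Rightarrow> ('k, 'u) kspace" where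
  "kzero V = \<lparr> carr = {0}, smul = smul V \<rparr>"

definition quad_A :: "('u \<Rightarrow> 'u) \<Rightarrow> ('u \<Rightarrow> 'u) \<Rightarrow> ('k, 'u::ab_group_add) kspace \<Rightarrow> ('k, 'u, 'u, 'u) quad" where
  "quad_A p q V = \<lparr> qU = V, qW = V, qZ = kzero V, qa = p, qb = q, qc = (\<lambda>_. 0), qd = (\<lambda>_. 0) \<rparr>"

definition quad_B :: "('u \<Rightarrow> 'u) \<Rightarrow> ('u \<Rightarrow> 'u) \<Rightarrow> ('k, 'u::ab_group_add) kspace \<Rightarrow> ('k, 'u, 'u, 'u) quad" where
  "quad_B p q V = \<lparr> qU = kzero V, qW = V, qZ = V, qa = (\<lambda>_. 0), qb = (\<lambda>_. 0), qc = p, qd = q \<rparr>"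

text \<open>The Koszul square of the unit vectors (1, 0) and (0, 1), that is, of an invertible 2 by
  2 matrix in normal form. For a one-dimensional V its two layered modules are P0 and P1.\<close>

definition quad_P :: "('k, 'u::ab_group_add) kspace \<Rightarrow> ('k, 'u, 'u \<times> 'u, 'u) quad" where
  "quad_P V = \<lparr> qU = V, qW = kpair V V, qZ = V, qa = (\<lambda>u. (u, 0)), qb = (\<lambda>u. (0, u)), qc = snd, qd = fst \<rparr>"

lemma klin_kzero: "klin V \<Longrightarrow> klin (kzero V)"
  using klin_0[of V] by (auto simp: klin_def kzero_def subsp_def)

context
  fixes p q :: "'u::ab_group_add \<Rightarrow> 'u" and V :: "('k, 'u) kspace"
  assumes V: "klin V" and p: "lin_map V V p" and q: "lin_map V V q"
begin

lemma sub': "subsp V" "subsp (kzero V)"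
  using V klin_kzero[OF V] by (auto simp: klin_def)

lemma quad_A_ok: "quad_ok (quad_A p q V)"
  using V p q sub' klin_0[OF V] by (auto simp: quad_ok_def quad_A_def) (auto simp: lin_map_def kzero_def)

lemma quad_B_ok: "quad_ok (quad_B p q V)"
  using V p q sub' klin_0[OF V] by (auto simp: quad_ok_def quad_B_def) (auto simp: lin_map_def kzero_def subsp_def)

lemma layers_010_quad_A: "rep_iso (layers_010 (quad_A p q V)) (A_pencil p q V)"
  unfolding rep_iso_def
proof (intro conjI exI)
  show "op_rep_ok (layers_010 (quad_A p q V))"
    by (rule layers_010_ok[OF quad_A_ok]) (simp add: quad_A_def V)
  show "lin_iso (\<lambda>(u, (w1, w2, w3), z). (u, w1, w2, w3)) (\<lambda>(u, w1, w2, w3). (u, (w1, w2, w3), 0)) (layers_010 (quad_A p q V)) (A_pencil p q V)"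
    using sub' by (auto simp: lin_iso_def lin_map_def subsp_def zero_prod_def layers_010_def quad_A_def A_pencil_def kzero_def)
qed (auto simp: layers_010_def quad_A_def A_pencil_def)

lemma layers_010_quad_B: "rep_iso (layers_010 (quad_B p q V)) (B_pencil p q V)"
  unfolding rep_iso_def
proof (intro conjI exI)
  show "op_rep_ok (layers_010 (quad_B p q V))"
    by (rule layers_010_ok[OF quad_B_ok]) (simp add: quad_B_def klin_kzero V)
  show "lin_iso (\<lambda>(u, (w1, w2, w3), z). (w1, w2, w3, z)) (\<lambda>(w1, w2, w3, z). (0, (w1, w2, w3), z)) (layers_010 (quad_B p q V)) (B_pencil p q V)"
    using sub' by (auto simp: lin_iso_def lin_map_def subsp_def zero_prod_def layers_010_def quad_B_def B_pencil_def kzero_def)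
qed (auto simp: layers_010_def quad_B_def B_pencil_def)

text \<open>Exchanging V0 and V1 exchanges the two families: a square with Z = 0 now has V1 on top
  and gives a B, and one with U = 0 gives an A. This is where A \<otimes> B acquires its summands in
  the opposite order.\<close>

lemma layers_101_quad_A: "rep_iso (layers_101 (quad_A p q V)) (B_pencil p q V)"
  unfolding rep_iso_def
proof (intro conjI exI)
  show "op_rep_ok (layers_101 (quad_A p q V))"
    by (rule layers_101_ok[OF quad_A_ok]) (simp_all add: quad_A_def klin_kzero V)
  show "lin_iso (\<lambda>((w1, w2, w3), w, z). (w1, w2, w3, w)) (\<lambda>(w1, w2, w3, w). ((w1, w2, w3), w, (0, 0, 0))) (layers_101 (quad_A p q V)) (B_pencil p q V)"
    using sub' by (auto simp: lin_iso_def lin_map_def subsp_def zero_prod_def layers_101_def quad_A_def B_pencil_def kzero_def)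
qed (auto simp: layers_101_def quad_A_def B_pencil_def)

lemma layers_101_quad_B: "rep_iso (layers_101 (quad_B p q V)) (A_pencil p q V)"
  unfolding rep_iso_def
proof (intro conjI exI)
  have p0: "p 0 = 0" using lin_map_0[OF p] sub' by (auto simp: subsp_def)
  show "op_rep_ok (layers_101 (quad_B p q V))"
    by (rule layers_101_ok[OF quad_B_ok]) (simp_all add: quad_B_def klin_kzero V)
  show "lin_iso (\<lambda>(u, w, (z1, z2, z3)). (w, z1, z2, z3)) (\<lambda>(w, z1, z2, z3). ((0, 0, 0), w, (z1, z2, z3))) (layers_101 (quad_B p q V)) (A_pencil p q V)"
    using sub' by (auto simp: lin_iso_def lin_map_def subsp_def zero_prod_def layers_101_def quad_B_def A_pencil_def kzero_def)
  show "\<forall>x\<in>carr (layers_101 (quad_B p q V)). (\<lambda>(u, w, (z1, z2, z3)). (w, z1, z2, z3)) (opa (layers_101 (quad_B p q V)) x) =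
    opa (A_pencil p q V) ((\<lambda>(u, w, (z1, z2, z3)). (w, z1, z2, z3)) x) \<and>
     (\<lambda>(u, w, (z1, z2, z3)). (w, z1, z2, z3)) (opb (layers_101 (quad_B p q V)) x) =
    opb (A_pencil p q V) ((\<lambda>(u, w, (z1, z2, z3)). (w, z1, z2, z3)) x)"
    by (auto simp: layers_101_def quad_B_def A_pencil_def p0)
qed

end

lemma quad_P_ok: "klin V \<Longrightarrow> quad_ok (quad_P V)"
  using klin_0[of V] by (auto simp: quad_ok_def quad_P_def subsp_kpair klin_def) (auto simp: lin_map_def kpair_def subsp_def)

section \<open>The tensor product over commuting operators\<close>

locale pencil_pair =
  fixes V :: "('k, 'u::ab_group_add) kspace" and p q p' q' :: "'u \<Rightarrow> 'u"
  assumes two: "x + (x::'u) = 0"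
    and V: "subsp V"
    and smul_add [simp]: "smul V c (x + y) = smul V c x + smul V c y"
    and cl [simp]: "x \<in> carr V \<Longrightarrow> p x \<in> carr V" "x \<in> carr V \<Longrightarrow> q x \<in> carr V"
      "x \<in> carr V \<Longrightarrow> p' x \<in> carr V" "x \<in> carr V \<Longrightarrow> q' x \<in> carr V"
    and additive [simp]: "p (x + y) = p x + p y" "q (x + y) = q x + q y" "p' (x + y) = p' x + p' y" "q' (x + y) = q' x + q' y"
    and smul_comm [simp]: "p (smul V c x) = smul V c (p x)" "q (smul V c x) = smul V c (q x)"
      "p' (smul V c x) = smul V c (p' x)" "q' (smul V c x) = smul V c (q' x)"
    and comm [simp]: "q (p x) = p (q x)" "p' (p x) = p (p' x)" "q' (p x) = p (q' x)"
      "p' (q x) = q (p' x)" "q' (q x) = q (q' x)" "q' (p' x) = p' (q' x)"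
begin

lemma two' [simp]: "x + (x + y) = (y::'u)" "x + x = (0::'u)"
  by (simp_all add: two flip: add.assoc)

lemma sub [simp]: "0 \<in> carr V" "x \<in> carr V \<Longrightarrow> smul V c x \<in> carr V" "x \<in> carr V \<Longrightarrow> y \<in> carr V \<Longrightarrow> x + y \<in> carr V"
  using V by (auto simp: subsp_def)

lemma zero_map [simp]: "p 0 = 0" "q 0 = 0" "p' 0 = 0" "q' 0 = 0" "smul V c 0 = 0"
  using additive[of 0 0] smul_add[of c 0 0] by auto

text \<open>The Koszul square of the columns (p, p') and (q, q'). Its composites qc qa = p' p + p p'
  and qd qb vanish, and qc qb = qd qa is the determinant p q' + q p'.\<close>

definition quad_tensor :: "('k, 'u, 'u \<times> 'u, 'u) quad" where
  "quad_tensor = \<lparr> qU = V, qW = kpair V V, qZ = V, qa = (\<lambda>u. (p u, p' u)), qb = (\<lambda>u. (q u, q' u)),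
     qc = (\<lambda>(s, t). p' s + p t), qd = (\<lambda>(s, t). q' s + q t) \<rparr>"

lemma quad_tensor_ok: "quad_ok quad_tensor"
  using V by (auto simp: quad_ok_def quad_tensor_def subsp_kpair) (auto simp: lin_map_def kpair_def add_ac)

definition T_carr :: "(('u \<times> 'u \<times> 'u \<times> 'u) \<times> ('u \<times> 'u \<times> 'u \<times> 'u) \<times> ('u \<times> 'u \<times> 'u \<times> 'u) \<times> ('u \<times> 'u \<times> 'u \<times> 'u)) set" where
  "T_carr = (carr V \<times> carr V \<times> carr V \<times> carr V) \<times> (carr V \<times> carr V \<times> carr V \<times> carr V) \<times> (carr V \<times> carr V \<times> carr V \<times> carr V) \<times> (carr V \<times> carr V \<times> carr V \<times> carr V)"

definition T_smul :: "'k \<Rightarrow> ('u \<times> 'u \<times> 'u \<times> 'u) \<times> ('u \<times> 'u \<times> 'u \<times> 'u) \<times> ('u \<times> 'u \<times> 'u \<times> 'u) \<times> ('u \<times> 'u \<times> 'u \<times> 'u)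
    \<Rightarrow> ('u \<times> 'u \<times> 'u \<times> 'u) \<times> ('u \<times> 'u \<times> 'u \<times> 'u) \<times> ('u \<times> 'u \<times> 'u \<times> 'u) \<times> ('u \<times> 'u \<times> 'u \<times> 'u)" where
  "T_smul c = (\<lambda>((ww, w1, w2, w3), (xw, x1, x2, x3), (yw, y1, y2, y3), (zw, z1, z2, z3)).
     ((smul V c ww, smul V c w1, smul V c w2, smul V c w3), (smul V c xw, smul V c x1, smul V c x2, smul V c x3),
      (smul V c yw, smul V c y1, smul V c y2, smul V c y3), (smul V c zw, smul V c z1, smul V c z2, smul V c z3)))"

text \<open>Sixteen coordinates in a 4 by 4 scheme: the letter w, x, y, z names the basis vector of
  the first factor, and the suffix w, 1, 2, 3 that of the second, where w is the head.\<close>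

definition tensor_AA where
  "tensor_AA = \<lparr> carr = T_carr, smul = T_smul,
     opa = (\<lambda>((ww, w1, w2, w3), (xw, x1, x2, x3), (yw, y1, y2, y3), (zw, z1, z2, z3)).
       ((0, p' ww, w1, w2), (p ww, p w1 + p' xw, p w2 + x1, p w3 + x2),
        (xw, x1 + p' yw, x2 + y1, x3 + y2), (yw, y1 + p' zw, y2 + z1, y3 + z2))),
     opb = (\<lambda>((ww, w1, w2, w3), (xw, x1, x2, x3), (yw, y1, y2, y3), (zw, z1, z2, z3)).
       ((0, w2, w3, q' ww), (yw, y1 + x2, y2 + x3, y3 + q' xw),
        (zw, z1 + y2, z2 + y3, z3 + q' yw), (q ww, q w1 + z2, q w2 + z3, q w3 + q' zw))) \<rparr>"

definition tensor_AB where
  "tensor_AB = \<lparr> carr = T_carr, smul = T_smul,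
     opa = (\<lambda>((w1, w2, w3, ww), (x1, x2, x3, xw), (y1, y2, y3, yw), (z1, z2, z3, zw)).
       ((0, w1, w2, p' w3), (p w1, p w2 + x1, p w3 + x2, p ww + p' x3),
        (x1, x2 + y1, x3 + y2, xw + p' y3), (y1, y2 + z1, y3 + z2, yw + p' z3))),
     opb = (\<lambda>((w1, w2, w3, ww), (x1, x2, x3, xw), (y1, y2, y3, yw), (z1, z2, z3, zw)).
       ((w2, w3, 0, q' w1), (y1 + x2, y2 + x3, y3, yw + q' x1),
        (z1 + y2, z2 + y3, z3, zw + q' y1), (q w1 + z2, q w2 + z3, q w3, q ww + q' z1))) \<rparr>"

lemma T_ok: "op_rep_ok tensor_AA" "op_rep_ok tensor_AB"
  by (auto simp: op_rep_ok_def subsp_def lin_map_def tensor_AA_def tensor_AB_def T_carr_def T_smul_def zero_prod_def add_ac)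

text \<open>The first component has top ww, the two copies of V1 built from head and V1 in the
  middle, and x3 + y2 + z1, the invariant pairing on V1 \<otimes> V1, at the bottom. The second
  component is the projection of V1 \<otimes> V1 to P1, whose top is (x2 + y1, x3 + z1, y3 + z2);
  the terms with p, q, p', q' extend it to the whole product so that it commutes with a and
  b.\<close>

definition AA_map where
  "AA_map = (\<lambda>((ww, w1, w2, w3), (xw, x1, x2, x3), (yw, y1, y2, y3), (zw, z1, z2, z3)).
     ((ww, ((xw, w1), (yw, w2), (zw, w3)), x3 + y2 + z1),
      ((x2 + y1 + p w3 + p' zw, x3 + z1 + p (q' ww) + q (p' ww), y3 + z2 + q' xw + q w1),
       (z3 + q' yw + q w2, x1 + p' yw + p w2),
       (y1 + p w3, x3 + y2 + q (p' ww), y3 + q w1))))"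

definition AA_inv where
  "AA_inv = (\<lambda>((u, ((s1, t1), (s2, t2), (s3, t3)), z), ((f0, f1, f2), (f3, f4), (f5, f6, f7))).
     ((u, t1, t2, t3),
      (s1, f4 + p' s2 + p t2, f0 + f5 + p' s3, f6 + z + f1 + p (q' u)),
      (s2, f5 + p t3, z + f1 + p (q' u) + q (p' u), f7 + q t1),
      (s3, z + f6 + q (p' u), f2 + f7 + q' s1, f3 + q' s2 + q t2)))"

lemma tensor_AA_iso: "rep_iso tensor_AA (rep_prod (layers_010 quad_tensor) (layers_101 (quad_P V)))"
  unfolding rep_iso_def
proof (intro conjI exI)
  show "op_rep_ok tensor_AA" by (rule T_ok)
  show "lin_iso AA_map AA_inv tensor_AA (rep_prod (layers_010 quad_tensor) (layers_101 (quad_P V)))"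
    by (rule lin_isoI) (use T_ok(1) in \<open>simp add: op_rep_ok_def\<close>,
        auto simp: tensor_AA_def T_carr_def T_smul_def rep_prod_def layers_010_def layers_101_def quad_tensor_def quad_P_def kpair_def AA_map_def AA_inv_def add_ac)
  show "\<forall>x\<in>carr tensor_AA. AA_map (opa tensor_AA x) = opa (rep_prod (layers_010 quad_tensor) (layers_101 (quad_P V))) (AA_map x) \<and>
       AA_map (opb tensor_AA x) = opb (rep_prod (layers_010 quad_tensor) (layers_101 (quad_P V))) (AA_map x)"
    by (auto simp: tensor_AA_def T_carr_def rep_prod_def layers_010_def layers_101_def quad_tensor_def quad_P_def AA_map_def zero_prod_def add_ac)
qed

text \<open>Now V1 times the socle of B lies below V1 \<otimes> V1, so the bottom layer of the
  square also needs corrections. The middle layer pairs the invariant x3 + y2 + z1 with head times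
  socle.\<close>

definition AB_map where
  "AB_map = (\<lambda>((w1, w2, w3, ww), (x1, x2, x3, xw), (y1, y2, y3, yw), (z1, z2, z3, zw)).
     (((w1, w2, w3), (x3 + y2 + z1, ww), (xw + p' z2, yw + p' z3 + q' x1 + p (q' w2), zw + q' x2)),
      ((x2 + y1 + p w3, x3 + z1, y3 + z2 + q w1), (z3 + q w2, x1 + p w2),
       (y1 + p w3, x3 + y2, y3 + q w1))))"

definition AB_inv where
  "AB_inv = (\<lambda>(((w1, w2, w3), (s, t), (X1, X2, X3)), ((f0, f1, f2), (f3, f4), (f5, f6, f7))).
     ((w1, w2, w3, t),
      (f4 + p w2, f0 + f5, f6 + s + f1, X1 + p' (f2 + f7)),
      (f5 + p w3, s + f1, f7 + q w1, X2 + p' (f3 + q w2) + q' (f4 + p w2) + p (q' w2)),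
      (f6 + s, f2 + f7, f3 + q w2, X3 + q' (f0 + f5))))"

lemma tensor_AB_iso: "rep_iso tensor_AB (rep_prod (layers_101 quad_tensor) (layers_101 (quad_P V)))"
  unfolding rep_iso_def
proof (intro conjI exI)
  show "op_rep_ok tensor_AB" by (rule T_ok)
  show "lin_iso AB_map AB_inv tensor_AB (rep_prod (layers_101 quad_tensor) (layers_101 (quad_P V)))"
    by (rule lin_isoI) (use T_ok(2) in \<open>simp add: op_rep_ok_def\<close>,
        auto simp: tensor_AB_def T_carr_def T_smul_def rep_prod_def layers_010_def layers_101_def quad_tensor_def quad_P_def kpair_def AB_map_def AB_inv_def add_ac)
  show "\<forall>x\<in>carr tensor_AB. AB_map (opa tensor_AB x) = opa (rep_prod (layers_101 quad_tensor) (layers_101 (quad_P V))) (AB_map x) \<and>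
       AB_map (opb tensor_AB x) = opb (rep_prod (layers_101 quad_tensor) (layers_101 (quad_P V))) (AB_map x)"
    by (auto simp: tensor_AB_def T_carr_def rep_prod_def layers_010_def layers_101_def quad_tensor_def quad_P_def AB_map_def zero_prod_def add_ac)
qed

text \<open>The middle map is the inverse of the matrix with columns (p, p') and (q, q'), written as
  adjugate times \<open>Di\<close>, where \<open>Di\<close> inverts the determinant. Commuting with
  all four operators is what lets \<open>Di\<close> pass through the arrows.\<close>

lemma quad_tensor_distinct:
  assumes Di: "\<And>x. x \<in> carr V \<Longrightarrow> Di x \<in> carr V \<and> Di (p (q' x) + q (p' x)) = x \<and> p (q' (Di x)) + q (p' (Di x)) = x"
    and Dia: "\<And>x y. Di (x + y) = Di x + Di y" "\<And>c x. Di (smul V c x) = smul V c (Di x)"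
    and Dic: "\<And>x. Di (p x) = p (Di x)" "\<And>x. Di (q x) = q (Di x)" "\<And>x. Di (p' x) = p' (Di x)" "\<And>x. Di (q' x) = q' (Di x)"
  shows "quad_iso quad_tensor (quad_P V)"
  unfolding quad_iso_def
proof (intro conjI exI)
  show "quad_ok quad_tensor" by (rule quad_tensor_ok)
  have Di0: "Di 0 = 0" using Dia(1)[of 0 0] by simp
  have c [simp]: "\<And>x. x \<in> carr V \<Longrightarrow> Di x \<in> carr V" 
    and c2 [simp]: "x \<in> carr V \<Longrightarrow> p (q' (Di x)) + q (p' (Di x)) = x" for x
    using Di by blast+
  have c4: "x \<in> carr V \<Longrightarrow> p (q' (Di x)) + (q (p' (Di x)) + y) = x + y" for x y
    by (simp flip: add.assoc)
  have *: "x \<in> carr V \<Longrightarrow> y \<in> carr V \<Longrightarrow> p (q' (Di x)) = x + q (p' (Di x))" for x y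
    using c2[of x] by (metis add.assoc add.right_neutral two)
  show "lin_iso (\<lambda>x. x) (\<lambda>x. x) (qU quad_tensor) (qU (quad_P V))"
    by (auto simp: lin_iso_def lin_map_def V quad_tensor_def quad_P_def)
  show "lin_iso Di (\<lambda>x. p (q' x) + q (p' x)) (qZ quad_tensor) (qZ (quad_P V))"
    by (auto simp: lin_iso_def lin_map_def V quad_tensor_def quad_P_def Dia Dic *)
  show "lin_iso (\<lambda>(s, t). (Di (q' s + q t), Di (p' s + p t))) (\<lambda>(s, t). (p s + q t, p' s + q' t)) (qW quad_tensor) (qW (quad_P V))"
    by (auto simp: lin_iso_def lin_map_def quad_tensor_def quad_P_def subsp_kpair V)
       (auto simp: kpair_def Dia Dic add_ac *)
qed (auto simp: quad_tensor_def quad_P_def kpair_def Dia Dic Di zero_prod_def add_ac)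

end


section \<open>Two commuting shifts\<close>

lemma char2_add_self: "CHAR('k::field) = 2 \<Longrightarrow> x + (x :: 'k) = 0"
  by (metis mult_2 of_nat_CHAR of_nat_numeral mult_zero_left)

lemma quad_iso_trans [trans]:
  assumes "quad_iso Q R" "quad_iso R S"
  shows "quad_iso Q S"
proof -
  obtain f f' g g' h h' where ok: "quad_ok Q" and 
     f: "lin_iso f f' (qU Q) (qU R)" and g: "lin_iso g g' (qW Q) (qW R)" and h: "lin_iso h h' (qZ Q) (qZ R)" and
     i: "\<And>u. u\<in>carr (qU Q) \<Longrightarrow> g (qa Q u) = qa R (f u)" "\<And>u. u\<in>carr (qU Q) \<Longrightarrow> g (qb Q u) = qb R (f u)"
     "\<And>w. w\<in>carr (qW Q) \<Longrightarrow> h (qc Q w) = qc R (g w)" "\<And>w. w\<in>carr (qW Q) \<Longrightarrow> h (qd Q w) = qd R (g w)"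
    using assms(1) unfolding quad_iso_def by auto
  obtain F F' G G' H H' where  
     F: "lin_iso F F' (qU R) (qU S)" and G: "lin_iso G G' (qW R) (qW S)" and H: "lin_iso H H' (qZ R) (qZ S)" and
     I: "\<And>u. u\<in>carr (qU R) \<Longrightarrow> G (qa R u) = qa S (F u)" "\<And>u. u\<in>carr (qU R) \<Longrightarrow> G (qb R u) = qb S (F u)"
     "\<And>w. w\<in>carr (qW R) \<Longrightarrow> H (qc R w) = qc S (G w)" "\<And>w. w\<in>carr (qW R) \<Longrightarrow> H (qd R w) = qd S (G w)"
    using assms(2) unfolding quad_iso_def by auto
  have c: "\<And>u. u\<in>carr (qU Q) \<Longrightarrow> f u \<in> carr (qU R)" "\<And>u. u\<in>carr (qW Q) \<Longrightarrow> g u \<in> carr (qW R)"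
    using f g unfolding lin_iso_def lin_map_def by auto
  show ?thesis
    unfolding quad_iso_def using ok lin_iso_trans[OF f F] lin_iso_trans[OF g G] lin_iso_trans[OF h H] i I c
    by (intro conjI exI) auto
qed

lemma quad_isoI:
  assumes "quad_ok Q" "lin_iso f f' (qU Q) (qU R)" "lin_iso g g' (qW Q) (qW R)" "lin_iso h h' (qZ Q) (qZ R)"
    "\<And>u. u\<in>carr (qU Q) \<Longrightarrow> g (qa Q u) = qa R (f u)" "\<And>u. u\<in>carr (qU Q) \<Longrightarrow> g (qb Q u) = qb R (f u)"
    "\<And>w. w\<in>carr (qW Q) \<Longrightarrow> h (qc Q w) = qc R (g w)" "\<And>w. w\<in>carr (qW Q) \<Longrightarrow> h (qd Q w) = qd R (g w)"
  shows "quad_iso Q R"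
  using assms unfolding quad_iso_def by blast

lemma lin_iso_kpair:
  "lin_iso f f' V V' \<Longrightarrow> lin_iso g g' W W' \<Longrightarrow>
    lin_iso (\<lambda>(x, y). (f x, g y)) (\<lambda>(x, y). (f' x, g' y)) (kpair V W) (kpair V' W')"
  by (auto simp: lin_iso_def lin_map_def subsp_kpair) (auto simp: kpair_def)

lemma lin_iso_refl: "subsp V \<Longrightarrow> lin_iso (\<lambda>x. x) (\<lambda>x. x) V V"
  by (auto simp: lin_iso_def lin_map_def)

lemma qprod_cong2:
  assumes Q: "quad_ok Q" and R: "quad_iso R S"
  shows "quad_iso (qprod Q R) (qprod Q S)"
proof -
  obtain f f' g g' h h' where ok: "quad_ok R" and 
     f: "lin_iso f f' (qU R) (qU S)" and g: "lin_iso g g' (qW R) (qW S)" and h: "lin_iso h h' (qZ R) (qZ S)" and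
     i: "\<And>u. u\<in>carr (qU R) \<Longrightarrow> g (qa R u) = qa S (f u)" "\<And>u. u\<in>carr (qU R) \<Longrightarrow> g (qb R u) = qb S (f u)"
     "\<And>w. w\<in>carr (qW R) \<Longrightarrow> h (qc R w) = qc S (g w)" "\<And>w. w\<in>carr (qW R) \<Longrightarrow> h (qd R w) = qd S (g w)"
    using R unfolding quad_iso_def by auto
  have s: "subsp (qU Q)" "subsp (qW Q)" "subsp (qZ Q)" using Q unfolding quad_ok_def by auto
  have q: "qU (qprod Q R) = kpair (qU Q) (qU R)" "qW (qprod Q R) = kpair (qW Q) (qW R)" "qZ (qprod Q R) = kpair (qZ Q) (qZ R)"
     "qU (qprod Q S) = kpair (qU Q) (qU S)" "qW (qprod Q S) = kpair (qW Q) (qW S)" "qZ (qprod Q S) = kpair (qZ Q) (qZ S)"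
    by (auto simp: qprod_def)
  show ?thesis
  proof (rule quad_isoI[OF quad_ok_qprod[OF Q ok]])
    show "lin_iso (\<lambda>(x, y). (x, f y)) (\<lambda>(x, y). (x, f' y)) (qU (qprod Q R)) (qU (qprod Q S))"
      unfolding q by (rule lin_iso_kpair[OF lin_iso_refl[OF s(1)] f])
    show "lin_iso (\<lambda>(x, y). (x, g y)) (\<lambda>(x, y). (x, g' y)) (qW (qprod Q R)) (qW (qprod Q S))"
      unfolding q by (rule lin_iso_kpair[OF lin_iso_refl[OF s(2)] g])
    show "lin_iso (\<lambda>(x, y). (x, h y)) (\<lambda>(x, y). (x, h' y)) (qZ (qprod Q R)) (qZ (qprod Q S))"
      unfolding q by (rule lin_iso_kpair[OF lin_iso_refl[OF s(3)] h])
  qed (auto simp: qprod_def kpair_def i)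
qed

section \<open>Sequence and grid spaces with their shifts\<close>

definition seq_space :: "nat \<Rightarrow> ('k::field, nat \<Rightarrow> 'k) kspace" where
  "seq_space n = \<lparr> carr = supp_below n, smul = (\<lambda>c f i. c * f i) \<rparr>"

definition grid_space :: "nat \<Rightarrow> nat \<Rightarrow> ('k::field, nat \<Rightarrow> nat \<Rightarrow> 'k) kspace" where
  "grid_space r s = \<lparr> carr = {u. \<forall>k l. k \<ge> r \<or> l \<ge> s \<longrightarrow> u k l = 0}, smul = (\<lambda>c u k l. c * u k l) \<rparr>"

text \<open>The operator c + d N with N f = f (Suc k). On coordinates it raises the index, which is
  lowering it on basis vectors, so a bound on the support is preserved and the last index is no
  special case.\<close>

definition pencil :: "'k::field \<Rightarrow> 'k \<Rightarrow> (nat \<Rightarrow> 'k) \<Rightarrow> nat \<Rightarrow> 'k" where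
  "pencil c d f = (\<lambda>k. c * f k + d * f (Suc k))"

definition pencil_left :: "'k::field \<Rightarrow> 'k \<Rightarrow> (nat \<Rightarrow> nat \<Rightarrow> 'k) \<Rightarrow> nat \<Rightarrow> nat \<Rightarrow> 'k" where
  "pencil_left c d u = (\<lambda>k l. c * u k l + d * u (Suc k) l)"

definition pencil_right :: "'k::field \<Rightarrow> 'k \<Rightarrow> (nat \<Rightarrow> nat \<Rightarrow> 'k) \<Rightarrow> nat \<Rightarrow> nat \<Rightarrow> 'k" where
  "pencil_right c d u = (\<lambda>k l. c * u k l + d * u k (Suc l))"

lemma klin_seq_space: "klin (seq_space n)"
  by (auto simp: klin_def subsp_def seq_space_def supp_below_def plus_fun_def algebra_simps)

lemma klin_grid_space: "klin (grid_space r s)"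
  by (auto simp: klin_def subsp_def grid_space_def plus_fun_def algebra_simps)

lemma lin_pencil: "lin_map (seq_space n) (seq_space n) (pencil c d)"
  by (auto simp: lin_map_def seq_space_def supp_below_def pencil_def plus_fun_def algebra_simps)

lemma pencil_pair_grid_space:
  assumes "CHAR('k::field) = 2"
  shows "pencil_pair (grid_space r s :: ('k, _) kspace) (pencil_left c1 d1) (pencil_left c2 d2) (pencil_right c1' d1') (pencil_right c2' d2')"
proof
  fix x :: "nat \<Rightarrow> nat \<Rightarrow> 'k"
  show "x + x = 0"
  proof (intro ext)
    fix k l show "(x + x) k l = 0 k l"
      using char2_add_self[OF assms, of "x k l"] by (simp only: plus_fun_def zero_fun_def)
  qed
qed (use klin_grid_space[of r s] in \<open>auto simp: klin_def grid_space_def pencil_left_def pencil_right_def fun_eq_iff algebra_simps\<close>)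

section \<open>Frobenius and the inversion of pencils\<close>

definition bipencil :: "'k::field \<Rightarrow> 'k \<Rightarrow> 'k \<Rightarrow> 'k \<Rightarrow> nat \<Rightarrow> nat \<Rightarrow> (nat \<Rightarrow> nat \<Rightarrow> 'k) \<Rightarrow> nat \<Rightarrow> nat \<Rightarrow> 'k" where
  "bipencil c d e f i j u = (\<lambda>k l. c * u k l + d * u (k + i) l + e * u k (l + j) + f * u (k + i) (l + j))"

lemma char2_cancel:
  assumes "CHAR('k::field) = 2"
  shows "x + (x + y) = (y :: 'k)" "2 * x = 0"
proof -
  show "x + (x + y) = y"
    using char2_add_self[OF assms, of x] add.assoc[of x x y] by simp
  show "2 * x = 0"
    using char2_add_self[OF assms, of x] by (simp only: mult_2)
qed

text \<open>The operators 1, N^i, N'^j and N^i N'^j commute, so all mixed terms of the square occur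
  twice and cancel in characteristic 2.\<close>

lemma bipencil_square:
  assumes "CHAR('k::field) = 2"
  shows "bipencil c d e f i j (bipencil c d e f i j u) = (bipencil (c^2) (d^2) (e^2) (f^2) (2 * i) (2 * j) u :: nat \<Rightarrow> nat \<Rightarrow> 'k)"
  by (auto simp: bipencil_def fun_eq_iff algebra_simps power2_eq_square char2_cancel[OF assms] char2_add_self[OF assms] mult_2 mult_2_right)

lemma bipencil_power:
  assumes "CHAR('k::field) = 2"
  shows "(bipencil c d e f i j ^^ (2 ^ n)) u = (bipencil (c^(2^n)) (d^(2^n)) (e^(2^n)) (f^(2^n)) (2 ^ n * i) (2 ^ n * j) u :: nat \<Rightarrow> nat \<Rightarrow> 'k)"
proof (induction n arbitrary: u)
  case (Suc n)
  have "(bipencil c d e f i j ^^ (2 ^ Suc n)) u = (bipencil c d e f i j ^^ (2 ^ n)) ((bipencil c d e f i j ^^ (2 ^ n)) u)"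
    by (simp add: mult_2 funpow_add)
  then show ?case
    by (simp add: Suc bipencil_square[OF assms] mult.assoc flip: power_mult mult.commute[of 2])
qed simp

text \<open>
  In characteristic 2 a sufficiently high \<open>2\<^sup>n\<close>-th power of a pencil in nilpotent commuting shifts is a scalar,
  so a pencil with nonzero constant coefficient is invertible.
\<close>

definition op_inverse :: "nat \<Rightarrow> nat \<Rightarrow> ((nat \<Rightarrow> nat \<Rightarrow> 'k::field) \<Rightarrow> nat \<Rightarrow> nat \<Rightarrow> 'k) \<Rightarrow>
    ((nat \<Rightarrow> nat \<Rightarrow> 'k) \<Rightarrow> nat \<Rightarrow> nat \<Rightarrow> 'k) \<Rightarrow> bool" where
  "op_inverse r s D Di \<longleftrightarrow>
     (\<forall>x\<in>carr (grid_space r s). Di x \<in> carr (grid_space r s) \<and> Di (D x) = x \<and> D (Di x) = x) \<and>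
     (\<forall>x y. Di (x + y) = Di x + Di y) \<and>
     (\<forall>E. (\<forall>x. E (D x) = D (E x)) \<longrightarrow> (\<forall>c x. E (\<lambda>k l. c * x k l) = (\<lambda>k l. c * E x k l))
       \<longrightarrow> (\<forall>x. Di (E x) = E (Di x))) \<and>
     (\<forall>S. (\<forall>x\<in>S. D x \<in> S) \<longrightarrow> (\<forall>x\<in>S. \<forall>c. (\<lambda>k l. c * x k l) \<in> S) \<longrightarrow> (\<forall>x\<in>S. Di x \<in> S))"

lemma op_inverseD:
  assumes "op_inverse r s D Di"
  shows "x \<in> carr (grid_space r s) \<Longrightarrow> Di x \<in> carr (grid_space r s)"
    and "x \<in> carr (grid_space r s) \<Longrightarrow> Di (D x) = x"
    and "x \<in> carr (grid_space r s) \<Longrightarrow> D (Di x) = x"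
    and "Di (x + y) = Di x + Di y"
    and "(\<And>x. E (D x) = D (E x)) \<Longrightarrow> (\<And>c x. E (\<lambda>k l. c * x k l) = (\<lambda>k l. c * E x k l)) \<Longrightarrow> Di (E x) = E (Di x)"
    and "(\<And>x. x \<in> S \<Longrightarrow> D x \<in> S) \<Longrightarrow> (\<And>c x. x \<in> S \<Longrightarrow> (\<lambda>k l. c * x k l) \<in> S) \<Longrightarrow> x \<in> S \<Longrightarrow> Di x \<in> S"
proof -
  note * = assms[unfolded op_inverse_def]
  show "x \<in> carr (grid_space r s) \<Longrightarrow> Di x \<in> carr (grid_space r s)" "x \<in> carr (grid_space r s) \<Longrightarrow> Di (D x) = x"
    "x \<in> carr (grid_space r s) \<Longrightarrow> D (Di x) = x" "Di (x + y) = Di x + Di y"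
    using * by simp_all
  show "Di (E x) = E (Di x)" if "\<And>x. E (D x) = D (E x)" "\<And>c x. E (\<lambda>k l. c * x k l) = (\<lambda>k l. c * E x k l)"
    using *[THEN conjunct2, THEN conjunct2, THEN conjunct1, THEN spec[of _ E]] that by simp
  show "Di x \<in> S" if "\<And>x. x \<in> S \<Longrightarrow> D x \<in> S" "\<And>c x. x \<in> S \<Longrightarrow> (\<lambda>k l. c * x k l) \<in> S" "x \<in> S"
    using *[THEN conjunct2, THEN conjunct2, THEN conjunct2, THEN spec[of _ S]] that by simp
qed

text \<open>The inverse is a scalar times the power of exponent 2^n - 1 of the operator. It
  therefore commutes with everything that commutes with the operator and with scalars, and preserves
  every set stable under both; these are the clauses of \<open>op_inverse\<close>, which take the
  place of centrality in a ring.\<close>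

lemma bipencil_inverse:
  fixes c d e f :: "'k::field"
  assumes "CHAR('k) = 2" and c: "c \<noteq> 0"
  shows "\<exists>Di. op_inverse r s (bipencil c d e f 1 1) Di"
proof -
  let ?D = "bipencil c d e f 1 1"
  \<comment> \<open>Any n with r, s at most 2^n serves: then N^(2^n) and N'^(2^n) vanish on the
    grid.\<close>
  define n where "n = r + s"
  define N where "N = (2::nat) ^ n - 1"
  have N: "Suc N = 2 ^ n" by (simp add: N_def)
  have "n < 2 ^ n" by (rule less_exp)
  then have n: "r \<le> 2 ^ n" "s \<le> 2 ^ n"
    unfolding n_def by linarith+
  define Di where "Di x = (\<lambda>k l. inverse (c ^ 2 ^ n) * (?D ^^ N) x k l)" for x
  have pow: "(?D ^^ Suc N) x = (\<lambda>k l. c ^ 2 ^ n * x k l)" if "x \<in> carr (grid_space r s)" for x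
    using that n unfolding N bipencil_power[OF assms(1)] by (auto simp: bipencil_def grid_space_def fun_eq_iff)
  have cl: "(\<And>x. x \<in> S \<Longrightarrow> ?D x \<in> S) \<Longrightarrow> (\<And>c x. x \<in> S \<Longrightarrow> (\<lambda>k l. c * x k l) \<in> S)
       \<Longrightarrow> x \<in> S \<Longrightarrow> Di x \<in> S" for S x
  proof -
    assume *: "(\<And>x. x \<in> S \<Longrightarrow> ?D x \<in> S)" "(\<And>c x. x \<in> S \<Longrightarrow> (\<lambda>k l. c * x k l) \<in> S)" "x \<in> S"
    have "(?D ^^ M) x \<in> S" for M
      using * by (induction M) auto
    then show "Di x \<in> S" unfolding Di_def using * by blast
  qed
  have scal: "(?D ^^ M) (\<lambda>k l. a * x k l) = (\<lambda>k l. a * (?D ^^ M) x k l)" for M a x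
    by (induction M) (auto simp: bipencil_def fun_eq_iff algebra_simps)
  have add: "(?D ^^ M) (x + y) = (?D ^^ M) x + (?D ^^ M) y" for M x y
    by (induction M) (auto simp: bipencil_def fun_eq_iff algebra_simps)
  have 1: "Di x \<in> carr (grid_space r s)" if "x \<in> carr (grid_space r s)" for x
    using that by (intro cl) (auto simp: grid_space_def bipencil_def)
  have 2: "Di (?D x) = x" if "x \<in> carr (grid_space r s)" for x
  proof -
    have "(?D ^^ N) (?D x) = (\<lambda>k l. c ^ 2 ^ n * x k l)"
      using pow[OF that] by (simp add: funpow_Suc_right del: funpow.simps)
    moreover have "inverse (c ^ 2 ^ n) * (c ^ 2 ^ n * y) = y" for y
      using c by (simp add: field_simps)
    ultimately show ?thesis
      by (simp only: Di_def)
  qed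
  have "?D (Di x) = Di (?D x)" for x
    unfolding Di_def funpow_swap1[of ?D N x, symmetric]
    by (auto simp: bipencil_def fun_eq_iff algebra_simps)
  then have 3: "?D (Di x) = x" if "x \<in> carr (grid_space r s)" for x
    using 2 that by simp
  have 4: "Di (x + y) = Di x + Di y" for x y
    unfolding Di_def add by (simp add: fun_eq_iff algebra_simps)
  have 5: "Di (E x) = E (Di x)" if "\<And>x. E (?D x) = ?D (E x)" "\<And>c x. E (\<lambda>k l. c * x k l) = (\<lambda>k l. c * E x k l)" for E x
  proof -
    have "(?D ^^ M) (E x) = E ((?D ^^ M) x)" for M
      using that by (induction M) auto
    then show ?thesis
      using that by (simp add: Di_def)
  qed
  show ?thesis
    unfolding op_inverse_def using 1 2 3 4 5 cl by (intro exI[of _ Di]) simp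
qed

section \<open>The square of two pencils: distinct points, symmetry and scaling\<close>

lemma quad_iso_distinct:
  fixes c1 d1 c2 d2 c1' d1' c2' d2' :: "'k::field"
  assumes 2: "CHAR('k) = 2" and nz: "c1 * c2' + c2 * c1' \<noteq> 0"
  shows "quad_iso (pencil_pair.quad_tensor (grid_space r s) (pencil_left c1 d1) (pencil_left c2 d2) (pencil_right c1' d1') (pencil_right c2' d2')) (quad_P (grid_space r s))"
proof -
  interpret pencil_pair "grid_space r s" "pencil_left c1 d1" "pencil_left c2 d2" "pencil_right c1' d1'" "pencil_right c2' d2'"
    by (rule pencil_pair_grid_space[OF 2])
  \<comment> \<open>The determinant p q' + q p' expanded in 1, N, N' and NN'. Invertibility depends
    only on its constant coefficient, which is the determinant of the two points.\<close>
  let ?D = "bipencil (c1 * c2' + c2 * c1') (d1 * c2' + d2 * c1') (c1 * d2' + c2 * d1') (d1 * d2' + d2 * d1') 1 1"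
  have D: "pencil_left c1 d1 (pencil_right c2' d2' x) + pencil_left c2 d2 (pencil_right c1' d1' x) = ?D x" for x
    by (auto simp: pencil_left_def pencil_right_def bipencil_def fun_eq_iff algebra_simps)
  obtain Di where inv: "op_inverse r s ?D Di"
    using bipencil_inverse[OF 2 nz] by blast
  note Di = op_inverseD(1-4)[OF inv] and E = op_inverseD(5)[OF inv]
  show ?thesis
  proof (rule quad_tensor_distinct[of Di])
    show "Di (smul (grid_space r s) c x) = smul (grid_space r s) c (Di x)" for c x
      unfolding grid_space_def by simp (rule E; auto simp: bipencil_def fun_eq_iff algebra_simps)
  qed (unfold D, insert Di, (blast | simp | (rule E; auto simp: bipencil_def pencil_left_def pencil_right_def fun_eq_iff algebra_simps))+)
qed

text \<open>Transposing the grid exchanges the two shifts, and exchanging the components of the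
  middle layer exchanges the two pairs. It allows r \<le> s to be assumed.\<close>

lemma quad_iso_flip:
  fixes c1 d1 c2 d2 c1' d1' c2' d2' :: "'k::field"
  assumes 2: "CHAR('k) = 2"
  shows "quad_iso (pencil_pair.quad_tensor (grid_space r s) (pencil_left c1 d1) (pencil_left c2 d2) (pencil_right c1' d1') (pencil_right c2' d2'))
     (pencil_pair.quad_tensor (grid_space s r) (pencil_left c1' d1') (pencil_left c2' d2') (pencil_right c1 d1) (pencil_right c2 d2))"
proof -
  interpret P: pencil_pair "grid_space r s" "pencil_left c1 d1" "pencil_left c2 d2" "pencil_right c1' d1'" "pencil_right c2' d2'"
    by (rule pencil_pair_grid_space[OF 2])
  interpret Q: pencil_pair "grid_space s r" "pencil_left c1' d1'" "pencil_left c2' d2'" "pencil_right c1 d1" "pencil_right c2 d2"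
    by (rule pencil_pair_grid_space[OF 2])
  show ?thesis
  proof (rule quad_isoI[OF P.quad_tensor_ok])
    show 1: "lin_iso (\<lambda>u k l. u l k) (\<lambda>u k l. u l k) (qU P.quad_tensor) (qU Q.quad_tensor)"
      by (rule lin_isoI) (simp_all add: P.quad_tensor_def Q.quad_tensor_def P.V, auto simp: grid_space_def plus_fun_def)
    show "lin_iso (\<lambda>u k l. u l k) (\<lambda>u k l. u l k) (qZ P.quad_tensor) (qZ Q.quad_tensor)"
      by (rule lin_isoI) (simp_all add: P.quad_tensor_def Q.quad_tensor_def P.V, auto simp: grid_space_def plus_fun_def)
    show "lin_iso (\<lambda>(s, t). (\<lambda>k l. t l k, \<lambda>k l. s l k)) (\<lambda>(s, t). (\<lambda>k l. t l k, \<lambda>k l. s l k)) (qW P.quad_tensor) (qW Q.quad_tensor)"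
      by (rule lin_isoI) (auto simp: P.quad_tensor_def Q.quad_tensor_def P.V subsp_kpair, auto simp: kpair_def grid_space_def plus_fun_def)
  qed (auto simp: P.quad_tensor_def Q.quad_tensor_def pencil_left_def pencil_right_def fun_eq_iff kpair_def)
qed

text \<open>The factor of the second pair is absorbed by rescaling one component of the middle layer
  and the bottom layer. So only the projective point of the second pair matters.\<close>

lemma quad_iso_scale:
  fixes c1 d1 c2 d2 c1' d1' c2' d2' a :: "'k::field"
  assumes 2: "CHAR('k) = 2" and a: "a \<noteq> 0"
  shows "quad_iso (pencil_pair.quad_tensor (grid_space r s) (pencil_left c1 d1) (pencil_left c2 d2) (pencil_right (a * c1') (a * d1')) (pencil_right (a * c2') (a * d2')))
     (pencil_pair.quad_tensor (grid_space r s) (pencil_left c1 d1) (pencil_left c2 d2) (pencil_right c1' d1') (pencil_right c2' d2'))"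
proof -
  interpret P: pencil_pair "grid_space r s" "pencil_left c1 d1" "pencil_left c2 d2" "pencil_right (a * c1') (a * d1')" "pencil_right (a * c2') (a * d2')"
    by (rule pencil_pair_grid_space[OF 2])
  interpret Q: pencil_pair "grid_space r s" "pencil_left c1 d1" "pencil_left c2 d2" "pencil_right c1' d1'" "pencil_right c2' d2'"
    by (rule pencil_pair_grid_space[OF 2])
  show ?thesis
  proof (rule quad_isoI[OF P.quad_tensor_ok])
    show 1: "lin_iso (\<lambda>u. u) (\<lambda>u. u) (qU P.quad_tensor) (qU Q.quad_tensor)"
      by (rule lin_isoI) (auto simp: P.quad_tensor_def Q.quad_tensor_def P.V)
    show "lin_iso (\<lambda>u k l. u k l / a) (\<lambda>u k l. a * u k l) (qZ P.quad_tensor) (qZ Q.quad_tensor)"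
      using a by (intro lin_isoI) (auto simp: P.quad_tensor_def Q.quad_tensor_def P.V, auto simp: grid_space_def plus_fun_def fun_eq_iff field_simps)
    show "lin_iso (\<lambda>(s, t). (s, \<lambda>k l. t k l / a)) (\<lambda>(s, t). (s, \<lambda>k l. a * t k l)) (qW P.quad_tensor) (qW Q.quad_tensor)"
      using a by (intro lin_isoI) (auto simp: P.quad_tensor_def Q.quad_tensor_def P.V subsp_kpair, auto simp: kpair_def grid_space_def plus_fun_def fun_eq_iff field_simps)
  qed (use a in \<open>auto simp: P.quad_tensor_def Q.quad_tensor_def pencil_left_def pencil_right_def fun_eq_iff kpair_def field_simps\<close>)
qed


section \<open>Kernel and cokernel of the sum of the shifts\<close>

definition sc :: "'k::field \<Rightarrow> (nat \<Rightarrow> nat \<Rightarrow> 'k) \<Rightarrow> nat \<Rightarrow> nat \<Rightarrow> 'k" where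
  "sc c u = (\<lambda>k l. c * u k l)"

definition shift_sum :: "(nat \<Rightarrow> nat \<Rightarrow> 'k::field) \<Rightarrow> nat \<Rightarrow> nat \<Rightarrow> 'k" where
  "shift_sum u = (\<lambda>k l. u (Suc k) l + u k (Suc l))"

text \<open>In characteristic 2 the kernel of N + N' consists of the grids with u (Suc k) l = u k
  (Suc l), hence of grids constant along antidiagonals. For r \<le> s such a grid is given by its
  first column, a sequence supported below r.\<close>

definition hankel :: "(nat \<Rightarrow> 'k::field) \<Rightarrow> nat \<Rightarrow> nat \<Rightarrow> 'k" where
  "hankel f = (\<lambda>k l. f (k + l))"

definition first_col :: "(nat \<Rightarrow> nat \<Rightarrow> 'k::field) \<Rightarrow> nat \<Rightarrow> 'k" where
  "first_col u = (\<lambda>k. u k 0)"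

text \<open>A section of \<open>antidiag_sum\<close>: the entry (k, s - 1) lies on the antidiagonal
  of index k + s - 1.\<close>

definition last_col :: "nat \<Rightarrow> (nat \<Rightarrow> 'k::field) \<Rightarrow> nat \<Rightarrow> nat \<Rightarrow> 'k" where
  "last_col s e = (\<lambda>k l. if Suc l = s then e k else 0)"

text \<open>The solution u of (N + N') u = v with zero first column, obtained from the recursion u k
  (Suc l) = v k l + u (Suc k) l. Cutting it off at column s creates an error only in column s - 1,
  and that error is the class of v in the cokernel.\<close>

definition shift_sum_inv :: "nat \<Rightarrow> (nat \<Rightarrow> nat \<Rightarrow> 'k::field) \<Rightarrow> nat \<Rightarrow> nat \<Rightarrow> 'k" where
  "shift_sum_inv s v = (\<lambda>k l. if l < s then \<Sum>i<l. v (k + (l - Suc i)) i else 0)"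

text \<open>The projection onto the cokernel of N + N': the sum along the antidiagonal of index k +
  s - 1, on which the contributions of N u and N' u cancel.\<close>

definition antidiag_sum :: "nat \<Rightarrow> (nat \<Rightarrow> nat \<Rightarrow> 'k::field) \<Rightarrow> nat \<Rightarrow> 'k" where
  "antidiag_sum s v = (\<lambda>k. \<Sum>i<s. v (k + (s - Suc i)) i)"

text \<open>The complement of the kernel of N + N' that \<open>first_col\<close> selects;
  \<open>shift_sum\<close> maps it isomorphically onto the image.\<close>

definition grid_col0_space :: "nat \<Rightarrow> nat \<Rightarrow> ('k::field, nat \<Rightarrow> nat \<Rightarrow> 'k) kspace" where
  "grid_col0_space r s = \<lparr> carr = {u \<in> carr (grid_space r s). \<forall>k. u k 0 = 0}, smul = (\<lambda>c u k l. c * u k l) \<rparr>"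

lemma telescope_char2:
  assumes "CHAR('k::field) = 2"
  shows "(\<Sum>i<l. b i + b (Suc i)) = (b 0 + b l :: 'k)"
  by (induction l) (simp_all add: add_ac char2_add_self[OF assms] char2_cancel[OF assms])

text \<open>All maps of the splitting commute with N. No such rule is available for
  \<open>pencil_right\<close>, so the splitting is linear over k[N] only.\<close>

lemma pencil_maps:
  "antidiag_sum s (pencil_left c d v) = pencil c d (antidiag_sum s v)"
  "shift_sum_inv s (pencil_left c d v) = pencil_left c d (shift_sum_inv s v)"
  "first_col (pencil_left c d v) = pencil c d (first_col v)"
  "hankel (pencil c d f) = pencil_left c d (hankel f)"
  "last_col s (pencil c d f) = pencil_left c d (last_col s f)"
  "shift_sum (pencil_left c d v) = pencil_left c d (shift_sum v)"
proof -
  show "antidiag_sum s (pencil_left c d v) = pencil c d (antidiag_sum s v)"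
    by (intro ext) (simp only: antidiag_sum_def pencil_left_def pencil_def sum.distrib sum_distrib_left add_Suc)
  have "(\<Sum>i<l. pencil_left c d v (k + (l - Suc i)) i) = c * (\<Sum>i<l. v (k + (l - Suc i)) i) + d * (\<Sum>i<l. v (Suc k + (l - Suc i)) i)" for k l
    by (simp only: pencil_left_def sum.distrib sum_distrib_left add_Suc)
  then have "shift_sum_inv s (pencil_left c d v) k l = pencil_left c d (shift_sum_inv s v) k l" for k l
    by (cases "l < s") (simp_all only: shift_sum_inv_def pencil_left_def[of c d "\<lambda>k l. if l < s then _ k l else 0"]
      if_True if_False mult_zero_right add_0_right)
  then show "shift_sum_inv s (pencil_left c d v) = pencil_left c d (shift_sum_inv s v)"
    by (intro ext)
qed (auto simp: pencil_left_def pencil_def first_col_def hankel_def last_col_def shift_sum_def fun_eq_iff algebra_simps)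

lemma maps_additive:
  "antidiag_sum s (x + y) = antidiag_sum s x + antidiag_sum s y" "shift_sum_inv s (x + y) = shift_sum_inv s x + shift_sum_inv s y" "first_col (x + y) = first_col x + first_col y"
  "hankel (f + g) = hankel f + hankel g" "last_col s (f + g) = last_col s f + last_col s g" "shift_sum (x + y) = shift_sum x + shift_sum y"
  "sc c (x + y) = sc c x + sc c y"
  by (auto simp: antidiag_sum_def shift_sum_inv_def first_col_def hankel_def last_col_def shift_sum_def sc_def sum.distrib fun_eq_iff algebra_simps)

lemma maps_scale:
  "antidiag_sum s (sc c x) = (\<lambda>i. c * antidiag_sum s x i)" "shift_sum_inv s (sc c x) = sc c (shift_sum_inv s x)" "first_col (sc c x) = (\<lambda>i. c * first_col x i)"
  "hankel (\<lambda>i. c * f i) = sc c (hankel f)" "last_col s (\<lambda>i. c * f i) = sc c (last_col s f)" "shift_sum (sc c x) = sc c (shift_sum x)"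
  by (auto simp: antidiag_sum_def shift_sum_inv_def first_col_def hankel_def last_col_def shift_sum_def sc_def sum_distrib_left fun_eq_iff distrib_left)

lemma maps_mem:
  assumes "r \<le> s"
  shows "x \<in> carr (grid_space r s) \<Longrightarrow> antidiag_sum s x \<in> supp_below r"
    "x \<in> carr (grid_space r s) \<Longrightarrow> shift_sum_inv s x \<in> carr (grid_col0_space r s)"
    "x \<in> carr (grid_space r s) \<Longrightarrow> first_col x \<in> supp_below r"
    "f \<in> supp_below r \<Longrightarrow> hankel f \<in> carr (grid_space r s)"
    "f \<in> supp_below r \<Longrightarrow> last_col s f \<in> carr (grid_space r s)"
    "x \<in> carr (grid_space r s) \<Longrightarrow> shift_sum x \<in> carr (grid_space r s)"
    "x \<in> carr (grid_col0_space r s) \<Longrightarrow> x \<in> carr (grid_space r s)"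
  using assms by (auto simp: antidiag_sum_def shift_sum_inv_def first_col_def hankel_def last_col_def shift_sum_def grid_space_def grid_col0_space_def supp_below_def)

text \<open>Each sum along an antidiagonal telescopes in characteristic 2. The outcome is a split
  exact sequence from the kernel through two copies of the grid to the cokernel, with
  \<open>shift_sum_inv\<close> as the homotopy; r \<le> s makes the boundary values u (k + s) 0
  vanish.\<close>

lemma map_identities:
  assumes 2: "CHAR('k::field) = 2" and rs: "r \<le> s"
  shows "shift_sum (hankel f) = (0 :: nat \<Rightarrow> nat \<Rightarrow> 'k)"
    and "u \<in> carr (grid_space r s) \<Longrightarrow> antidiag_sum s (shift_sum u) = (0 :: nat \<Rightarrow> 'k)"
    and "u \<in> carr (grid_space r s) \<Longrightarrow> hankel (first_col u) + shift_sum_inv s (shift_sum u) = (u :: nat \<Rightarrow> nat \<Rightarrow> 'k)"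
    and "u \<in> carr (grid_space r s) \<Longrightarrow> last_col s (antidiag_sum s u) + shift_sum (shift_sum_inv s u) = (u :: nat \<Rightarrow> nat \<Rightarrow> 'k)"
    and "0 < s \<Longrightarrow> antidiag_sum s (last_col s f) = (f :: nat \<Rightarrow> 'k)"
    and "shift_sum_inv s (last_col s f) = (0 :: nat \<Rightarrow> nat \<Rightarrow> 'k)"
    and "first_col (hankel f) = f"
    and "u \<in> carr (grid_col0_space r s) \<Longrightarrow> first_col u = (0 :: nat \<Rightarrow> 'k)"
    and "u \<in> carr (grid_col0_space r s) \<Longrightarrow> shift_sum_inv s (shift_sum u) = (u :: nat \<Rightarrow> nat \<Rightarrow> 'k)"
proof -
  \<comment> \<open>All terms lie on one antidiagonal, and consecutive ones share an entry; only the
    entry in column 0 and the entry (k, l) survive.\<close>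
  have tel: "(\<Sum>i<l. shift_sum u (k + (l - Suc i)) i) = u (k + l) 0 + u k l" for u :: "nat \<Rightarrow> nat \<Rightarrow> 'k" and k l
  proof -
    have "(\<Sum>i<l. shift_sum u (k + (l - Suc i)) i) = (\<Sum>i<l. u (k + (l - i)) i + u (k + (l - Suc i)) (Suc i))"
      by (intro sum.cong) (auto simp: shift_sum_def Suc_diff_Suc simp flip: add_Suc_right)
    also have "\<dots> = u (k + l) 0 + u k l"
      using telescope_char2[OF 2, of "\<lambda>i. u (k + (l - i)) i" l] by simp
    finally show ?thesis .
  qed
  show "shift_sum (hankel f) = (0 :: nat \<Rightarrow> nat \<Rightarrow> 'k)"
    by (auto simp: shift_sum_def hankel_def fun_eq_iff char2_cancel[OF 2])
  show "antidiag_sum s (shift_sum u) = 0" if "u \<in> carr (grid_space r s)"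
  proof
    fix k show "antidiag_sum s (shift_sum u) k = 0 k"
      unfolding antidiag_sum_def tel using that rs by (simp add: grid_space_def)
  qed
  show 3: "hankel (first_col u) + shift_sum_inv s (shift_sum u) = u" if "u \<in> carr (grid_space r s)" for u :: "nat \<Rightarrow> nat \<Rightarrow> 'k"
  proof (intro ext)
    fix k l
    have "shift_sum_inv s (shift_sum u) k l = (if l < s then u (k + l) 0 + u k l else 0)"
      by (simp only: shift_sum_inv_def tel)
    then show "(hankel (first_col u) + shift_sum_inv s (shift_sum u)) k l = u k l"
      using that rs by (auto simp: grid_space_def hankel_def first_col_def char2_cancel[OF 2])
  qed
  show "last_col s (antidiag_sum s u) + shift_sum (shift_sum_inv s u) = u" if "u \<in> carr (grid_space r s)"
  proof (intro ext)
    fix k l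
    have e: "(\<Sum>i<l. u (Suc (k + (l - Suc i))) i) = (\<Sum>i<l. u (k + (l - i)) i)"
      by (intro sum.cong) (auto simp: Suc_diff_Suc simp flip: add_Suc_right)
    show "(last_col s (antidiag_sum s u) + shift_sum (shift_sum_inv s u)) k l = u k l"
      using that e by (cases "Suc l = s"; cases "l < s")
        (auto simp: last_col_def antidiag_sum_def shift_sum_def shift_sum_inv_def grid_space_def char2_cancel[OF 2] add_ac)
  qed
  show "antidiag_sum s (last_col s f) = f" if "0 < s"
  proof
    fix k
    have "antidiag_sum s (last_col s f) k = (\<Sum>i<s. if i = s - 1 then f k else 0)"
      unfolding antidiag_sum_def last_col_def using that by (intro sum.cong) auto
    then show "antidiag_sum s (last_col s f) k = f k" using that by simp
  qed
  show "shift_sum_inv s (last_col s f) = 0"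
    by (auto simp: shift_sum_inv_def last_col_def fun_eq_iff intro!: sum.neutral)
  show "first_col (hankel f) = f" by (simp add: first_col_def hankel_def)
  show 8: "first_col u = 0" if "u \<in> carr (grid_col0_space r s)"
    using that by (auto simp: first_col_def grid_col0_space_def fun_eq_iff)
  show "shift_sum_inv s (shift_sum u) = u" if "u \<in> carr (grid_col0_space r s)"
    using 3[of u] that 8 by (auto simp: grid_col0_space_def hankel_def first_col_def fun_eq_iff)
qed

lemma klin_grid_col0_space: "klin (grid_col0_space r s)"
  by (auto simp: klin_def subsp_def grid_space_def grid_col0_space_def plus_fun_def algebra_simps)

lemma spaces_smul: "smul (grid_space r s) = sc" "smul (grid_col0_space r s) = sc" "smul (seq_space r) = (\<lambda>c f i. c * f i)" "carr (seq_space r) = supp_below r"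
  by (auto simp: grid_space_def grid_col0_space_def seq_space_def sc_def fun_eq_iff)

section \<open>Reduction of the square at equal points\<close>

locale same_point =
  fixes r s :: nat and c1 d1 c2 d2 m n :: "'k::field"
  assumes char2: "CHAR('k) = 2" and rs: "r \<le> s" and s: "0 < s" and mn: "m * c1 + n * c2 = 1"
    and det: "c1 * d2 + c2 * d1 \<noteq> 0"
begin

abbreviation "p \<equiv> pencil_left c1 d1"
abbreviation "q \<equiv> pencil_left c2 d2"
abbreviation "p' \<equiv> pencil_right c1 d1"
abbreviation "q' \<equiv> pencil_right c2 d2"
abbreviation "V \<equiv> grid_space r s"
abbreviation "V' \<equiv> grid_col0_space r s"

definition "dt = c1 * d2 + c2 * d1"

sublocale P: pencil_pair V p q p' q'
  by (rule pencil_pair_grid_space[OF char2])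

definition h where "h u = sc m (p u) + sc n (q u)"
definition h' where "h' u = sc m (p' u) + sc n (q' u)"

lemma sc_maps: "p (sc a u) = sc a (p u)" "q (sc a u) = sc a (q u)" "p' (sc a u) = sc a (p' u)" "q' (sc a u) = sc a (q' u)"
  "sc a (sc b u) = sc (a * b) u" "sc 1 u = u" "shift_sum (sc a u) = sc a (shift_sum u)" "sc a 0 = 0"
  by (auto simp: sc_def pencil_left_def pencil_right_def shift_sum_def fun_eq_iff algebra_simps)

text \<open>Write p = c1 + d1 N and h = 1 + e N with e = m d1 + n d2. In p' h + h' p the constant
  terms and the terms in NN' cancel, which leaves (d1 + c1 e) (N + N'). Inserting m c1 + n c2 = 1
  into d1 turns the coefficient into n dt; the case of q is symmetric.\<close>

lemma key_identity:
  "p' (h u) + h' (p u) = sc (n * dt) (shift_sum u)" "q' (h u) + h' (q u) = sc (m * dt) (shift_sum u)"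
proof -
  have mn': "1 = m * c1 + n * c2" using mn by simp
  have "d1 * 1 + c1 * (m * d1 + n * d2) = n * dt + 2 * (m * (c1 * d1))"
    unfolding mn' dt_def by (simp add: algebra_simps)
  then have 1: "d1 + c1 * (m * d1 + n * d2) = n * dt"
    by (simp add: char2_cancel[OF char2])
  have "d2 * 1 + c2 * (m * d1 + n * d2) = m * dt + 2 * (n * (c2 * d2))"
    unfolding mn' dt_def by (simp add: algebra_simps)
  then have 2: "d2 + c2 * (m * d1 + n * d2) = m * dt"
    by (simp add: char2_cancel[OF char2])
  have h: "h u = pencil_left 1 (m * d1 + n * d2) u" "h' u = pencil_right 1 (m * d1 + n * d2) u" for u
    unfolding mn[symmetric] by (auto simp: h_def h'_def sc_def pencil_left_def pencil_right_def fun_eq_iff algebra_simps)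
  have gen: "pencil_right c d (pencil_left 1 e u) + pencil_right 1 e (pencil_left c d u) = sc (d + c * e) (shift_sum u)" for c d e
    by (auto simp: sc_def shift_sum_def pencil_left_def pencil_right_def fun_eq_iff algebra_simps char2_cancel[OF char2])
  show "p' (h u) + h' (p u) = sc (n * dt) (shift_sum u)" "q' (h u) + h' (q u) = sc (m * dt) (shift_sum u)"
    unfolding h gen 1 2 by simp_all
qed

end

context same_point
begin

definition h_inv where "h_inv = (SOME g. op_inverse r s h g)"

lemma h_bipencil: "h = bipencil 1 (m * d1 + n * d2) 0 0 1 1"
  unfolding mn[symmetric] by (auto simp: h_def sc_def pencil_left_def bipencil_def fun_eq_iff algebra_simps)

lemma h_inv_op_inverse: "op_inverse r s h h_inv"
proof -
  have "\<exists>g. op_inverse r s h g"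
    unfolding h_bipencil by (rule bipencil_inverse[OF char2]) simp
  then show ?thesis
    unfolding h_inv_def by (rule someI_ex)
qed

lemma h_maps: "h (p u) = p (h u)" "h (q u) = q (h u)" "h (p' u) = p' (h u)" "h (q' u) = q' (h u)"
   "h (sc c u) = sc c (h u)" "h (shift_sum u) = shift_sum (h u)" "h (u + v) = h u + h v" 
   "u \<in> carr V \<Longrightarrow> h u \<in> carr V" "u \<in> carr V' \<Longrightarrow> h u \<in> carr V'" 
  by (auto simp: h_def pencil_left_def pencil_right_def sc_def shift_sum_def fun_eq_iff grid_space_def grid_col0_space_def algebra_simps)

lemma h'_maps: "h' (p u) = p (h' u)" "h' (q u) = q (h' u)" "h' (sc c u) = sc c (h' u)" "h' (h u) = h (h' u)" "h' (u + v) = h' u + h' v" 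
   "u \<in> carr V \<Longrightarrow> h' u \<in> carr V" 
  by (auto simp: h'_def h_def pencil_left_def pencil_right_def sc_def shift_sum_def fun_eq_iff grid_space_def grid_col0_space_def algebra_simps)

lemma h_inv_maps: "h_inv (p u) = p (h_inv u)" "h_inv (q u) = q (h_inv u)" "h_inv (p' u) = p' (h_inv u)" "h_inv (q' u) = q' (h_inv u)"
   "h_inv (sc c u) = sc c (h_inv u)" "h_inv (shift_sum u) = shift_sum (h_inv u)" "h_inv (u + v) = h_inv u + h_inv v" "h_inv (h' u) = h' (h_inv u)"
   "u \<in> carr V \<Longrightarrow> h_inv u \<in> carr V" "u \<in> carr V' \<Longrightarrow> h_inv u \<in> carr V'" 
   "u \<in> carr V \<Longrightarrow> h_inv (h u) = u" "u \<in> carr V \<Longrightarrow> h (h_inv u) = u"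
proof -
  note E = op_inverseD(5)[OF h_inv_op_inverse]
  show "h_inv (p u) = p (h_inv u)" "h_inv (q u) = q (h_inv u)" "h_inv (p' u) = p' (h_inv u)" "h_inv (q' u) = q' (h_inv u)"
    "h_inv (sc c u) = sc c (h_inv u)" "h_inv (shift_sum u) = shift_sum (h_inv u)"  "h_inv (h' u) = h' (h_inv u)"
    by (rule E, simp add: h_maps h'_maps, auto simp: pencil_left_def pencil_right_def sc_def shift_sum_def h'_def fun_eq_iff algebra_simps; fail)+
  show "u \<in> carr V' \<Longrightarrow> h_inv u \<in> carr V'" 
    by (rule op_inverseD(6)[OF h_inv_op_inverse, of "carr V'"], erule h_maps(9)) (auto simp: grid_col0_space_def grid_space_def)
qed (rule op_inverseD[OF h_inv_op_inverse]; assumption?)+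

lemma V_le: "u \<in> carr V' \<Longrightarrow> u \<in> carr V"
  by (simp add: grid_col0_space_def)

lemma subV: "subsp V" "subsp V'" 
  using klin_grid_space[of r s] klin_grid_col0_space[of r s] by (auto simp: klin_def)

lemma V_simps [simp]: "0 \<in> carr V" "0 \<in> carr V'" "x \<in> carr V \<Longrightarrow> y \<in> carr V \<Longrightarrow> x + y \<in> carr V" 
   "x \<in> carr V' \<Longrightarrow> y \<in> carr V' \<Longrightarrow> x + y \<in> carr V'" "x \<in> carr V \<Longrightarrow> sc c x \<in> carr V" "x \<in> carr V' \<Longrightarrow> sc c x \<in> carr V'"
   "x \<in> carr V' \<Longrightarrow> p x \<in> carr V'" "x \<in> carr V' \<Longrightarrow> q x \<in> carr V'" "x \<in> carr V \<Longrightarrow> shift_sum x \<in> carr V"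
  by (auto simp: grid_space_def grid_col0_space_def sc_def pencil_left_def shift_sum_def)

lemmas all_maps = h_maps h'_maps h_inv_maps sc_maps maps_additive maps_scale pencil_maps

text \<open>The Koszul square after the elementary operation: p' and q' have become n dt and m dt
  times N + N', so every remaining operator other than \<open>shift_sum\<close> is a pencil in N
  alone.\<close>

definition "D1 = \<lparr> qU = V, qW = kpair V V, qZ = V,
   qa = (\<lambda>u. (p u, sc (n * dt) (shift_sum u))), qb = (\<lambda>u. (q u, sc (m * dt) (shift_sum u))),
   qc = (\<lambda>(y1, y2). sc (n * dt) (shift_sum y1) + p y2), qd = (\<lambda>(y1, y2). sc (m * dt) (shift_sum y1) + q y2) \<rparr>"

text \<open>On the complement of the kernel \<open>shift_sum\<close> is injective. Using its image
  as coordinates replaces N + N' by the identity in the second component.\<close>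

definition "D2 = \<lparr> qU = V', qW = kpair V' V', qZ = V',
   qa = (\<lambda>u. (p u, sc (n * dt) u)), qb = (\<lambda>u. (q u, sc (m * dt) u)),
   qc = (\<lambda>(y1, y2). sc (n * dt) y1 + p y2), qd = (\<lambda>(y1, y2). sc (m * dt) y1 + q y2) \<rparr>"

lemma D1_ok: "quad_ok D1"
  by (auto simp: quad_ok_def D1_def subsp_kpair subV) (auto simp: lin_map_def kpair_def add_ac spaces_smul all_maps mult.commute)

lemma D2_ok: "quad_ok D2"
  by (auto simp: quad_ok_def D2_def subsp_kpair subV) (auto simp: lin_map_def kpair_def add_ac spaces_smul all_maps mult.commute)

lemma key': "p' (h u) = sc (n * dt) (shift_sum u) + h' (p u)" "q' (h u) = sc (m * dt) (shift_sum u) + h' (q u)"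
proof -
  have "p' (h u) = (p' (h u) + h' (p u)) + h' (p u)" "q' (h u) = (q' (h u) + h' (q u)) + h' (q u)"
    by (simp_all only: add.assoc P.two' add_0_right)
  then show "p' (h u) = sc (n * dt) (shift_sum u) + h' (p u)" "q' (h u) = sc (m * dt) (shift_sum u) + h' (q u)"
    by (simp_all only: key_identity)
qed

lemma key_h_inv:
  assumes "u \<in> carr V"
  shows "p' u = sc (n * dt) (shift_sum (h_inv u)) + h' (p (h_inv u))" "q' u = sc (m * dt) (shift_sum (h_inv u)) + h' (q (h_inv u))"
  using key'[of "h_inv u"] h_inv_maps(12)[OF assms] by auto

text \<open>The second middle coordinate is increased by h' h^(-1) times the first. On the image of
  u = h v this gives p' h v + h' p v, which the key identity evaluates; the top layer has to be
  rescaled by h^(-1) to match.\<close>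

lemma stage1: "quad_iso P.quad_tensor D1"
proof (rule quad_isoI[OF P.quad_tensor_ok])
  show "lin_iso h_inv h (qU P.quad_tensor) (qU D1)"
    by (rule lin_isoI) (simp_all add: P.quad_tensor_def D1_def subV spaces_smul all_maps)
  show "lin_iso (\<lambda>x. x) (\<lambda>x. x) (qZ P.quad_tensor) (qZ D1)"
    by (rule lin_isoI) (simp_all add: P.quad_tensor_def D1_def subV)
  show "lin_iso (\<lambda>(s, t). (h_inv s, t + h' (h_inv s))) (\<lambda>(y1, y2). (h y1, h' y1 + y2)) (qW P.quad_tensor) (qW D1)"
    by (rule lin_isoI) (simp_all add: P.quad_tensor_def D1_def subV subsp_kpair, auto simp: kpair_def spaces_smul all_maps add_ac)
  fix w assume "w \<in> carr (qW P.quad_tensor)"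
  then obtain a b where w: "w = (a, b)" "a \<in> carr V" "b \<in> carr V" by (auto simp: P.quad_tensor_def kpair_def)
  then show "qc P.quad_tensor w = qc D1 (case w of (s, t) \<Rightarrow> (h_inv s, t + h' (h_inv s)))"
      "qd P.quad_tensor w = qd D1 (case w of (s, t) \<Rightarrow> (h_inv s, t + h' (h_inv s)))"
    by (simp_all add: P.quad_tensor_def D1_def key_h_inv[of a] all_maps add_ac)
next
  fix u assume "u \<in> carr (qU P.quad_tensor)"
  then have u: "u \<in> carr V" by (simp add: P.quad_tensor_def)
  show "(case qa P.quad_tensor u of (s, t) \<Rightarrow> (h_inv s, t + h' (h_inv s))) = qa D1 (h_inv u)"
      "(case qb P.quad_tensor u of (s, t) \<Rightarrow> (h_inv s, t + h' (h_inv s))) = qb D1 (h_inv u)"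
    by (simp_all add: P.quad_tensor_def D1_def key_h_inv[OF u] all_maps add_ac)
qed

text \<open>The kernel of N + N' splits off in the top layer and in the first middle component,
  giving the square of A. The cokernel splits off in the second middle component and in the bottom
  layer, giving the square of B. The rest is identified with \<open>D2\<close> through
  \<open>shift_sum\<close>.\<close>

lemma stage2: "quad_iso D1 (qprod (quad_A (pencil c1 d1) (pencil c2 d2) (seq_space r)) (qprod (quad_B (pencil c1 d1) (pencil c2 d2) (seq_space r)) D2))"
proof (rule quad_isoI[OF D1_ok])
  let ?R = "qprod (quad_A (pencil c1 d1) (pencil c2 d2) (seq_space r)) (qprod (quad_B (pencil c1 d1) (pencil c2 d2) (seq_space r)) D2)"
  note id = map_identities[OF char2 rs]
  note mem = maps_mem[OF rs]
  note defs = D1_def D2_def quad_A_def quad_B_def qprod_def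
  have z: "shift_sum 0 = 0" "shift_sum_inv s 0 = 0" "antidiag_sum s 0 = 0" "first_col 0 = 0" "hankel 0 = 0" "last_col s 0 = 0" 
    by (auto simp: shift_sum_def shift_sum_inv_def antidiag_sum_def first_col_def hankel_def last_col_def fun_eq_iff)
  show "lin_iso (\<lambda>u. (first_col u, (0, shift_sum_inv s (shift_sum u)))) (\<lambda>(f, (e, u)). hankel f + u) (qU D1) (qU ?R)"
    by (rule lin_isoI) (simp_all add: defs subV, auto simp: kpair_def kzero_def spaces_smul mem id all_maps z s)
  show "lin_iso (\<lambda>z. (0, (antidiag_sum s z, shift_sum_inv s z))) (\<lambda>(f, (e, u)). last_col s e + shift_sum u) (qZ D1) (qZ ?R)"
    by (rule lin_isoI) (simp_all add: defs subV, auto simp: kpair_def kzero_def spaces_smul mem id all_maps z s)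
  show "lin_iso (\<lambda>(y1, y2). (first_col y1, (antidiag_sum s y2, (shift_sum_inv s (shift_sum y1), shift_sum_inv s y2)))) (\<lambda>(f, (e, (a, b))). (hankel f + a, last_col s e + shift_sum b)) (qW D1) (qW ?R)"
    by (rule lin_isoI) (simp_all add: defs subV subsp_kpair, auto simp: kpair_def kzero_def spaces_smul mem id all_maps z s)
qed (auto simp: D1_def D2_def quad_A_def quad_B_def qprod_def kpair_def all_maps map_identities[OF char2 rs] zero_fun_def)

text \<open>The matrix with columns (p, n dt) and (q, m dt) has determinant dt (m p + n q) = dt h, a
  unit. As for distinct points, adjugate over determinant is the isomorphism with the free
  square.\<close>

lemma stage3: "quad_iso D2 (quad_P V')"
proof (rule quad_isoI[OF D2_ok])
  have dt: "dt \<noteq> 0" using det by (simp add: dt_def)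
  have *: "sc m (p (h_inv u)) = u + sc n (q (h_inv u))" if "u \<in> carr V'" for u
  proof -
    have "sc m (p (h_inv u)) + sc n (q (h_inv u)) = u"
      using h_inv_maps(12)[OF V_le[OF that]] by (simp only: h_def)
    then have "u + sc n (q (h_inv u)) = sc m (p (h_inv u)) + sc n (q (h_inv u)) + sc n (q (h_inv u))" by simp
    then show ?thesis by (simp only: add.assoc P.two' add_0_right)
  qed
  note simps = dt * kpair_def spaces_smul all_maps add_ac mult_ac V_le sc_def[of 0]
  show "lin_iso (\<lambda>u. u) (\<lambda>u. u) (qU D2) (qU (quad_P V'))"
    by (rule lin_isoI) (simp_all add: D2_def quad_P_def subV)
  show "lin_iso (\<lambda>z. sc (1 / dt) (h_inv z)) (\<lambda>z. sc dt (h z)) (qZ D2) (qZ (quad_P V'))"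
    by (rule lin_isoI) (simp_all add: D2_def quad_P_def subV, simp_all add: simps)
  show "lin_iso (\<lambda>(a, b). (h_inv (sc m a + sc (1 / dt) (q b)), h_inv (sc n a + sc (1 / dt) (p b))))
      (\<lambda>(g1, g2). (p g1 + q g2, sc dt (sc n g1 + sc m g2))) (qW D2) (qW (quad_P V'))"
    by (rule lin_isoI) (simp_all add: D2_def quad_P_def subV subsp_kpair, auto simp: simps)
  fix w assume "w \<in> carr (qW D2)"
  then obtain a b where w: "w = (a, b)" "a \<in> carr V'" "b \<in> carr V'" by (auto simp: D2_def kpair_def)
  then show "sc (1 / dt) (h_inv (qc D2 w)) = qc (quad_P V') (case w of (a, b) \<Rightarrow> (h_inv (sc m a + sc (1 / dt) (q b)), h_inv (sc n a + sc (1 / dt) (p b))))"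
      "sc (1 / dt) (h_inv (qd D2 w)) = qd (quad_P V') (case w of (a, b) \<Rightarrow> (h_inv (sc m a + sc (1 / dt) (q b)), h_inv (sc n a + sc (1 / dt) (p b))))"
    by (simp_all add: D2_def quad_P_def simps)
next
  have dt: "dt \<noteq> 0" using det by (simp add: dt_def)
  fix u assume "u \<in> carr (qU D2)"
  then have u: "u \<in> carr V'" by (simp add: D2_def)
  have "sc m (p (h_inv u)) + sc n (q (h_inv u)) = u"
    using h_inv_maps(12)[OF V_le[OF u]] by (simp only: h_def)
  then show "(case qa D2 u of (a, b) \<Rightarrow> (h_inv (sc m a + sc (1 / dt) (q b)), h_inv (sc n a + sc (1 / dt) (p b)))) = qa (quad_P V') u"
     "(case qb D2 u of (a, b) \<Rightarrow> (h_inv (sc m a + sc (1 / dt) (q b)), h_inv (sc n a + sc (1 / dt) (p b)))) = qb (quad_P V') u"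
    using dt by (simp_all add: D2_def quad_P_def all_maps add_ac mult_ac)
qed

lemma quad_iso_same:
  "quad_iso P.quad_tensor (qprod (quad_A (pencil c1 d1) (pencil c2 d2) (seq_space r)) (qprod (quad_B (pencil c1 d1) (pencil c2 d2) (seq_space r)) (quad_P V')))"
proof -
  have l: "lin_map (seq_space r) (seq_space r) (pencil c1 d1)" "lin_map (seq_space r) (seq_space r) (pencil c2 d2)" 
    by (rule lin_pencil)+
  show ?thesis
    using quad_iso_trans[OF stage1 quad_iso_trans[OF stage2
      qprod_cong2[OF quad_A_ok[OF klin_seq_space l] qprod_cong2[OF quad_B_ok[OF klin_seq_space l] stage3]]]] .
qed

end


section \<open>The projective covers of the simple modules\<close>

definition fun8 :: "'k \<Rightarrow> 'k \<Rightarrow> 'k \<Rightarrow> 'k \<Rightarrow> 'k \<Rightarrow> 'k \<Rightarrow> 'k \<Rightarrow> 'k \<Rightarrow> nat \<Rightarrow> 'k::field" where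
  "fun8 x0 x1 x2 x3 x4 x5 x6 x7 = (\<lambda>i. if i = 0 then x0 else if i = 1 then x1 else if i = 2 then x2
     else if i = 3 then x3 else if i = 4 then x4 else if i = 5 then x5 else if i = 6 then x6 else if i = 7 then x7 else 0)"

lemma supp8E:
  assumes "f \<in> supp_below 8"
  obtains x0 x1 x2 x3 x4 x5 x6 x7 where "f = fun8 x0 x1 x2 x3 x4 x5 x6 x7"
proof (rule that)
  show "f = fun8 (f 0) (f 1) (f 2) (f 3) (f 4) (f 5) (f 6) (f 7)"
  proof
    fix i
    consider "i = 0" | "i = 1" | "i = 2" | "i = 3" | "i = 4" | "i = 5" | "i = 6" | "i = 7" | "i \<ge> (8::nat)" by linarith
    then show "f i = fun8 (f 0) (f 1) (f 2) (f 3) (f 4) (f 5) (f 6) (f 7) i"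
      by cases (use assms in \<open>auto simp: fun8_def supp_below_def\<close>)
  qed
qed

definition sparse :: "(nat \<times> nat) set \<Rightarrow> 'k::field mat" where
  "sparse S = mat 8 8 (\<lambda>ij. if ij \<in> S then 1 else 0)"

text \<open>With generator e0 the basis is e0, a e0, a^2 e0, a^3 e0, b^3 e0, b^2 e0, b e0, ab e0.
  The two chains of length three are the copies of V1 in the middle layer, and ab e0 = ba e0 spans
  the socle.\<close>

definition P0c :: "'k::field um_rep" where
  "P0c = \<lparr> mdim = 8,
     act_a = sparse {(1, 0), (2, 1), (3, 2), (5, 4), (6, 5), (7, 6)},
     act_b = sparse {(6, 0), (5, 6), (4, 5), (2, 3), (1, 2), (7, 1)},
     act_c = sparse {(1, 1), (3, 3), (4, 4), (6, 6)} \<rparr>"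

text \<open>With generator e0 the basis is a^i e0 followed by a^i b e0 for i = 0, ..., 3. The
  entries (5, 1) and (6, 2) of b are the correction terms of \<open>layers_101\<close>.\<close>

definition P1c :: "'k::field um_rep" where
  "P1c = \<lparr> mdim = 8,
     act_a = sparse {(1, 0), (2, 1), (3, 2), (5, 4), (6, 5), (7, 6)},
     act_b = sparse {(4, 0), (0, 1), (5, 1), (1, 2), (6, 2), (7, 3), (6, 7), (5, 6)},
     act_c = sparse {(0, 0), (2, 2), (5, 5), (7, 7)} \<rparr>"

lemma lessThan_8: "{..<8::nat} = {0, 1, 2, 3, 4, 5, 6, 7}"
  by auto

lemma fun8_nth: "fun8 x0 x1 x2 x3 x4 x5 x6 x7 0 = x0" "fun8 x0 x1 x2 x3 x4 x5 x6 x7 (Suc 0) = x1" "fun8 x0 x1 x2 x3 x4 x5 x6 x7 2 = x2"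
  "fun8 x0 x1 x2 x3 x4 x5 x6 x7 3 = x3" "fun8 x0 x1 x2 x3 x4 x5 x6 x7 4 = x4" "fun8 x0 x1 x2 x3 x4 x5 x6 x7 5 = x5"
  "fun8 x0 x1 x2 x3 x4 x5 x6 x7 6 = x6" "fun8 x0 x1 x2 x3 x4 x5 x6 x7 7 = x7"
  by (simp_all add: fun8_def)

lemma fun8_supp: "fun8 x0 x1 x2 x3 x4 x5 x6 x7 \<in> supp_below 8"
  by (auto simp: fun8_def supp_below_def)

lemma mat_fun_sparse:
  assumes "\<And>i. i < 8 \<Longrightarrow> y i = (\<Sum>j<8. if (i, j) \<in> S then f j else 0)"
  shows "mat_fun (sparse S) f = fun8 (y 0) (y 1) (y 2) (y 3) (y 4) (y 5) (y 6) (y 7)"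
proof
  fix i
  have "mat_fun (sparse S) f i = y i" if "i < 8"
    unfolding assms[OF that] using that by (auto simp: mat_fun_def sparse_def intro!: sum.cong)
  note main = this
  consider "i = 0" | "i = 1" | "i = 2" | "i = 3" | "i = 4" | "i = 5" | "i = 6" | "i = 7" | "i \<ge> (8::nat)" by linarith
  then show "mat_fun (sparse S) f i = fun8 (y 0) (y 1) (y 2) (y 3) (y 4) (y 5) (y 6) (y 7) i"
  proof cases
    case 9 then show ?thesis by (simp add: fun8_def mat_fun_def sparse_def)
  qed (use main in \<open>simp_all add: fun8_nth\<close>)
qed

lemma sparse_carrier [simp]: "sparse S \<in> carrier_mat 8 8" by (simp add: sparse_def)

lemma mat_fun_P0c:
  "mat_fun (act_a P0c) (fun8 x0 x1 x2 x3 x4 x5 x6 x7) = fun8 0 x0 x1 x2 0 x4 x5 x6"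
  "mat_fun (act_b P0c) (fun8 x0 x1 x2 x3 x4 x5 x6 x7) = fun8 0 x2 x3 0 x5 x6 x0 x1"
  "mat_fun (act_c P0c) (fun8 x0 x1 x2 x3 x4 x5 x6 x7) = fun8 0 x1 0 x3 x4 0 x6 0"
  unfolding P0c_def um_rep.simps
  by (subst mat_fun_sparse[OF refl]; simp add: lessThan_8 fun8_nth)+

lemma mat_fun_P1c:
  "mat_fun (act_a P1c) (fun8 x0 x1 x2 x3 x4 x5 x6 x7) = fun8 0 x0 x1 x2 0 x4 x5 x6"
  "mat_fun (act_b P1c) (fun8 x0 x1 x2 x3 x4 x5 x6 x7) = fun8 x1 x2 0 0 x0 (x1 + x6) (x2 + x7) x3"
  "mat_fun (act_c P1c) (fun8 x0 x1 x2 x3 x4 x5 x6 x7) = fun8 x0 0 x2 0 0 x5 0 x7"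
  unfolding P1c_def um_rep.simps
  by (subst mat_fun_sparse[OF refl]; simp add: lessThan_8 fun8_nth)+

lemma Pc_carrier [simp]: "mdim P0c = 8" "act_a P0c \<in> carrier_mat 8 8" "act_b P0c \<in> carrier_mat 8 8" "act_c P0c \<in> carrier_mat 8 8"
  "mdim P1c = 8" "act_a P1c \<in> carrier_mat 8 8" "act_b P1c \<in> carrier_mat 8 8" "act_c P1c \<in> carrier_mat 8 8"
  by (auto simp: P0c_def P1c_def)

lemma fun8_plus: "(\<lambda>i. fun8 x0 x1 x2 x3 x4 x5 x6 x7 i + fun8 y0 y1 y2 y3 y4 y5 y6 y7 i) = fun8 (x0+y0) (x1+y1) (x2+y2) (x3+y3) (x4+y4) (x5+y5) (x6+y6) (x7+y7)"
  by (auto simp: fun8_def fun_eq_iff)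

lemma fun8_zero: "fun8 0 0 0 0 0 0 0 0 = (\<lambda>_. 0)"
  by (auto simp: fun8_def fun_eq_iff)

lemma mat_fun_zero_mat: "mat_fun (0\<^sub>m n m) f = (\<lambda>_. 0)"
  by (auto simp: mat_fun_def fun_eq_iff)

lemma um_moduleI:
  fixes M :: "'k::field um_rep"
  assumes 2: "CHAR('k) = 2"
    and c: "act_a M \<in> carrier_mat n n" "act_b M \<in> carrier_mat n n" "act_c M \<in> carrier_mat n n" "mdim M = n"
    and rel: "\<And>f. f \<in> supp_below n \<Longrightarrow> (let a = mat_fun (act_a M); b = mat_fun (act_b M); c = mat_fun (act_c M) in
       (\<lambda>i. a (b f) i + b (a f) i) = c f \<and> (\<lambda>i. a (c f) i + c (a f) i) = a f \<and> (\<lambda>i. b (c f) i + c (b f) i) = b f \<and>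
       a (a (a (a f))) = (\<lambda>_. 0) \<and> b (b (b (b f))) = (\<lambda>_. 0) \<and> (\<lambda>i. c (c f) i + c f i) = (\<lambda>_. 0))"
  shows "um_module M"
proof -
  have m: "mat_fun (X * Y) f = mat_fun X (mat_fun Y f)" if "X \<in> carrier_mat n n" "Y \<in> carrier_mat n n" for X Y :: "'k mat" and f
    using mat_fun_mult that by blast
  have p: "mat_fun (X + Y) f = (\<lambda>i. mat_fun X f i + mat_fun Y f i)" if "X \<in> carrier_mat n n" "Y \<in> carrier_mat n n" for X Y :: "'k mat" and f
    using mat_fun_add_mat that by blast
  show ?thesis
    unfolding um_module_def Let_def c(4) pow_mat_4[OF c(1)] pow_mat_4[OF c(2)] pow_mat_2[OF c(3)]
    using rel[unfolded Let_def] c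
    by (auto intro!: mat_fun_eqI[of _ n n] simp: m p mat_fun_zero_mat)
qed

lemma P0c_module: "CHAR('k::field) = 2 \<Longrightarrow> um_module (P0c :: 'k um_rep)"
  by (rule um_moduleI[where n = 8]) (auto elim!: supp8E simp: mat_fun_P0c fun8_plus fun8_zero char2_add_self)

lemma P1c_module: 
  assumes "CHAR('k::field) = 2"
  shows "um_module (P1c :: 'k um_rep)"
proof (rule um_moduleI[OF assms, where n = 8])
  note 2 = char2_add_self[OF assms] char2_cancel(1)[OF assms]
  have 3: "x + y + y = x" for x y :: 'k
    by (simp add: add.assoc 2)
  fix f :: "nat \<Rightarrow> 'k" assume "f \<in> supp_below 8"
  then obtain x0 x1 x2 x3 x4 x5 x6 x7 where f: "f = fun8 x0 x1 x2 x3 x4 x5 x6 x7"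
    by (rule supp8E)
  show "let a = mat_fun (act_a P1c); b = mat_fun (act_b P1c); c = mat_fun (act_c P1c) in
       (\<lambda>i. a (b f) i + b (a f) i) = c f \<and> (\<lambda>i. a (c f) i + c (a f) i) = a f \<and> (\<lambda>i. b (c f) i + c (b f) i) = b f \<and>
       a (a (a (a f))) = (\<lambda>_. 0) \<and> b (b (b (b f))) = (\<lambda>_. 0) \<and> (\<lambda>i. c (c f) i + c f i) = (\<lambda>_. 0)"
    unfolding f Let_def mat_fun_P1c fun8_plus by (simp add: 2 3 fun8_zero char2_cancel(2)[OF assms])
qed simp_all

section \<open>Calculation in a module and lifting out of the models\<close>

definition scale_fun :: "'k::field \<Rightarrow> (nat \<Rightarrow> 'k) \<Rightarrow> nat \<Rightarrow> 'k" where
  "scale_fun c f = (\<lambda>i. c * f i)"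

locale um_ops =
  fixes M :: "'k::field um_rep"
  assumes char2: "CHAR('k) = 2" and module: "um_module M"
begin

abbreviation "a \<equiv> mat_fun (act_a M)"
abbreviation "b \<equiv> mat_fun (act_b M)"
abbreviation "c \<equiv> mat_fun (act_c M)"

lemma carrier: "act_a M \<in> carrier_mat (mdim M) (mdim M)" "act_b M \<in> carrier_mat (mdim M) (mdim M)" "act_c M \<in> carrier_mat (mdim M) (mdim M)"
  using module by (auto simp: um_module_def Let_def)

lemma closed [simp]: "a f \<in> supp_below (mdim M)" "b f \<in> supp_below (mdim M)" "c f \<in> supp_below (mdim M)"
  using carrier by (auto intro: mat_fun_supp)

lemma two [simp]: "(x :: nat \<Rightarrow> 'k) + x = 0" "x + (x + y) = y"
proof -
  show "x + x = 0"
  proof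
    fix i show "(x + x) i = 0 i"
      using char2_add_self[OF char2, of "x i"] by (simp only: plus_fun_def zero_fun_def)
  qed
  then show "x + (x + y) = y" by (simp flip: add.assoc)
qed

lemma linear [simp]: "a (x + y) = a x + a y" "b (x + y) = b x + b y" "c (x + y) = c x + c y"
  "a (scale_fun k x) = scale_fun k (a x)" "b (scale_fun k x) = scale_fun k (b x)" "c (scale_fun k x) = scale_fun k (c x)"
  "a 0 = 0" "b 0 = 0" "c 0 = 0"
  by (simp_all add: mat_fun_plus scale_fun_def mat_fun_smult) (simp_all add: mat_fun_def fun_eq_iff)

lemma rel: "a (b x) + b (a x) = c x" "a (c x) + c (a x) = a x" "b (c x) + c (b x) = b x"
  "c (c x) + c x = 0" and nil [simp]: "a (a (a (a x))) = 0" "b (b (b (b x))) = 0"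
proof -
  note C = carrier
  have pl: "mat_fun (X + Y) x = mat_fun X x + mat_fun Y x" if "X \<in> carrier_mat (mdim M) (mdim M)" "Y \<in> carrier_mat (mdim M) (mdim M)" for X Y
    using mat_fun_add_mat[OF that] by (simp add: plus_fun_def)
  have *: "act_a M * act_b M + act_b M * act_a M = act_c M" "act_a M * act_c M + act_c M * act_a M = act_a M"
    "act_b M * act_c M + act_c M * act_b M = act_b M"
    "act_a M * act_a M * act_a M * act_a M = 0\<^sub>m (mdim M) (mdim M)"
    "act_b M * act_b M * act_b M * act_b M = 0\<^sub>m (mdim M) (mdim M)"
    "act_c M * act_c M + act_c M = 0\<^sub>m (mdim M) (mdim M)"
    using module C by (auto simp: um_module_def Let_def pow_mat_4[of _ "mdim M"] pow_mat_2[of _ "mdim M"])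
  have m: "mat_fun (X * Y) x = mat_fun X (mat_fun Y x)" if "X \<in> carrier_mat (mdim M) (mdim M)" "Y \<in> carrier_mat (mdim M) (mdim M)" for X Y x
    using mat_fun_mult that by blast
  show "a (b x) + b (a x) = c x" "a (c x) + c (a x) = a x" "b (c x) + c (b x) = b x"
    "c (c x) + c x = 0" "a (a (a (a x))) = 0" "b (b (b (b x))) = 0"
    using arg_cong[OF *(1), of "\<lambda>X. mat_fun X x"] arg_cong[OF *(2), of "\<lambda>X. mat_fun X x"] arg_cong[OF *(3), of "\<lambda>X. mat_fun X x"]
       arg_cong[OF *(4), of "\<lambda>X. mat_fun X x"] arg_cong[OF *(5), of "\<lambda>X. mat_fun X x"] arg_cong[OF *(6), of "\<lambda>X. mat_fun X x"] C
    by (simp_all add: pl m mat_fun_zero_mat zero_fun_def)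
qed

text \<open>As rewrite rules the relations move every word to the order a, b, c. Together with a^4 =
  b^4 = 0 and x + x = 0 this lets the simplifier prove identities between words by comparing
  combinations of a^i b^j c^k with i, j < 4 and k < 2.\<close>

lemma normalise [simp]: "b (a x) = a (b x) + c x" "c (a x) = a x + a (c x)" "c (b x) = b x + b (c x)" "c (c x) = c x"
proof -
  have *: "y = x + z" if "x + y = z" for x y z :: "nat \<Rightarrow> 'k"
    using two(2)[of x y] that by simp
  show "b (a x) = a (b x) + c x" by (rule *[OF rel(1)])
  show "c (a x) = a x + a (c x)" using *[OF rel(2)] by (simp add: add.commute)
  show "c (b x) = b x + b (c x)" using *[OF rel(3)] by (simp add: add.commute)
  show "c (c x) = c x" using *[OF rel(4)[unfolded add.commute[of "c (c x)"]]] by simp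
qed

text \<open>
  \<open>e0\<close> and \<open>e1\<close> project every module onto the vectors that satisfy the defining relations of the generator
  of \<open>P\<^sub>0\<close> and \<open>P\<^sub>1\<close>; being elements of the algebra they commute with homomorphisms, so they correct an
  arbitrary preimage under an epimorphism to one that defines a lift.
\<close>

definition e0 where "e0 m = (let y = m + a (b (b (a (a (b m + a (b (b m))))))) in y + c y)"
definition e1 where "e1 m = b (b (a (a (c m))))"

text \<open>In normal form b^2 a m is b m + a b^2 m, the innermost bracket of \<open>e0\<close>. So
  the correction added to m vanishes when b^2 a m = 0, and y + c y is the part of y on which c is 0.
  The conditions themselves are identities of words.\<close>

lemma e0: "c (e0 m) = 0" "a (a (b (e0 m))) = 0" "b (b (a (e0 m))) = 0"
  "c m = 0 \<Longrightarrow> a (a (b m)) = 0 \<Longrightarrow> b (b (a m)) = 0 \<Longrightarrow> e0 m = m"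
  by (simp_all add: e0_def Let_def add_ac)

lemma e1: "c (e1 m) = e1 m" "b (b (e1 m)) = 0" "c m = m \<Longrightarrow> b (b m) = 0 \<Longrightarrow> e1 m = m"
  by (simp_all add: e1_def add_ac)

text \<open>The coordinate i of f multiplies the monomial that produces basis vector i of
  \<open>P0c\<close> from its generator; this is the map out of \<open>P0c\<close> that sends the
  generator to x.\<close>

definition ev0 where "ev0 f x = scale_fun (f 0) x + scale_fun (f 1) (a x) + scale_fun (f 2) (a (a x)) + scale_fun (f 3) (a (a (a x)))
   + scale_fun (f 4) (b (b (b x))) + scale_fun (f 5) (b (b x)) + scale_fun (f 6) (b x) + scale_fun (f 7) (a (b x))"

definition ev1 where "ev1 f x = scale_fun (f 0) x + scale_fun (f 1) (a x) + scale_fun (f 2) (a (a x)) + scale_fun (f 3) (a (a (a x)))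
   + scale_fun (f 4) (b x) + scale_fun (f 5) (a (b x)) + scale_fun (f 6) (a (a (b x))) + scale_fun (f 7) (a (a (a (b x))))"

lemma scale_fun_simps: "scale_fun k (x + y) = scale_fun k x + scale_fun k y" "scale_fun k 0 = 0" "scale_fun 0 x = 0" "scale_fun (k + l) x = scale_fun k x + scale_fun l x"
  by (auto simp: scale_fun_def fun_eq_iff algebra_simps)

lemma ev0_hom:
  assumes "c x = 0" "a (a (b x)) = 0" "b (b (a x)) = 0" "f \<in> supp_below 8"
  shows "ev0 (mat_fun (act_a P0c) f) x = a (ev0 f x)" "ev0 (mat_fun (act_b P0c) f) x = b (ev0 f x)"
proof -
  \<comment> \<open>Normalising b^2 a x yields a b^2 x + b x, so the third relation says that a b^2
    x = b x. This identity makes the chain b x, b^2 x, b^3 x a copy of V1 under a.\<close>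
  have "b x + a (b (b x)) = 0" using assms(1,3) by (simp add: add_ac)
  then have ab: "a (b (b x)) = b x"
    using two(2)[of "b x" "a (b (b x))"] by simp
  then have "b (a (b (b x))) = b (b x)" by simp
  then have ab3: "a (b (b (b x))) = b (b x) + c (b (b x))"
    using normalise(1)[of "b (b x)"] two by (metis add.commute)
  obtain x0 x1 x2 x3 x4 x5 x6 x7 where f: "f = fun8 x0 x1 x2 x3 x4 x5 x6 x7"
    using assms(4) by (rule supp8E)
  show "ev0 (mat_fun (act_a P0c) f) x = a (ev0 f x)" "ev0 (mat_fun (act_b P0c) f) x = b (ev0 f x)"
    unfolding f using assms(1-2) ab ab3 by (simp_all add: ev0_def mat_fun_P0c fun8_nth scale_fun_simps add_ac)
qed

lemma ev1_hom:
  assumes "c x = x" "b (b x) = 0" "f \<in> supp_below 8"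
  shows "ev1 (mat_fun (act_a P1c) f) x = a (ev1 f x)" "ev1 (mat_fun (act_b P1c) f) x = b (ev1 f x)"
proof -
  obtain x0 x1 x2 x3 x4 x5 x6 x7 where f: "f = fun8 x0 x1 x2 x3 x4 x5 x6 x7"
    using assms(3) by (rule supp8E)
  show "ev1 (mat_fun (act_a P1c) f) x = a (ev1 f x)" "ev1 (mat_fun (act_b P1c) f) x = b (ev1 f x)"
    unfolding f using assms(1-2) by (simp_all add: ev1_def mat_fun_P1c fun8_nth scale_fun_simps add_ac)
qed

end

lemma um_homI:
  assumes M: "um_pre M" and N: "um_pre N" and F: "F \<in> carrier_mat (mdim N) (mdim M)"
    and a: "\<And>f. f \<in> supp_below (mdim M) \<Longrightarrow> mat_fun F (mat_fun (act_a M) f) = mat_fun (act_a N) (mat_fun F f)"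
    and b: "\<And>f. f \<in> supp_below (mdim M) \<Longrightarrow> mat_fun F (mat_fun (act_b M) f) = mat_fun (act_b N) (mat_fun F f)"
  shows "F \<in> um_hom M N"
proof -
  let ?m = "mdim M" and ?n = "mdim N"
  have MA: "act_a M \<in> carrier_mat ?m ?m" "act_b M \<in> carrier_mat ?m ?m" "act_c M \<in> carrier_mat ?m ?m"
    and NA: "act_a N \<in> carrier_mat ?n ?n" "act_b N \<in> carrier_mat ?n ?n" "act_c N \<in> carrier_mat ?n ?n"
    and MC: "act_a M * act_b M + act_b M * act_a M = act_c M" and NC: "act_a N * act_b N + act_b N * act_a N = act_c N"
    using M N by (auto simp: um_pre_def)
  have cc: "mat_fun F (mat_fun (act_c M) f) = mat_fun (act_c N) (mat_fun F f)" if f: "f \<in> supp_below ?m" for f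
  proof -
    have "mat_fun (act_c M) f = mat_fun (act_a M) (mat_fun (act_b M) f) + mat_fun (act_b M) (mat_fun (act_a M) f)"
      unfolding MC[symmetric] using MA by (simp add: mat_fun_add_mat[of _ ?m ?m] mat_fun_mult[OF MA(1,2)] mat_fun_mult[OF MA(2,1)] plus_fun_def)
    moreover have "mat_fun (act_c N) g = mat_fun (act_a N) (mat_fun (act_b N) g) + mat_fun (act_b N) (mat_fun (act_a N) g)" for g
      unfolding NC[symmetric] using NA by (simp add: mat_fun_add_mat[of _ ?n ?n] mat_fun_mult[OF NA(1,2)] mat_fun_mult[OF NA(2,1)] plus_fun_def)
    ultimately show ?thesis
      using a b f mat_fun_supp[OF MA(1)] mat_fun_supp[OF MA(2)] by (simp add: mat_fun_plus)
  qed
  have "F * X = Y * F" if "X \<in> carrier_mat ?m ?m" "Y \<in> carrier_mat ?n ?n" 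
      "\<And>f. f \<in> supp_below (mdim M) \<Longrightarrow> mat_fun F (mat_fun X f) = mat_fun Y (mat_fun F f)" for X Y
    by (rule mat_fun_eqI[of _ ?n ?m]) (use that F in \<open>auto simp: mat_fun_mult[OF F that(1)] mat_fun_mult[OF that(2) F]\<close>)
  then show ?thesis
    unfolding um_hom_def using F MA NA a b cc by auto
qed

lemma um_homD:
  assumes "F \<in> um_hom M N" "um_pre M" "um_pre N"
  shows "mat_fun F (mat_fun (act_a M) f) = mat_fun (act_a N) (mat_fun F f)" "mat_fun F (mat_fun (act_b M) f) = mat_fun (act_b N) (mat_fun F f)"
    "mat_fun F (mat_fun (act_c M) f) = mat_fun (act_c N) (mat_fun F f)"
  using assms unfolding um_hom_def um_pre_def
  by (auto simp flip: mat_fun_mult[of F "mdim N" "mdim M" _ "mdim M"] mat_fun_mult[of _ "mdim N" "mdim N" F "mdim M"])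

definition vfun :: "'k::field vec \<Rightarrow> nat \<Rightarrow> 'k" where
  "vfun v = (\<lambda>i. if i < dim_vec v then v $ i else 0)"

lemma vfun_mult: "X \<in> carrier_mat n m \<Longrightarrow> v \<in> carrier_vec m \<Longrightarrow> vfun (X *\<^sub>v v) = mat_fun X (vfun v)"
  by (auto simp: vfun_def mat_fun_def scalar_prod_def atLeast0LessThan fun_eq_iff)

lemma vfun_supp: "v \<in> carrier_vec n \<Longrightarrow> vfun v \<in> supp_below n"
  by (auto simp: vfun_def supp_below_def)

lemma vfun_vec: "f \<in> supp_below n \<Longrightarrow> vfun (vec n f) = f"
  by (auto simp: vfun_def supp_below_def fun_eq_iff)

lemma vec_vfun: "v \<in> carrier_vec n \<Longrightarrow> vec n (vfun v) = v"
  by (auto simp: vfun_def)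

lemma um_epi_surj:
  assumes "E \<in> um_epi M N" "x \<in> supp_below (mdim N)"
  obtains y where "y \<in> supp_below (mdim M)" "mat_fun E y = x"
proof -
  have E: "E \<in> carrier_mat (mdim N) (mdim M)" "(\<lambda>v. E *\<^sub>v v) ` carrier_vec (mdim M) = carrier_vec (mdim N)"
    using assms(1) by (auto simp: um_epi_def um_hom_def)
  have "vec (mdim N) x \<in> carrier_vec (mdim N)" by simp
  then obtain v where v: "v \<in> carrier_vec (mdim M)" "E *\<^sub>v v = vec (mdim N) x"
    using E(2) by (metis imageE)
  show thesis
    using that[OF vfun_supp[OF v(1)]] vfun_mult[OF E(1) v(1)] v(2) vfun_vec[OF assms(2)] by simp
qed

lemma um_epiI:
  assumes "E \<in> um_hom M N" "\<And>x. x \<in> supp_below (mdim N) \<Longrightarrow> \<exists>y\<in>supp_below (mdim M). mat_fun E y = x"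
  shows "E \<in> um_epi M N"
proof -
  have E: "E \<in> carrier_mat (mdim N) (mdim M)"
    using assms(1) by (auto simp: um_hom_def)
  have "v \<in> (\<lambda>v. E *\<^sub>v v) ` carrier_vec (mdim M)" if v: "v \<in> carrier_vec (mdim N)" for v
  proof -
    obtain y where y: "y \<in> supp_below (mdim M)" "mat_fun E y = vfun v"
      using assms(2)[OF vfun_supp[OF v]] by auto
    have "vfun (E *\<^sub>v vec (mdim M) y) = vfun v"
      using vfun_mult[OF E, of "vec (mdim M) y"] vfun_vec[OF y(1)] y(2) by simp
    then have "E *\<^sub>v vec (mdim M) y = v"
      using vec_vfun[OF v] vec_vfun[of "E *\<^sub>v vec (mdim M) y" "mdim N"] E by auto
    then show ?thesis by (metis imageI vec_carrier)
  qed
  then show ?thesis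
    unfolding um_epi_def using assms(1) E by auto
qed

text \<open>A map out of \<open>P0c\<close> amounts to a vector killed by c, a^2 b and b^2 a. The
  image x of the generator is such a vector; the preimage m of x is made one by \<open>e0\<close>,
  and \<open>ev0\<close> then defines the lift.\<close>

lemma P0c_projective:
  assumes "CHAR('k::field) = 2"
  shows "um_projective (P0c :: 'k um_rep)"
  unfolding um_projective_def
proof (intro conjI allI impI)
  show "um_module (P0c :: 'k um_rep)" by (rule P0c_module[OF assms])
  fix M N :: "'k um_rep" and E F
  assume M: "um_module M" and N: "um_module N" and E: "E \<in> um_epi M N" and F: "F \<in> um_hom P0c N"
  interpret P: um_ops "P0c :: 'k um_rep" by unfold_locales (rule assms, rule P0c_module[OF assms])
  interpret M: um_ops M by unfold_locales (rule assms, rule M)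
  interpret N: um_ops N by unfold_locales (rule assms, rule N)
  note pre = um_module_pre[OF P.module] um_module_pre[OF M] um_module_pre[OF N]
  have E': "E \<in> um_hom M N" using E by (simp add: um_epi_def)
  have c: "E \<in> carrier_mat (mdim N) (mdim M)" "F \<in> carrier_mat (mdim N) 8"
    using E' F by (auto simp: um_hom_def)
  note EM = um_homD[OF E' pre(2,3)] and FM = um_homD[OF F pre(1,3)]
  have lin: "mat_fun X (x + y) = mat_fun X x + mat_fun X y" "mat_fun X (scale_fun k x) = scale_fun k (mat_fun X x)" for X :: "'k mat" and x y k
    by (simp_all add: mat_fun_plus scale_fun_def mat_fun_smult)
  let ?d = "fun8 1 0 0 0 0 0 0 0 :: nat \<Rightarrow> 'k"
  define x where "x = mat_fun F ?d"
  have x: "x \<in> supp_below (mdim N)" using mat_fun_supp[OF c(2)] by (simp add: x_def)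
  have xr: "N.c x = 0" "N.a (N.a (N.b x)) = 0" "N.b (N.b (N.a x)) = 0"
    unfolding x_def by (simp_all only: FM[symmetric] mat_fun_P0c fun8_zero) (simp_all add: mat_fun_def fun_eq_iff)
  obtain m0 where m0: "m0 \<in> supp_below (mdim M)" "mat_fun E m0 = x"
    using um_epi_surj[OF E x] .
  define m where "m = M.e0 m0"
  have mr: "M.c m = 0" "M.a (M.a (M.b m)) = 0" "M.b (M.b (M.a m)) = 0"
    unfolding m_def by (rule M.e0)+
  have "mat_fun E m = N.e0 x"
    by (simp only: m_def M.e0_def N.e0_def Let_def lin EM m0(2))
  then have Em: "mat_fun E m = x"
    using N.e0(4)[OF xr] by simp
  have ms: "m \<in> supp_below (mdim M)"
    using m0 M.closed unfolding m_def M.e0_def Let_def by (auto simp: supp_below_def)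
  define G where "G = fun_mat (mdim M) 8 (\<lambda>f. M.ev0 f m)"
  have G: "mat_fun G f = M.ev0 f m" if "f \<in> supp_below 8" for f
    unfolding G_def
  proof (rule mat_fun_fun_mat[OF _ _ _ that])
    show "M.ev0 (f + g) m = M.ev0 f m + M.ev0 g m" for f g
      by (simp add: M.ev0_def M.scale_fun_simps add_ac)
    show "M.ev0 (\<lambda>i. c * f i) m = (\<lambda>i. c * M.ev0 f m i)" for c f
      by (simp add: M.ev0_def scale_fun_def fun_eq_iff algebra_simps)
    show "M.ev0 f m \<in> supp_below (mdim M)" for f
      using ms M.closed unfolding M.ev0_def by (auto simp: supp_below_def scale_fun_def)
  qed
  have Gc: "G \<in> carrier_mat (mdim M) 8" by (simp add: G_def)
  have cl: "mat_fun (act_a P0c) f \<in> supp_below 8" "mat_fun (act_b P0c) f \<in> supp_below 8" for f :: "nat \<Rightarrow> 'k"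
    using P.closed by auto
  have "G \<in> um_hom P0c M"
    by (rule um_homI[OF pre(1,2)]) (use Gc in \<open>simp_all add: G cl M.ev0_hom[OF mr]\<close>)
  moreover have "E * G = F"
  proof (rule mat_fun_eqI)
    fix f :: "nat \<Rightarrow> 'k" assume f: "f \<in> supp_below 8"
    then obtain x0 x1 x2 x3 x4 x5 x6 x7 where fv: "f = fun8 x0 x1 x2 x3 x4 x5 x6 x7" by (rule supp8E)
    have "P.ev0 f ?d = f"
      unfolding P.ev0_def mat_fun_P0c by (auto simp: fv fun_eq_iff scale_fun_def fun8_def)
    then have "mat_fun F f = N.ev0 f x"
      unfolding x_def N.ev0_def FM[symmetric] lin[symmetric] P.ev0_def by simp
    moreover have "mat_fun E (M.ev0 f m) = N.ev0 f x"
      by (simp only: M.ev0_def N.ev0_def lin EM Em)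
    ultimately show "mat_fun (E * G) f = mat_fun F f"
      by (simp add: mat_fun_mult[OF c(1) Gc] G[OF f])
  qed (use c Gc in auto)
  ultimately show "\<exists>G\<in>um_hom P0c M. E * G = F" by blast
qed

lemma P1c_projective:
  assumes "CHAR('k::field) = 2"
  shows "um_projective (P1c :: 'k um_rep)"
  unfolding um_projective_def
proof (intro conjI allI impI)
  show "um_module (P1c :: 'k um_rep)" by (rule P1c_module[OF assms])
  fix M N :: "'k um_rep" and E F
  assume M: "um_module M" and N: "um_module N" and E: "E \<in> um_epi M N" and F: "F \<in> um_hom P1c N"
  interpret P: um_ops "P1c :: 'k um_rep" by unfold_locales (rule assms, rule P1c_module[OF assms])
  interpret M: um_ops M by unfold_locales (rule assms, rule M)
  interpret N: um_ops N by unfold_locales (rule assms, rule N)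
  note pre = um_module_pre[OF P.module] um_module_pre[OF M] um_module_pre[OF N]
  have E': "E \<in> um_hom M N" using E by (simp add: um_epi_def)
  have c: "E \<in> carrier_mat (mdim N) (mdim M)" "F \<in> carrier_mat (mdim N) 8"
    using E' F by (auto simp: um_hom_def)
  note EM = um_homD[OF E' pre(2,3)] and FM = um_homD[OF F pre(1,3)]
  have lin: "mat_fun X (x + y) = mat_fun X x + mat_fun X y" "mat_fun X (scale_fun k x) = scale_fun k (mat_fun X x)" for X :: "'k mat" and x y k
    by (simp_all add: mat_fun_plus scale_fun_def mat_fun_smult)
  let ?d = "fun8 1 0 0 0 0 0 0 0 :: nat \<Rightarrow> 'k"
  define x where "x = mat_fun F ?d"
  have x: "x \<in> supp_below (mdim N)" using mat_fun_supp[OF c(2)] by (simp add: x_def)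
  have layers_010: "mat_fun F (\<lambda>_. 0) = 0" by (simp add: mat_fun_def fun_eq_iff)
  have xr: "N.c x = x" "N.b (N.b x) = 0"
    unfolding x_def by (simp_all add: FM[symmetric] mat_fun_P1c fun8_zero layers_010)
  obtain m0 where m0: "m0 \<in> supp_below (mdim M)" "mat_fun E m0 = x"
    using um_epi_surj[OF E x] .
  define m where "m = M.e1 m0"
  have mr: "M.c m = m" "M.b (M.b m) = 0"
    unfolding m_def by (rule M.e1)+
  have "mat_fun E m = N.e1 x"
    by (simp only: m_def M.e1_def N.e1_def EM m0(2))
  then have Em: "mat_fun E m = x"
    using N.e1(3)[OF xr] by simp
  have ms: "m \<in> supp_below (mdim M)"
    unfolding m_def M.e1_def by (rule M.closed)
  define G where "G = fun_mat (mdim M) 8 (\<lambda>f. M.ev1 f m)"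
  have G: "mat_fun G f = M.ev1 f m" if "f \<in> supp_below 8" for f
    unfolding G_def
  proof (rule mat_fun_fun_mat[OF _ _ _ that])
    show "M.ev1 (f + g) m = M.ev1 f m + M.ev1 g m" for f g
      by (simp add: M.ev1_def M.scale_fun_simps add_ac)
    show "M.ev1 (\<lambda>i. c * f i) m = (\<lambda>i. c * M.ev1 f m i)" for c f
      by (simp add: M.ev1_def scale_fun_def fun_eq_iff algebra_simps)
    show "M.ev1 f m \<in> supp_below (mdim M)" for f
      using ms M.closed unfolding M.ev1_def by (auto simp: supp_below_def scale_fun_def)
  qed
  have Gc: "G \<in> carrier_mat (mdim M) 8" by (simp add: G_def)
  have cl: "mat_fun (act_a P1c) f \<in> supp_below 8" "mat_fun (act_b P1c) f \<in> supp_below 8" for f :: "nat \<Rightarrow> 'k"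
    using P.closed by auto
  have "G \<in> um_hom P1c M"
    by (rule um_homI[OF pre(1,2)]) (use Gc in \<open>simp_all add: G cl M.ev1_hom[OF mr]\<close>)
  moreover have "E * G = F"
  proof (rule mat_fun_eqI)
    fix f :: "nat \<Rightarrow> 'k" assume f: "f \<in> supp_below 8"
    then obtain x0 x1 x2 x3 x4 x5 x6 x7 where fv: "f = fun8 x0 x1 x2 x3 x4 x5 x6 x7" by (rule supp8E)
    have "P.ev1 f ?d = f"
      unfolding P.ev1_def mat_fun_P1c by (auto simp: fv fun_eq_iff scale_fun_def fun8_def)
    then have "mat_fun F f = N.ev1 f x"
      unfolding x_def N.ev1_def FM[symmetric] lin[symmetric] P.ev1_def by simp
    moreover have "mat_fun E (M.ev1 f m) = N.ev1 f x"
      by (simp only: M.ev1_def N.ev1_def lin EM Em)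
    ultimately show "mat_fun (E * G) f = mat_fun F f"
      by (simp add: mat_fun_mult[OF c(1) Gc] G[OF f])
  qed (use c Gc in auto)
  ultimately show "\<exists>G\<in>um_hom P1c M. E * G = F" by blast
qed

section \<open>Uniqueness of projective covers and a criterion for them\<close>

lemma mat_v_simps:
  fixes F :: "'k::field mat"
  assumes "F \<in> carrier_mat n m" "v \<in> carrier_vec m" "w \<in> carrier_vec m"
  shows "F *\<^sub>v (v + w) = F *\<^sub>v v + F *\<^sub>v w" "F *\<^sub>v (k \<cdot>\<^sub>v v) = k \<cdot>\<^sub>v (F *\<^sub>v v)"
  using mult_add_distrib_mat_vec[OF assms] mult_mat_vec[OF assms(1,2)] by auto

lemma hom_mult_vec:
  assumes "F \<in> um_hom M N" "um_pre M" "um_pre N" "v \<in> carrier_vec (mdim M)"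
  shows "act_a N *\<^sub>v (F *\<^sub>v v) = F *\<^sub>v (act_a M *\<^sub>v v)" "act_b N *\<^sub>v (F *\<^sub>v v) = F *\<^sub>v (act_b M *\<^sub>v v)"
    "act_c N *\<^sub>v (F *\<^sub>v v) = F *\<^sub>v (act_c M *\<^sub>v v)"
proof -
  have *: "Y *\<^sub>v (F *\<^sub>v v) = F *\<^sub>v (X *\<^sub>v v)" if "F * X = Y * F" "X \<in> carrier_mat (mdim M) (mdim M)" "Y \<in> carrier_mat (mdim N) (mdim N)"
      "F \<in> carrier_mat (mdim N) (mdim M)" for X Y
    using that assms(4) assoc_mult_mat_vec[of F "mdim N" "mdim M" X "mdim M" v] assoc_mult_mat_vec[of Y "mdim N" "mdim N" F "mdim M" v] by simp
  show "act_a N *\<^sub>v (F *\<^sub>v v) = F *\<^sub>v (act_a M *\<^sub>v v)" "act_b N *\<^sub>v (F *\<^sub>v v) = F *\<^sub>v (act_b M *\<^sub>v v)"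
    "act_c N *\<^sub>v (F *\<^sub>v v) = F *\<^sub>v (act_c M *\<^sub>v v)"
    using assms(1-3) by (auto simp: um_hom_def um_pre_def intro!: *)
qed

lemma image_submodule:
  assumes F: "F \<in> um_hom M N" and M: "um_pre M" and N: "um_pre N"
  shows "um_submodule ((\<lambda>v. F *\<^sub>v v) ` carrier_vec (mdim M)) N"
proof -
  have Fc: "F \<in> carrier_mat (mdim N) (mdim M)" using F by (auto simp: um_hom_def)
  have MA: "act_a M \<in> carrier_mat (mdim M) (mdim M)" "act_b M \<in> carrier_mat (mdim M) (mdim M)" "act_c M \<in> carrier_mat (mdim M) (mdim M)"
    using M by (auto simp: um_pre_def)
  let ?I = "(\<lambda>v. F *\<^sub>v v) ` carrier_vec (mdim M)"
  have "F *\<^sub>v v + F *\<^sub>v w \<in> ?I" if "v \<in> carrier_vec (mdim M)" "w \<in> carrier_vec (mdim M)" for v w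
    using that mat_v_simps[OF Fc that] by (metis add_carrier_vec imageI)
  moreover have "k \<cdot>\<^sub>v (F *\<^sub>v v) \<in> ?I" if "v \<in> carrier_vec (mdim M)" for v k
    using that mat_v_simps[OF Fc that that] by (metis smult_carrier_vec imageI)
  moreover have "F *\<^sub>v 0\<^sub>v (mdim M) = 0\<^sub>v (mdim N)" using Fc by auto
  then have "0\<^sub>v (mdim N) \<in> ?I" by (metis zero_carrier_vec imageI)
  ultimately show ?thesis
    unfolding um_submodule_def
    using Fc MA by (auto simp: hom_mult_vec[OF F M N])
qed

text \<open>For a submodule W, the sum W + ker E is the whole module exactly when W and the module
  have the same image under E. Superfluity of the kernel thus becomes a statement about images,
  which is the form used below.\<close>

lemma projective_coverD:
  fixes P V :: "'k::field um_rep"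
  assumes "um_projective_cover P V"
  obtains E where "um_projective P" "um_module P" "E \<in> um_hom P V" "E \<in> carrier_mat (mdim V) (mdim P)"
    "E \<in> um_epi P V"
    "\<And>W. um_submodule W P \<Longrightarrow> (\<And>v. v \<in> carrier_vec (mdim P) \<Longrightarrow> \<exists>w\<in>W. E *\<^sub>v w = E *\<^sub>v v) \<Longrightarrow> W = carrier_vec (mdim P)"
proof -
  obtain E where E: "um_projective P" "E \<in> um_epi P V" "um_superfluous (mat_kernel E) P"
    using assms unfolding um_projective_cover_def by auto
  have c: "E \<in> carrier_mat (mdim V) (mdim P)" and h: "E \<in> um_hom P V"
    using E by (auto simp: um_epi_def um_hom_def)
  have sf: "W = carrier_vec (mdim P)" if W: "um_submodule W P" and *: "\<And>v. v \<in> carrier_vec (mdim P) \<Longrightarrow> \<exists>w\<in>W. E *\<^sub>v w = E *\<^sub>v v" for W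
  proof -
    have Wc: "W \<subseteq> carrier_vec (mdim P)" using W by (simp add: um_submodule_def)
    have "{w + k |w k. w \<in> W \<and> k \<in> mat_kernel E} = carrier_vec (mdim P)"
    proof (intro equalityI subsetI)
      fix v :: "'k vec" assume v: "v \<in> carrier_vec (mdim P)"
      then obtain w where w: "w \<in> W" "E *\<^sub>v w = E *\<^sub>v v" using * by blast
      have wc: "w \<in> carrier_vec (mdim P)" using w Wc by auto
      have "E *\<^sub>v (v - w) = 0\<^sub>v (mdim V)"
        using mult_minus_distrib_mat_vec[OF c v wc] w(2) c v by auto
      then have "v - w \<in> mat_kernel E"
        using c v wc by (auto simp: mat_kernel_def)
      moreover have "v = w + (v - w)" using v wc by auto
      ultimately show "v \<in> {w + k |w k. w \<in> W \<and> k \<in> mat_kernel E}" using w(1) by blast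
    next
      fix v assume "v \<in> {w + k |w k. w \<in> W \<and> k \<in> mat_kernel E}"
      then show "v \<in> carrier_vec (mdim P)" using Wc c by (auto simp: mat_kernel_def)
    qed
    then show ?thesis
      using E(3) W unfolding um_superfluous_def by blast
  qed
  show thesis
    using that[OF E(1) _ h c E(2) sf] E(1) by (simp add: um_projective_def)
qed

text \<open>Lift E through E' to G. The image of G maps onto V, so G is onto by superfluity of ker
  E', and projectivity of Q splits it by some S with G S = 1. By the same argument S is onto, hence
  inverse to G.\<close>

lemma projective_cover_unique:
  fixes P Q V :: "'k::field um_rep"
  assumes P: "um_projective_cover P V" and Q: "um_projective_cover Q V" and V: "um_module V"
  shows "um_iso P Q"
proof -
  obtain E where E: "um_projective P" "um_module P" "E \<in> um_hom P V" "E \<in> carrier_mat (mdim V) (mdim P)"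
    "E \<in> um_epi P V"
    "\<And>W. um_submodule W P \<Longrightarrow> (\<And>v. v \<in> carrier_vec (mdim P) \<Longrightarrow> \<exists>w\<in>W. E *\<^sub>v w = E *\<^sub>v v) \<Longrightarrow> W = carrier_vec (mdim P)"
    using projective_coverD[OF P] by blast
  obtain E' where E': "um_projective Q" "um_module Q" "E' \<in> um_hom Q V" "E' \<in> carrier_mat (mdim V) (mdim Q)"
    "E' \<in> um_epi Q V"
    "\<And>W. um_submodule W Q \<Longrightarrow> (\<And>v. v \<in> carrier_vec (mdim Q) \<Longrightarrow> \<exists>w\<in>W. E' *\<^sub>v w = E' *\<^sub>v v) \<Longrightarrow> W = carrier_vec (mdim Q)"
    using projective_coverD[OF Q] by blast
  note pre = um_module_pre[OF E(2)] um_module_pre[OF E'(2)]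
  obtain G where G: "G \<in> um_hom P Q" "E' * G = E"
    using E(1) E'(2,5) V E(3) unfolding um_projective_def by blast
  have Gc: "G \<in> carrier_mat (mdim Q) (mdim P)" using G by (auto simp: um_hom_def)
  have surj: "(\<lambda>v. G *\<^sub>v v) ` carrier_vec (mdim P) = carrier_vec (mdim Q)"
  proof (rule E'(6)[OF image_submodule[OF G(1) pre]])
    fix v :: "'k vec" assume v: "v \<in> carrier_vec (mdim Q)"
    then have "E' *\<^sub>v v \<in> carrier_vec (mdim V)" using E'(4) by auto
    then obtain u where u: "u \<in> carrier_vec (mdim P)" "E *\<^sub>v u = E' *\<^sub>v v"
      using E(5) unfolding um_epi_def by auto (metis imageE)
    have "E' *\<^sub>v (G *\<^sub>v u) = E' *\<^sub>v v"
      using u assoc_mult_mat_vec[OF E'(4) Gc u(1)] G(2) by simp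
    then show "\<exists>w\<in>(\<lambda>v. G *\<^sub>v v) ` carrier_vec (mdim P). E' *\<^sub>v w = E' *\<^sub>v v"
      using u(1) by blast
  qed
  have Ge: "G \<in> um_epi P Q" using G(1) surj by (simp add: um_epi_def)
  have "1\<^sub>m (mdim Q) \<in> um_hom Q Q"
    using pre(2) by (auto simp: um_hom_def um_pre_def)
  then obtain S where S: "S \<in> um_hom Q P" "G * S = 1\<^sub>m (mdim Q)"
    using E'(1) E(2) E'(2) Ge unfolding um_projective_def by blast
  have Sc: "S \<in> carrier_mat (mdim P) (mdim Q)" using S by (auto simp: um_hom_def)
  \<comment> \<open>Since E = E' G and G S = 1, the vectors S G v and v have the same image under E,
    so the image of S already maps onto V.\<close>
  have surjS: "(\<lambda>v. S *\<^sub>v v) ` carrier_vec (mdim Q) = carrier_vec (mdim P)"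
  proof (rule E(6)[OF image_submodule[OF S(1) pre(2,1)]])
    fix v :: "'k vec" assume v: "v \<in> carrier_vec (mdim P)"
    have Gv: "G *\<^sub>v v \<in> carrier_vec (mdim Q)" using Gc v by auto
    have "E *\<^sub>v (S *\<^sub>v (G *\<^sub>v v)) = (E' * G) *\<^sub>v (S *\<^sub>v (G *\<^sub>v v))" using G(2) by simp
    also have "\<dots> = E' *\<^sub>v ((G * S) *\<^sub>v (G *\<^sub>v v))"
      using assoc_mult_mat_vec[OF E'(4) Gc, of "S *\<^sub>v (G *\<^sub>v v)"] assoc_mult_mat_vec[OF Gc Sc Gv] Sc Gv by auto
    also have "\<dots> = E *\<^sub>v v"
      using S(2) Gv assoc_mult_mat_vec[OF E'(4) Gc v] G(2) by simp
    finally show "\<exists>w\<in>(\<lambda>v. S *\<^sub>v v) ` carrier_vec (mdim Q). E *\<^sub>v w = E *\<^sub>v v"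
      using Gv by blast
  qed
  have "S * G = 1\<^sub>m (mdim P)"
  proof (rule mat_fun_eqI[of _ "mdim P" "mdim P"])
    fix f :: "nat \<Rightarrow> 'k" assume f: "f \<in> supp_below (mdim P)"
    then obtain u where u: "u \<in> carrier_vec (mdim Q)" "vec (mdim P) f = S *\<^sub>v u"
      using surjS by (metis imageE vec_carrier)
    have f': "f = mat_fun S (vfun u)"
      using vfun_vec[OF f] vfun_mult[OF Sc u(1)] u(2) by simp
    show "mat_fun (S * G) f = mat_fun (1\<^sub>m (mdim P)) f"
      unfolding mat_fun_one[OF f] unfolding f' mat_fun_mult[OF Sc Gc] mat_fun_mult[OF Gc Sc, symmetric] S(2) mat_fun_one[OF vfun_supp[OF u(1)]] ..
  qed (use Sc Gc in auto)
  moreover have "G * act_a P = act_a Q * G" "G * act_b P = act_b Q * G"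
    using G(1) by (auto simp: um_hom_def)
  ultimately show ?thesis
    using um_isoI[OF pre(1) E'(2) Gc Sc S(2)] by blast
qed

lemma projective_coverI:
  fixes P V :: "'k::field um_rep"
  assumes P: "um_projective P" and V: "um_pre V" and E: "E \<in> um_epi P V"
    and sf: "\<And>S. \<lbrakk>S \<subseteq> supp_below (mdim P); \<And>f g. f \<in> S \<Longrightarrow> g \<in> S \<Longrightarrow> f + g \<in> S; \<And>k f. f \<in> S \<Longrightarrow> scale_fun k f \<in> S;
       \<And>f. f \<in> S \<Longrightarrow> mat_fun (act_a P) f \<in> S; \<And>f. f \<in> S \<Longrightarrow> mat_fun (act_b P) f \<in> S;
       \<And>f. f \<in> supp_below (mdim P) \<Longrightarrow> \<exists>g\<in>S. mat_fun E g = mat_fun E f\<rbrakk> \<Longrightarrow> supp_below (mdim P) \<subseteq> S"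
  shows "um_projective_cover P V"
proof -
  let ?n = "mdim P"
  have Pm: "um_module P" using P by (simp add: um_projective_def)
  have Ap: "act_a P \<in> carrier_mat ?n ?n" "act_b P \<in> carrier_mat ?n ?n" "act_c P \<in> carrier_mat ?n ?n"
    using um_module_pre[OF Pm] by (auto simp: um_pre_def)
  have h: "E \<in> um_hom P V" and c: "E \<in> carrier_mat (mdim V) ?n"
    using E by (auto simp: um_epi_def um_hom_def)
  have AV: "act_a V \<in> carrier_mat (mdim V) (mdim V)" "act_b V \<in> carrier_mat (mdim V) (mdim V)" "act_c V \<in> carrier_mat (mdim V) (mdim V)"
    using V by (auto simp: um_pre_def)
  have kz: "X *\<^sub>v 0\<^sub>v (mdim V) = 0\<^sub>v (mdim V)" if "X \<in> carrier_mat (mdim V) (mdim V)" for X :: "'k mat"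
    using that by auto
  have "um_submodule (mat_kernel E) P"
    unfolding um_submodule_def mat_kernel_def
    using c Ap kz AV hom_mult_vec[OF h um_module_pre[OF Pm] V, symmetric]
    by (auto simp: mat_v_simps[OF c])
  moreover have "W = carrier_vec ?n" if W: "um_submodule W P" and eq: "{w + k |w k. w \<in> W \<and> k \<in> mat_kernel E} = carrier_vec ?n" for W
  proof -
    define S where "S = {f \<in> supp_below ?n. vec ?n f \<in> W}"
    have "supp_below ?n \<subseteq> S"
    proof (rule sf)
      have vm: "vec ?n (mat_fun X f) = X *\<^sub>v vec ?n f" if "f \<in> supp_below ?n" "X \<in> carrier_mat ?n ?n" for X f
        using vfun_mult[OF that(2), of "vec ?n f"] vfun_vec[OF that(1)] vec_vfun[of "X *\<^sub>v vec ?n f" ?n] that(2) by auto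
      show "S \<subseteq> supp_below ?n" by (auto simp: S_def)
      show "f + g \<in> S" if "f \<in> S" "g \<in> S" for f g
      proof -
        have "vec ?n (f + g) = vec ?n f + vec ?n g" by auto
        then show ?thesis using that W by (auto simp: S_def um_submodule_def supp_below_def)
      qed
      show "scale_fun k f \<in> S" if "f \<in> S" for k f
      proof -
        have "vec ?n (scale_fun k f) = k \<cdot>\<^sub>v vec ?n f" by (auto simp: scale_fun_def)
        then show ?thesis using that W by (auto simp: S_def um_submodule_def supp_below_def scale_fun_def)
      qed
      show "mat_fun (act_a P) f \<in> S" "mat_fun (act_b P) f \<in> S" if "f \<in> S" for f
        using that W Ap mat_fun_supp[OF Ap(1)] mat_fun_supp[OF Ap(2)] by (auto simp: S_def vm um_submodule_def)
      show "\<exists>g\<in>S. mat_fun E g = mat_fun E f" if f: "f \<in> supp_below ?n" for f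
      proof -
        have "vec ?n f \<in> {w + k |w k. w \<in> W \<and> k \<in> mat_kernel E}" unfolding eq by simp
        then obtain w k where wk: "vec ?n f = w + k" "w \<in> W" "k \<in> mat_kernel E" by auto
        have wc: "w \<in> carrier_vec ?n" "k \<in> carrier_vec ?n" and Ek: "E *\<^sub>v k = 0\<^sub>v (mdim V)"
          using wk W c by (auto simp: um_submodule_def mat_kernel_def)
        have "E *\<^sub>v vec ?n f = E *\<^sub>v w"
          unfolding wk(1) using mat_v_simps(1)[OF c wc] Ek c wc by auto
        then have "mat_fun E f = mat_fun E (vfun w)"
          using vfun_mult[OF c, of "vec ?n f"] vfun_mult[OF c wc(1)] vfun_vec[OF f] by simp
        moreover have "vfun w \<in> S"
          using vfun_supp[OF wc(1)] vec_vfun[OF wc(1)] wk(2) by (simp add: S_def)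
        ultimately show ?thesis by metis
      qed
    qed
    then have "v \<in> W" if "v \<in> carrier_vec ?n" for v
      using vfun_supp[OF that] vec_vfun[OF that] by (auto simp: S_def)
    then show ?thesis using W by (auto simp: um_submodule_def)
  qed
  ultimately show ?thesis
    unfolding um_projective_cover_def um_superfluous_def using P E by blast
qed

lemma scale_fun_fun8: "scale_fun k (fun8 x0 x1 x2 x3 x4 x5 x6 x7) = fun8 (k*x0) (k*x1) (k*x2) (k*x3) (k*x4) (k*x5) (k*x6) (k*x7)"
  by (auto simp: scale_fun_def fun8_def fun_eq_iff)

lemma fun8_plus': "fun8 x0 x1 x2 x3 x4 x5 x6 x7 + fun8 y0 y1 y2 y3 y4 y5 y6 y7 = fun8 (x0+y0) (x1+y1) (x2+y2) (x3+y3) (x4+y4) (x5+y5) (x6+y6) (x7+y7)"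
  by (auto simp: fun8_def fun_eq_iff)

lemma V0_module: "um_module (um_V0 :: 'k::field um_rep)"
  by (auto simp: um_module_def um_V0_def Let_def pow_mat_4[of _ 1] pow_mat_2[of _ 1])

text \<open>A submodule that maps onto V0 contains a vector with coefficient 1 at the generator.
  Suitable words in a and b applied to it yield the basis vectors other than the generator, which
  are then subtracted.\<close>

lemma P0c_cover:
  assumes "CHAR('k::field) = 2"
  shows "um_projective_cover (P0c :: 'k um_rep) um_V0"
proof -
  define E :: "'k mat" where "E = mat 1 8 (\<lambda>(i, j). if j = 0 then 1 else 0)"
  have Ec: "E \<in> carrier_mat 1 8" by (simp add: E_def)
  have oE: "mat_fun E (fun8 x0 x1 x2 x3 x4 x5 x6 x7) = fun8 x0 0 0 0 0 0 0 0" for x0 x1 x2 x3 x4 x5 x6 x7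
    by (auto simp: mat_fun_def E_def fun_eq_iff lessThan_8 fun8_nth) (auto simp: fun8_def)
  have V: "um_pre (um_V0 :: 'k um_rep)" by (rule um_module_pre[OF V0_module])
  have h: "E \<in> um_hom P0c um_V0"
  proof (rule um_homI[OF um_module_pre[OF P0c_module[OF assms]] V])
    fix f :: "nat \<Rightarrow> 'k" assume "f \<in> supp_below (mdim (P0c :: 'k um_rep))"
    then have "f \<in> supp_below 8" by simp
    then show "mat_fun E (mat_fun (act_a P0c) f) = mat_fun (act_a um_V0) (mat_fun E f)" "mat_fun E (mat_fun (act_b P0c) f) = mat_fun (act_b um_V0) (mat_fun E f)"
      by (auto elim!: supp8E simp: mat_fun_P0c oE um_V0_def mat_fun_zero_mat fun8_zero)
  qed (use Ec in \<open>auto simp: um_V0_def\<close>)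
  have e: "E \<in> um_epi P0c um_V0"
  proof (rule um_epiI[OF h])
    fix x :: "nat \<Rightarrow> 'k" assume x: "x \<in> supp_below (mdim (um_V0 :: 'k um_rep))"
    then have "fun8 (x 0) 0 0 0 0 0 0 0 = x"
      by (auto simp: um_V0_def fun8_def supp_below_def fun_eq_iff)
    then show "\<exists>y\<in>supp_below (mdim (P0c :: 'k um_rep)). mat_fun E y = x"
      using oE[of "x 0" 0 0 0 0 0 0 0] by (auto intro!: bexI[of _ x] simp: fun8_supp) (metis fun8_supp)
  qed
  show ?thesis
  proof (rule projective_coverI[OF P0c_projective[OF assms] V e], simp only: Pc_carrier)
    fix S :: "(nat \<Rightarrow> 'k) set"
    assume S: "S \<subseteq> supp_below 8" and add: "\<And>f g. f \<in> S \<Longrightarrow> g \<in> S \<Longrightarrow> f + g \<in> S" and sc: "\<And>k f. f \<in> S \<Longrightarrow> scale_fun k f \<in> S"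
      and a: "\<And>f. f \<in> S \<Longrightarrow> mat_fun (act_a P0c) f \<in> S" and b: "\<And>f. f \<in> S \<Longrightarrow> mat_fun (act_b P0c) f \<in> S"
      and ex: "\<And>f. f \<in> supp_below 8 \<Longrightarrow> \<exists>g\<in>S. mat_fun E g = mat_fun E f"
    obtain g where g: "g \<in> S" "mat_fun E g = mat_fun E (fun8 1 0 0 0 0 0 0 0)"
      using ex[OF fun8_supp] by blast
    obtain x0 x1 x2 x3 x4 x5 x6 x7 where gv: "g = fun8 x0 x1 x2 x3 x4 x5 x6 x7"
      using g(1) S supp8E by blast
    have "x0 = 1" using g(2) unfolding gv oE by (metis fun8_nth(1))
    then have g: "fun8 1 x1 x2 x3 x4 x5 x6 x7 \<in> S" using g gv by simp
    note A = a[of "fun8 _ _ _ _ _ _ _ _", unfolded mat_fun_P0c] and B = b[of "fun8 _ _ _ _ _ _ _ _", unfolded mat_fun_P0c]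
    \<comment> \<open>a^3 retains only coordinates 0 and 4 of the vector; b a^3 discards the second
      of these and leaves the basis vector 2, free of the unknown coefficients.\<close>
    have e2: "fun8 0 0 1 0 0 0 0 0 \<in> S" using B[OF A[OF A[OF A[OF g]]]] by simp
    have e1: "fun8 0 1 0 0 0 0 0 0 \<in> S" using B[OF e2] by simp
    have e7: "fun8 0 0 0 0 0 0 0 1 \<in> S" using B[OF e1] by simp
    have e3: "fun8 0 0 0 1 0 0 0 0 \<in> S" using A[OF e2] by simp
    have "fun8 0 0 0 0 1 0 0 x3 \<in> S" using B[OF B[OF B[OF g]]] by simp
    then have e5: "fun8 0 0 0 0 0 1 0 0 \<in> S" using A by simp
    have e6: "fun8 0 0 0 0 0 0 1 0 \<in> S" using A[OF e5] by simp
    have e4: "fun8 0 0 0 0 1 0 0 0 \<in> S" using B[OF e5] by simp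
    have "fun8 1 x1 x2 x3 x4 x5 x6 x7 + scale_fun (-x1) (fun8 0 1 0 0 0 0 0 0) + scale_fun (-x2) (fun8 0 0 1 0 0 0 0 0) + scale_fun (-x3) (fun8 0 0 0 1 0 0 0 0)
       + scale_fun (-x4) (fun8 0 0 0 0 1 0 0 0) + scale_fun (-x5) (fun8 0 0 0 0 0 1 0 0) + scale_fun (-x6) (fun8 0 0 0 0 0 0 1 0) + scale_fun (-x7) (fun8 0 0 0 0 0 0 0 1) \<in> S"
      by (intro add sc g e1 e2 e3 e4 e5 e6 e7)
    then have e0: "fun8 1 0 0 0 0 0 0 0 \<in> S" by (simp add: scale_fun_fun8 fun8_plus')
    show "supp_below 8 \<subseteq> S"
    proof
      fix f :: "nat \<Rightarrow> 'k" assume "f \<in> supp_below 8"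
      then obtain y0 y1 y2 y3 y4 y5 y6 y7 where f: "f = fun8 y0 y1 y2 y3 y4 y5 y6 y7" by (rule supp8E)
      have "scale_fun y0 (fun8 1 0 0 0 0 0 0 0) + scale_fun y1 (fun8 0 1 0 0 0 0 0 0) + scale_fun y2 (fun8 0 0 1 0 0 0 0 0) + scale_fun y3 (fun8 0 0 0 1 0 0 0 0)
       + scale_fun y4 (fun8 0 0 0 0 1 0 0 0) + scale_fun y5 (fun8 0 0 0 0 0 1 0 0) + scale_fun y6 (fun8 0 0 0 0 0 0 1 0) + scale_fun y7 (fun8 0 0 0 0 0 0 0 1) \<in> S"
        by (intro add sc e0 e1 e2 e3 e4 e5 e6 e7)
      then show "f \<in> S" by (simp add: scale_fun_fun8 fun8_plus' f)
    qed
  qed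
qed

lemma endo_mat_nth: "i < n \<Longrightarrow> j < n \<Longrightarrow> (\<And>i. i \<le> n \<Longrightarrow> f i \<in> carrier_vec n) \<Longrightarrow> endo_mat n f $$ (i, j) = f (j + 1) $ i"
  by (simp add: endo_mat_def mat_of_cols_def del: upt_Suc)

lemma endo_mat_carrier [simp]: "endo_mat n f \<in> carrier_mat n n"
  by (auto simp: endo_mat_def)

lemma supp3: "f \<in> supp_below 3 \<Longrightarrow> f = fun8 (f 0) (f 1) (f 2) 0 0 0 0 0"
  by (auto simp: supp_below_def fun8_def fun_eq_iff)

lemma V1_carrier: "mdim um_V1 = 3" "act_a um_V1 \<in> carrier_mat 3 3" "act_b um_V1 \<in> carrier_mat 3 3" "act_c um_V1 \<in> carrier_mat 3 3"
  by (auto simp: um_V1_def Let_def)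

lemma lessThan_3: "{..<3::nat} = {0, 1, 2}" by auto

lemma mat_fun_V1:
  "mat_fun (act_a um_V1) (fun8 x0 x1 x2 x3 x4 x5 x6 x7) = fun8 0 x0 x1 0 0 0 0 0"
  "mat_fun (act_b um_V1) (fun8 x0 x1 x2 x3 x4 x5 x6 x7) = fun8 x1 x2 0 0 0 0 0 0"
  "mat_fun (act_c um_V1) (fun8 x0 x1 x2 x3 x4 x5 x6 x7) = fun8 x0 0 x2 0 0 0 0 0"
proof -
  have *: "mat_fun X f = fun8 (y 0) (y 1) (y 2) 0 0 0 0 0" if "X \<in> carrier_mat 3 3" "\<And>i. i < 3 \<Longrightarrow> (\<Sum>j<3. X $$ (i, j) * f j) = y i" for X :: "'a mat" and f y
    using mat_fun_supp[OF that(1)] that by (subst supp3[of "mat_fun X f"]) (auto simp: mat_fun_def)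
  show "mat_fun (act_a um_V1) (fun8 x0 x1 x2 x3 x4 x5 x6 x7) = fun8 0 x0 x1 0 0 0 0 0"
    by (subst *[of _ _ "\<lambda>i. if i = 0 then 0 else if i = 1 then x0 else x1"]) (auto simp: um_V1_def Let_def endo_mat_nth basis_vec_def lessThan_3 fun8_nth fun8_nth(3)[unfolded numeral_2_eq_2] less_Suc_eq numeral_3_eq_3)
  show "mat_fun (act_b um_V1) (fun8 x0 x1 x2 x3 x4 x5 x6 x7) = fun8 x1 x2 0 0 0 0 0 0"
    by (subst *[of _ _ "\<lambda>i. if i = 0 then x1 else if i = 1 then x2 else 0"]) (auto simp: um_V1_def Let_def endo_mat_nth basis_vec_def lessThan_3 fun8_nth fun8_nth(3)[unfolded numeral_2_eq_2] less_Suc_eq numeral_3_eq_3)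
  show "mat_fun (act_c um_V1) (fun8 x0 x1 x2 x3 x4 x5 x6 x7) = fun8 x0 0 x2 0 0 0 0 0"
    by (subst *[of _ _ "\<lambda>i. if i = 0 then x0 else if i = 1 then 0 else x2"]) (auto simp: um_V1_def Let_def endo_mat_nth basis_vec_def lessThan_3 fun8_nth fun8_nth(3)[unfolded numeral_2_eq_2] less_Suc_eq numeral_3_eq_3)
qed

lemma V1_module: 
  assumes "CHAR('k::field) = 2"
  shows "um_module (um_V1 :: 'k um_rep)"
proof (rule um_moduleI[OF assms V1_carrier(2,3,4,1)])
  fix f :: "nat \<Rightarrow> 'k" assume "f \<in> supp_below 3"
  then obtain x0 x1 x2 where f: "f = fun8 x0 x1 x2 0 0 0 0 0" using supp3 by blast
  show "let a = mat_fun (act_a um_V1); b = mat_fun (act_b um_V1); c = mat_fun (act_c um_V1) in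
       (\<lambda>i. a (b f) i + b (a f) i) = c f \<and> (\<lambda>i. a (c f) i + c (a f) i) = a f \<and> (\<lambda>i. b (c f) i + c (b f) i) = b f \<and>
       a (a (a (a f))) = (\<lambda>_. 0) \<and> b (b (b (b f))) = (\<lambda>_. 0) \<and> (\<lambda>i. c (c f) i + c f i) = (\<lambda>_. 0)"
    unfolding f Let_def mat_fun_V1 fun8_plus by (simp add: char2_add_self[OF assms] char2_cancel[OF assms] fun8_zero)
qed

lemma P1c_cover:
  assumes "CHAR('k::field) = 2"
  shows "um_projective_cover (P1c :: 'k um_rep) um_V1"
proof -
  define E :: "'k mat" where "E = mat 3 8 (\<lambda>(i, j). if i = j then 1 else 0)"
  have Ec: "E \<in> carrier_mat 3 8" by (simp add: E_def)
  have oE: "mat_fun E (fun8 x0 x1 x2 x3 x4 x5 x6 x7) = fun8 x0 x1 x2 0 0 0 0 0" for x0 x1 x2 x3 x4 x5 x6 x7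
  proof -
    have "mat_fun E (fun8 x0 x1 x2 x3 x4 x5 x6 x7) i = fun8 x0 x1 x2 x3 x4 x5 x6 x7 i" if "i < 3" for i
    proof -
      have "mat_fun E (fun8 x0 x1 x2 x3 x4 x5 x6 x7) i = (\<Sum>j<8. if j = i then fun8 x0 x1 x2 x3 x4 x5 x6 x7 j else 0)"
        using that by (simp add: mat_fun_def E_def if_distrib[of "\<lambda>t. t * _"] cong: if_cong)
      then show ?thesis using that by simp
    qed
    then show ?thesis
      using supp3[OF mat_fun_supp[OF Ec, of "fun8 x0 x1 x2 x3 x4 x5 x6 x7"]] by (simp add: fun8_nth)
  qed
  have V: "um_pre (um_V1 :: 'k um_rep)" by (rule um_module_pre[OF V1_module[OF assms]])
  have h: "E \<in> um_hom P1c um_V1"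
  proof (rule um_homI[OF um_module_pre[OF P1c_module[OF assms]] V])
    fix f :: "nat \<Rightarrow> 'k" assume "f \<in> supp_below (mdim (P1c :: 'k um_rep))"
    then have "f \<in> supp_below 8" by simp
    then show "mat_fun E (mat_fun (act_a P1c) f) = mat_fun (act_a um_V1) (mat_fun E f)" "mat_fun E (mat_fun (act_b P1c) f) = mat_fun (act_b um_V1) (mat_fun E f)"
      by (auto elim!: supp8E simp: mat_fun_P1c oE mat_fun_V1)
  qed (use Ec V1_carrier in auto)
  have e: "E \<in> um_epi P1c um_V1"
  proof (rule um_epiI[OF h])
    fix x :: "nat \<Rightarrow> 'k" assume x: "x \<in> supp_below (mdim (um_V1 :: 'k um_rep))"
    then have "x = fun8 (x 0) (x 1) (x 2) 0 0 0 0 0"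
      using supp3 V1_carrier by metis
    then show "\<exists>y\<in>supp_below (mdim (P1c :: 'k um_rep)). mat_fun E y = x"
      using oE[of "x 0" "x 1" "x 2" 0 0 0 0 0] by (metis fun8_supp Pc_carrier(5))
  qed
  show ?thesis
  proof (rule projective_coverI[OF P1c_projective[OF assms] V e], simp only: Pc_carrier)
    fix S :: "(nat \<Rightarrow> 'k) set"
    assume S: "S \<subseteq> supp_below 8" and add: "\<And>f g. f \<in> S \<Longrightarrow> g \<in> S \<Longrightarrow> f + g \<in> S" and sc: "\<And>k f. f \<in> S \<Longrightarrow> scale_fun k f \<in> S"
      and a: "\<And>f. f \<in> S \<Longrightarrow> mat_fun (act_a P1c) f \<in> S" and b: "\<And>f. f \<in> S \<Longrightarrow> mat_fun (act_b P1c) f \<in> S"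
      and ex: "\<And>f. f \<in> supp_below 8 \<Longrightarrow> \<exists>g\<in>S. mat_fun E g = mat_fun E f"
    obtain g where g: "g \<in> S" "mat_fun E g = mat_fun E (fun8 1 0 0 0 0 0 0 0)"
      using ex[OF fun8_supp] by blast
    obtain x0 x1 x2 x3 x4 x5 x6 x7 where gv: "g = fun8 x0 x1 x2 x3 x4 x5 x6 x7"
      using g(1) S supp8E by blast
    have "x0 = 1" "x1 = 0" "x2 = 0" using g(2) unfolding gv oE by (metis fun8_nth(1), metis fun8_nth(2), metis fun8_nth(3))
    then have g: "fun8 1 0 0 x3 x4 x5 x6 x7 \<in> S" using g gv by simp
    note A = a[of "fun8 _ _ _ _ _ _ _ _", unfolded mat_fun_P1c] and B = b[of "fun8 _ _ _ _ _ _ _ _", unfolded mat_fun_P1c]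
    \<comment> \<open>Here the generator coefficient reaches position 4, and a^3 moves it to the
      socle while the unknown coefficients fall off the end. The basis is recovered from the socle
      upwards.\<close>
    have bg: "fun8 0 0 0 0 1 x6 x7 x3 \<in> S" using B[OF g] by simp
    have e7: "fun8 0 0 0 0 0 0 0 1 \<in> S" using A[OF A[OF A[OF bg]]] by simp
    have e6: "fun8 0 0 0 0 0 0 1 0 \<in> S" using B[OF e7] by simp
    have e5: "fun8 0 0 0 0 0 1 0 0 \<in> S" using B[OF e6] by simp
    have "fun8 0 0 0 0 1 x6 x7 x3 + scale_fun (-x6) (fun8 0 0 0 0 0 1 0 0) + scale_fun (-x7) (fun8 0 0 0 0 0 0 1 0) + scale_fun (-x3) (fun8 0 0 0 0 0 0 0 1) \<in> S"
      by (intro add sc bg e5 e6 e7)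
    then have e4: "fun8 0 0 0 0 1 0 0 0 \<in> S" by (simp add: scale_fun_fun8 fun8_plus')
    have "fun8 1 0 0 x3 x4 x5 x6 x7 + scale_fun (-x4) (fun8 0 0 0 0 1 0 0 0) + scale_fun (-x5) (fun8 0 0 0 0 0 1 0 0) + scale_fun (-x6) (fun8 0 0 0 0 0 0 1 0) + scale_fun (-x7) (fun8 0 0 0 0 0 0 0 1) \<in> S"
      by (intro add sc g e4 e5 e6 e7)
    then have g': "fun8 1 0 0 x3 0 0 0 0 \<in> S" by (simp add: scale_fun_fun8 fun8_plus')
    have e1: "fun8 0 1 0 0 0 0 0 0 \<in> S" using A[OF g'] by simp
    have e2: "fun8 0 0 1 0 0 0 0 0 \<in> S" using A[OF e1] by simp
    have e3: "fun8 0 0 0 1 0 0 0 0 \<in> S" using A[OF e2] by simp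
    have "fun8 1 0 0 x3 0 0 0 0 + scale_fun (-x3) (fun8 0 0 0 1 0 0 0 0) \<in> S"
      by (intro add sc g' e3)
    then have e0: "fun8 1 0 0 0 0 0 0 0 \<in> S" by (simp add: scale_fun_fun8 fun8_plus')
    show "supp_below 8 \<subseteq> S"
    proof
      fix f :: "nat \<Rightarrow> 'k" assume "f \<in> supp_below 8"
      then obtain y0 y1 y2 y3 y4 y5 y6 y7 where f: "f = fun8 y0 y1 y2 y3 y4 y5 y6 y7" by (rule supp8E)
      have "scale_fun y0 (fun8 1 0 0 0 0 0 0 0) + scale_fun y1 (fun8 0 1 0 0 0 0 0 0) + scale_fun y2 (fun8 0 0 1 0 0 0 0 0) + scale_fun y3 (fun8 0 0 0 1 0 0 0 0)
       + scale_fun y4 (fun8 0 0 0 0 1 0 0 0) + scale_fun y5 (fun8 0 0 0 0 0 1 0 0) + scale_fun y6 (fun8 0 0 0 0 0 0 1 0) + scale_fun y7 (fun8 0 0 0 0 0 0 0 1) \<in> S"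
        by (intro add sc e0 e1 e2 e3 e4 e5 e6 e7)
      then show "f \<in> S" by (simp add: scale_fun_fun8 fun8_plus' f)
    qed
  qed
qed


section \<open>Direct sums and copies\<close>

lemma um_iso_iff_rep_iso:
  "um_module M \<Longrightarrow> um_module N \<Longrightarrow> um_iso M N \<longleftrightarrow> rep_iso (fun_rep M) (fun_rep N)"
  using um_iso_of_rep_iso rep_iso_of_um_iso um_module_pre by blast

lemma um_iso_modules: "um_iso M N \<Longrightarrow> um_module M" "um_iso M N \<Longrightarrow> um_module N"
  by (auto simp: um_iso_def)

lemma um_iso_sym: "um_iso M N \<Longrightarrow> um_iso N M"
  using um_iso_iff_rep_iso um_iso_modules rep_iso_sym by blast

lemma op_rep_ok_subsp: "op_rep_ok R \<Longrightarrow> subsp R"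
  by (simp add: op_rep_ok_def)

lemma klin_subsp: "klin V \<Longrightarrow> subsp V"
  by (simp add: klin_def)

section \<open>Block sums, powers and multiplicity spaces\<close>

definition glue :: "nat \<Rightarrow> (nat \<Rightarrow> 'k) \<Rightarrow> (nat \<Rightarrow> 'k) \<Rightarrow> nat \<Rightarrow> 'k" where
  "glue m g h = (\<lambda>i. if i < m then g i else h (i - m))"

lemma sum_lessThan_plus: "(\<Sum>j<m + n. g j) = (\<Sum>j<m. g j) + (\<Sum>j<n. g (m + j :: nat) :: 'k::comm_monoid_add)"
  by (induction n) (auto simp: add_ac)

lemma mat_fun_diag_sum:
  assumes X: "X \<in> carrier_mat m m" and Y: "Y \<in> carrier_mat n n"
  shows "mat_fun (diag_sum X Y) (glue m g h) = glue m (mat_fun X g) (mat_fun Y h)"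
proof
  fix i
  show "mat_fun (diag_sum X Y) (glue m g h) i = glue m (mat_fun X g) (mat_fun Y h) i"
    using X Y by (auto simp: mat_fun_def glue_def sum_lessThan_plus diag_sum_def)
qed

lemma um_sum_simps [simp]: "mdim (um_sum M N) = mdim M + mdim N" "act_a (um_sum M N) = diag_sum (act_a M) (act_a N)"
  "act_b (um_sum M N) = diag_sum (act_b M) (act_b N)" "act_c (um_sum M N) = diag_sum (act_c M) (act_c N)"
  by (auto simp: um_sum_def)

lemma diag_sum_carrier [simp]: "X \<in> carrier_mat m m \<Longrightarrow> Y \<in> carrier_mat n n \<Longrightarrow> diag_sum X Y \<in> carrier_mat (m + n) (m + n)"
  by (auto simp: diag_sum_def)

lemma glue_cases:
  assumes "f \<in> supp_below (m + n)"
  obtains g h where "g \<in> supp_below m" "h \<in> supp_below n" "f = glue m g h"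
proof (rule that)
  show "(\<lambda>i. if i < m then f i else 0) \<in> supp_below m" "(\<lambda>i. f (m + i)) \<in> supp_below n"
    using assms by (auto simp: supp_below_def)
  show "f = glue m (\<lambda>i. if i < m then f i else 0) (\<lambda>i. f (m + i))"
    by (auto simp: glue_def)
qed

lemma glue_add: "(\<lambda>i. glue m g h i + glue m g' h' i) = glue m (\<lambda>i. g i + g' i) (\<lambda>i. h i + h' i)"
  by (auto simp: glue_def)

lemma glue_zero: "glue m (\<lambda>_. 0) (\<lambda>_. 0) = (\<lambda>_. 0)"
  by (auto simp: glue_def)

lemma um_module_rel:
  assumes 2: "CHAR('k::field) = 2" and M: "um_module (M :: 'k um_rep)"
  defines "a \<equiv> mat_fun (act_a M)" and "b \<equiv> mat_fun (act_b M)" and "c \<equiv> mat_fun (act_c M)"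
  shows "(\<lambda>i. a (b f) i + b (a f) i) = c f" "(\<lambda>i. a (c f) i + c (a f) i) = a f" "(\<lambda>i. b (c f) i + c (b f) i) = b f"
       "a (a (a (a f))) = (\<lambda>_. 0)" "b (b (b (b f))) = (\<lambda>_. 0)" "(\<lambda>i. c (c f) i + c f i) = (\<lambda>_. 0)"
proof -
  interpret um_ops M by unfold_locales (rule 2, rule M)
  show "(\<lambda>i. a (b f) i + b (a f) i) = c f" "(\<lambda>i. a (c f) i + c (a f) i) = a f" "(\<lambda>i. b (c f) i + c (b f) i) = b f"
       "a (a (a (a f))) = (\<lambda>_. 0)" "b (b (b (b f))) = (\<lambda>_. 0)" "(\<lambda>i. c (c f) i + c f i) = (\<lambda>_. 0)"
    unfolding a_def b_def c_def using rel[of f] nil[of f] by (simp_all only: plus_fun_def zero_fun_def)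
qed

lemma um_module_sum:
  assumes 2: "CHAR('k::field) = 2" and M: "um_module (M :: 'k um_rep)" and N: "um_module N"
  shows "um_module (um_sum M N)"
proof -
  have M': "act_a M \<in> carrier_mat (mdim M) (mdim M)" "act_b M \<in> carrier_mat (mdim M) (mdim M)" "act_c M \<in> carrier_mat (mdim M) (mdim M)"
    and N': "act_a N \<in> carrier_mat (mdim N) (mdim N)" "act_b N \<in> carrier_mat (mdim N) (mdim N)" "act_c N \<in> carrier_mat (mdim N) (mdim N)"
    using um_module_pre[OF M] um_module_pre[OF N] by (auto simp: um_pre_def)
  show ?thesis
  proof (rule um_moduleI[OF 2, where n = "mdim M + mdim N"])
    fix f :: "nat \<Rightarrow> 'k" assume "f \<in> supp_below (mdim M + mdim N)"
    then obtain g h where f: "f = glue (mdim M) g h" by (rule glue_cases)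
    show "let a = mat_fun (act_a (um_sum M N)); b = mat_fun (act_b (um_sum M N)); c = mat_fun (act_c (um_sum M N)) in
       (\<lambda>i. a (b f) i + b (a f) i) = c f \<and> (\<lambda>i. a (c f) i + c (a f) i) = a f \<and> (\<lambda>i. b (c f) i + c (b f) i) = b f \<and>
       a (a (a (a f))) = (\<lambda>_. 0) \<and> b (b (b (b f))) = (\<lambda>_. 0) \<and> (\<lambda>i. c (c f) i + c f i) = (\<lambda>_. 0)"
      unfolding f Let_def um_sum_simps mat_fun_diag_sum[OF M'(1) N'(1)] mat_fun_diag_sum[OF M'(2) N'(2)] mat_fun_diag_sum[OF M'(3) N'(3)] glue_add
      by (simp add: um_module_rel[OF 2 M] um_module_rel[OF 2 N] glue_zero)
  qed (use M' N' in simp_all)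
qed

lemma fun_rep_sum:
  assumes "um_pre M" "um_pre N"
  shows "rep_iso (rep_prod (fun_rep M) (fun_rep N)) (fun_rep (um_sum M N))"
proof -
  have M': "act_a M \<in> carrier_mat (mdim M) (mdim M)" "act_b M \<in> carrier_mat (mdim M) (mdim M)"
    and N': "act_a N \<in> carrier_mat (mdim N) (mdim N)" "act_b N \<in> carrier_mat (mdim N) (mdim N)"
    using assms by (auto simp: um_pre_def)
  show ?thesis
  proof (rule rep_isoI[OF rep_prod_ok[OF fun_rep_ok[OF assms(1)] fun_rep_ok[OF assms(2)]]])
    have ok: "subsp (rep_prod (fun_rep M) (fun_rep N))"
      by (rule op_rep_ok_subsp[OF rep_prod_ok[OF fun_rep_ok[OF assms(1)] fun_rep_ok[OF assms(2)]]])
    show "lin_iso (\<lambda>(g, h). glue (mdim M) g h) (\<lambda>f. (\<lambda>i. if i < mdim M then f i else 0, \<lambda>i. f (mdim M + i))) (rep_prod (fun_rep M) (fun_rep N)) (fun_rep (um_sum M N))"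
      by (rule lin_isoI[OF ok]) (auto simp: rep_prod_def fun_rep_def glue_def supp_below_def fun_eq_iff)
  qed (auto simp: rep_prod_def fun_rep_def mat_fun_diag_sum[OF M'(1) N'(1)] mat_fun_diag_sum[OF M'(2) N'(2)])
qed

text \<open>The scalar action is cut off at n explicitly, because a representation is not assumed to
  satisfy smul c 0 = 0.\<close>

definition rep_power :: "nat \<Rightarrow> ('k, 'v::ab_group_add) op_rep \<Rightarrow> ('k, nat \<Rightarrow> 'v) op_rep" where
  "rep_power n R = \<lparr> carr = {F. (\<forall>k<n. F k \<in> carr R) \<and> (\<forall>k\<ge>n. F k = 0)}, smul = (\<lambda>c F k. if k < n then smul R c (F k) else 0),
     opa = (\<lambda>F k. opa R (F k)), opb = (\<lambda>F k. opb R (F k)) \<rparr>"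

lemma op_rep_ok_0: "op_rep_ok R \<Longrightarrow> opa R 0 = 0" "op_rep_ok R \<Longrightarrow> opb R 0 = 0"
  unfolding op_rep_ok_def subsp_def using lin_map_0[of R R] by auto

lemma rep_power_ok: "op_rep_ok R \<Longrightarrow> op_rep_ok (rep_power n R)"
proof -
  assume R: "op_rep_ok R"
  have "subsp (rep_power n R)"
    using R by (auto simp: op_rep_ok_def rep_power_def subsp_def)
  moreover have mem: "F k \<in> carr R" if "F \<in> carr (rep_power n R)" for F k
    using that R by (cases "k < n") (auto simp: rep_power_def op_rep_ok_def subsp_def)
  have "lin_map (rep_power n R) (rep_power n R) (opa (rep_power n R))" "lin_map (rep_power n R) (rep_power n R) (opb (rep_power n R))"
    unfolding lin_map_def using R mem op_rep_ok_0[OF R]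
    by (auto simp: op_rep_ok_def lin_map_def) (auto simp: rep_power_def fun_eq_iff)
  ultimately show ?thesis by (simp add: op_rep_ok_def)
qed

lemma rep_power_Suc: 
  assumes "op_rep_ok R"
  shows "rep_iso (rep_prod R (rep_power n R)) (rep_power (Suc n) R)"
proof (rule rep_isoI[OF rep_prod_ok[OF assms rep_power_ok[OF assms]]])
  have ok: "subsp (rep_prod R (rep_power n R))"
    by (rule op_rep_ok_subsp[OF rep_prod_ok[OF assms rep_power_ok[OF assms]]])
  show "lin_iso (\<lambda>(x, F). case_nat x F) (\<lambda>F. (F 0, \<lambda>k. F (Suc k))) (rep_prod R (rep_power n R)) (rep_power (Suc n) R)"
    by (rule lin_isoI[OF ok]) (auto simp: rep_prod_def rep_power_def fun_eq_iff split: nat.splits)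
qed (auto simp: rep_prod_def rep_power_def fun_eq_iff split: nat.splits)

lemma um_copies_module:
  assumes 2: "CHAR('k::field) = 2" and M: "um_module (M :: 'k um_rep)"
  shows "um_module (um_copies n M)"
proof (induction n)
  case 0
  then show ?case by (auto simp: um_module_def Let_def pow_mat_4[of _ 0] pow_mat_2[of _ 0])
qed (auto intro: um_module_sum[OF 2 M])

lemma fun_rep_copies:
  assumes 2: "CHAR('k::field) = 2" and M: "um_module (M :: 'k um_rep)" and R: "rep_iso R (fun_rep M)"
  shows "rep_iso (rep_power n R) (fun_rep (um_copies n M))"
proof (induction n)
  case 0
  show ?case
  proof (rule rep_isoI[OF rep_power_ok[OF rep_iso_okD(1)[OF R]]])
    have ok: "subsp (rep_power 0 R)"
      by (rule op_rep_ok_subsp[OF rep_power_ok[OF rep_iso_okD(1)[OF R], of 0]])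
    show "lin_iso (\<lambda>_. 0) (\<lambda>_. 0) (rep_power 0 R) (fun_rep (um_copies 0 M))"
      by (rule lin_isoI[OF ok]) (auto simp: rep_power_def fun_rep_def supp_below_def fun_eq_iff)
  qed (auto simp: fun_rep_def mat_fun_def zero_fun_def)
next
  case (Suc n)
  note ok = rep_iso_okD(1)[OF R]
  have "rep_iso (rep_power (Suc n) R) (rep_prod R (rep_power n R))"
    by (rule rep_iso_sym[OF rep_power_Suc[OF ok]])
  also have "rep_iso \<dots> (rep_prod (fun_rep M) (fun_rep (um_copies n M)))"
    by (rule rep_prod_cong[OF R Suc])
  also have "rep_iso \<dots> (fun_rep (um_copies (Suc n) M))"
    using fun_rep_sum[OF um_module_pre[OF M] um_module_pre[OF um_copies_module[OF 2 M]]] by simp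
  finally show ?case .
qed

definition scalar_space :: "('k::field, 'k) kspace" where
  "scalar_space = \<lparr> carr = UNIV, smul = (*) \<rparr>"

lemma klin_scalar_space: "klin scalar_space"
  by (auto simp: klin_def subsp_def scalar_space_def algebra_simps)

lemma layers_010_DP_ok: "klin V \<Longrightarrow> op_rep_ok (layers_010 (quad_P V))"
  by (rule layers_010_ok[OF quad_P_ok]) (auto simp: quad_P_def)

lemma layers_101_DP_ok: "klin V \<Longrightarrow> op_rep_ok (layers_101 (quad_P V))"
  by (rule layers_101_ok[OF quad_P_ok]) (auto simp: quad_P_def)

lemma fun_rep_P0c:
  "rep_iso (layers_010 (quad_P scalar_space)) (fun_rep (P0c :: 'k::field um_rep))"
proof (rule rep_isoI[OF layers_010_DP_ok[OF klin_scalar_space]])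
  have ok: "subsp (layers_010 (quad_P (scalar_space :: ('k, 'k) kspace)))"
    by (rule op_rep_ok_subsp[OF layers_010_DP_ok[OF klin_scalar_space]])
  show "lin_iso (\<lambda>(u, ((s1, t1), (s2, t2), (s3, t3)), z). fun8 u s1 s2 s3 t1 t2 t3 z)
      (\<lambda>f. (f 0, ((f 1, f 4), (f 2, f 5), (f 3, f 6)), f 7)) (layers_010 (quad_P scalar_space)) (fun_rep (P0c :: 'k um_rep))"
    by (rule lin_isoI[OF ok]) (auto elim!: supp8E simp: layers_010_def quad_P_def scalar_space_def kpair_def fun_rep_def fun8_supp fun8_plus' fun8_nth scale_fun_fun8[unfolded scale_fun_def])
qed (auto simp: layers_010_def quad_P_def scalar_space_def kpair_def fun_rep_def mat_fun_P0c)

lemma fun_rep_P1c: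
  "rep_iso (layers_101 (quad_P scalar_space)) (fun_rep (P1c :: 'k::field um_rep))"
proof (rule rep_isoI[OF layers_101_DP_ok[OF klin_scalar_space]])
  have ok: "subsp (layers_101 (quad_P (scalar_space :: ('k, 'k) kspace)))"
    by (rule op_rep_ok_subsp[OF layers_101_DP_ok[OF klin_scalar_space]])
  show "lin_iso (\<lambda>((f0, f1, f2), (f3, f4), (f5, f6, f7)). fun8 f0 f1 f2 f3 f4 f5 f6 f7)
      (\<lambda>f. ((f 0, f 1, f 2), (f 3, f 4), (f 5, f 6, f 7))) (layers_101 (quad_P scalar_space)) (fun_rep (P1c :: 'k um_rep))"
    by (rule lin_isoI[OF ok]) (auto elim!: supp8E simp: layers_101_def quad_P_def scalar_space_def kpair_def fun_rep_def fun8_supp fun8_plus' fun8_nth scale_fun_fun8[unfolded scale_fun_def])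
qed (auto simp: layers_101_def quad_P_def scalar_space_def kpair_def fun_rep_def mat_fun_P1c add_ac)

lemma quad_P_cong:
  assumes "lin_iso f g V W" "klin V"
  shows "quad_iso (quad_P V) (quad_P W)"
proof (rule quad_isoI[OF quad_P_ok[OF assms(2)]])
  have f0: "f 0 = 0"
    using assms(1) lin_map_0 unfolding lin_iso_def subsp_def by metis
  show "lin_iso (\<lambda>(x, y). (f x, f y)) (\<lambda>(x, y). (g x, g y)) (qW (quad_P V)) (qW (quad_P W))"
    using lin_iso_kpair[OF assms(1) assms(1)] by (simp add: quad_P_def)
qed (use assms in \<open>auto simp: quad_P_def kpair_def lin_map_0[of V W f] lin_iso_def subsp_def\<close>)

text \<open>A sequence of tuples is regrouped as a tuple of sequences. This identifies n copies of
  the fibre with the layered module over an n-dimensional multiplicity space.\<close>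

lemma rep_power_layers_010:
  "rep_iso (rep_power n (layers_010 (quad_P (scalar_space :: ('k::field, 'k) kspace)))) (layers_010 (quad_P (seq_space n)))"
proof (rule rep_isoI[OF rep_power_ok[OF layers_010_DP_ok[OF klin_scalar_space]]])
  have ok: "subsp (rep_power n (layers_010 (quad_P (scalar_space :: ('k, 'k) kspace))))"
    by (rule op_rep_ok_subsp[OF rep_power_ok[OF layers_010_DP_ok[OF klin_scalar_space]]])
  show "lin_iso (\<lambda>F. (\<lambda>k. fst (F k), ((\<lambda>k. fst (fst (fst (snd (F k)))), \<lambda>k. snd (fst (fst (snd (F k))))),
        (\<lambda>k. fst (fst (snd (fst (snd (F k))))), \<lambda>k. snd (fst (snd (fst (snd (F k)))))),
        (\<lambda>k. fst (snd (snd (fst (snd (F k))))), \<lambda>k. snd (snd (snd (fst (snd (F k))))))), \<lambda>k. snd (snd (F k))))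
      (\<lambda>(u, ((s1, t1), (s2, t2), (s3, t3)), z) k. (u k, ((s1 k, t1 k), (s2 k, t2 k), (s3 k, t3 k)), z k))
      (rep_power n (layers_010 (quad_P scalar_space))) (layers_010 (quad_P (seq_space n :: ('k, _) kspace)))"
    by (rule lin_isoI[OF ok]) (auto simp: rep_power_def layers_010_def quad_P_def scalar_space_def seq_space_def kpair_def supp_below_def zero_prod_def fun_eq_iff prod_eq_iff split_beta)
qed (auto simp: rep_power_def layers_010_def quad_P_def scalar_space_def seq_space_def kpair_def split_beta zero_fun_def)

lemma rep_power_layers_101:
  "rep_iso (rep_power n (layers_101 (quad_P (scalar_space :: ('k::field, 'k) kspace)))) (layers_101 (quad_P (seq_space n)))"
proof (rule rep_isoI[OF rep_power_ok[OF layers_101_DP_ok[OF klin_scalar_space]]])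
  have ok: "subsp (rep_power n (layers_101 (quad_P (scalar_space :: ('k, 'k) kspace))))"
    by (rule op_rep_ok_subsp[OF rep_power_ok[OF layers_101_DP_ok[OF klin_scalar_space]]])
  show "lin_iso (\<lambda>F. ((\<lambda>k. fst (fst (F k)), \<lambda>k. fst (snd (fst (F k))), \<lambda>k. snd (snd (fst (F k)))),
        (\<lambda>k. fst (fst (snd (F k))), \<lambda>k. snd (fst (snd (F k)))),
        (\<lambda>k. fst (snd (snd (F k))), \<lambda>k. fst (snd (snd (snd (F k)))), \<lambda>k. snd (snd (snd (snd (F k)))))))
      (\<lambda>((u1, u2, u3), (s, t), (z1, z2, z3)) k. ((u1 k, u2 k, u3 k), (s k, t k), (z1 k, z2 k, z3 k)))
      (rep_power n (layers_101 (quad_P scalar_space))) (layers_101 (quad_P (seq_space n :: ('k, _) kspace)))"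
    by (rule lin_isoI[OF ok]) (auto simp: rep_power_def layers_101_def quad_P_def scalar_space_def seq_space_def kpair_def supp_below_def zero_prod_def fun_eq_iff prod_eq_iff split_beta)
qed (auto simp: rep_power_def layers_101_def quad_P_def scalar_space_def seq_space_def kpair_def split_beta zero_fun_def plus_fun_def)

text \<open>The layers of a free square depend only on the dimension of V, so a complement such as
  \<open>grid_col0_space\<close> contributes as many copies of the cover as its dimension.\<close>

lemma fun_rep_copies_P0c:
  assumes 2: "CHAR('k::field) = 2" and P: "um_iso P (P0c :: 'k um_rep)" and V: "lin_iso f g V (seq_space n)" "klin V"
  shows "rep_iso (layers_010 (quad_P V)) (fun_rep (um_copies n P))"
proof -
  have "rep_iso (layers_010 (quad_P V)) (layers_010 (quad_P (seq_space n)))"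
    by (rule layers_010_cong[OF quad_P_cong[OF V]]) (simp add: quad_P_def V)
  also have "rep_iso \<dots> (rep_power n (layers_010 (quad_P scalar_space)))"
    by (rule rep_iso_sym[OF rep_power_layers_010])
  also have "rep_iso \<dots> (fun_rep (um_copies n P))"
    by (rule fun_rep_copies[OF 2 um_iso_modules(1)[OF P] rep_iso_trans[OF fun_rep_P0c rep_iso_sym[OF rep_iso_of_um_iso[OF P]]]])
  finally show ?thesis .
qed

lemma fun_rep_copies_P1c:
  assumes 2: "CHAR('k::field) = 2" and P: "um_iso P (P1c :: 'k um_rep)" and V: "lin_iso f g V (seq_space n)" "klin V"
  shows "rep_iso (layers_101 (quad_P V)) (fun_rep (um_copies n P))"
proof -
  have "rep_iso (layers_101 (quad_P V)) (layers_101 (quad_P (seq_space n)))"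
    by (rule layers_101_cong[OF quad_P_cong[OF V]]) (simp_all add: quad_P_def V)
  also have "rep_iso \<dots> (rep_power n (layers_101 (quad_P scalar_space)))"
    by (rule rep_iso_sym[OF rep_power_layers_101])
  also have "rep_iso \<dots> (fun_rep (um_copies n P))"
    by (rule fun_rep_copies[OF 2 um_iso_modules(1)[OF P] rep_iso_trans[OF fun_rep_P1c rep_iso_sym[OF rep_iso_of_um_iso[OF P]]]])
  finally show ?thesis .
qed

lemma div_mod_lt: "i < r * s \<Longrightarrow> i div s < r \<and> i mod s < (s::nat)"
  by (metis less_mult_imp_div_less mod_less_divisor mult_0_right not_less_zero gr0I)

lemma index_lt: "k < r \<Longrightarrow> l < s \<Longrightarrow> k * s + l < r * (s::nat)"
proof -
  assume "k < r" "l < s"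
  then have "k * s + l < Suc k * s" by simp
  also have "\<dots> \<le> r * s" using \<open>k < r\<close> by (intro mult_le_mono1) simp
  finally show ?thesis .
qed

lemma lin_iso_grid_space:
  "lin_iso (\<lambda>u i. if i < r * s then u (i div s) (i mod s) else 0) (\<lambda>f k l. if k < r \<and> l < s then f (k * s + l) else 0)
     (grid_space r s) (seq_space (r * s) :: ('k::field, _) kspace)"
  by (rule lin_isoI[OF klin_subsp[OF klin_grid_space]]) (auto simp: grid_space_def seq_space_def supp_below_def fun_eq_iff index_lt dest: div_mod_lt)

text \<open>Dropping the zero column leaves s - 1 columns of length r. For r \<le> s the dimension r
  (s - 1) is r s - t, the multiplicity left after splitting off the kernel.\<close>

lemma lin_iso_grid_col0_space:
  "lin_iso (\<lambda>u i. if i < r * (s - 1) then u (i div (s - 1)) (Suc (i mod (s - 1))) else 0)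
     (\<lambda>f k l. if k < r \<and> 0 < l \<and> l < s then f (k * (s - 1) + (l - 1)) else 0)
     (grid_col0_space r s) (seq_space (r * (s - 1)) :: ('k::field, _) kspace)"
proof (rule lin_isoI)
  show "subsp (grid_col0_space r s :: ('k, _) kspace)" by (rule klin_subsp[OF klin_grid_col0_space])
  fix x :: "nat \<Rightarrow> nat \<Rightarrow> 'k" assume x: "x \<in> carr (grid_col0_space r s)"
  show "(\<lambda>k l. if k < r \<and> 0 < l \<and> l < s then (if k * (s - 1) + (l - 1) < r * (s - 1) then x ((k * (s - 1) + (l - 1)) div (s - 1)) (Suc ((k * (s - 1) + (l - 1)) mod (s - 1))) else 0) else 0) = x"
  proof (intro ext)
    fix k l
    show "(if k < r \<and> 0 < l \<and> l < s then (if k * (s - 1) + (l - 1) < r * (s - 1) then x ((k * (s - 1) + (l - 1)) div (s - 1)) (Suc ((k * (s - 1) + (l - 1)) mod (s - 1))) else 0) else 0) = x k l"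
    proof (cases "k < r \<and> 0 < l \<and> l < s")
      case True
      then obtain l' s' where ls: "l = Suc l'" "s = Suc s'" "l' < s'"
        by (metis Suc_less_eq gr0_conv_Suc less_trans)
      then have "k * s' + l' < r * s'" "(k * s' + l') div s' = k" "(k * s' + l') mod s' = l'"
        using index_lt[of k r l' s'] True by auto
      then show ?thesis using True ls by simp
    qed (use x in \<open>auto simp: grid_col0_space_def grid_space_def not_less\<close>)
  qed
next
  fix f :: "nat \<Rightarrow> 'k" assume f: "f \<in> carr (seq_space (r * (s - 1)))"
  have *: "i < r * (s - 1) \<Longrightarrow> i div (s - 1) < r \<and> Suc (i mod (s - 1)) < s" for i
    using div_mod_lt[of i r "s - 1"] by auto
  show "(\<lambda>i. if i < r * (s - 1) then (if i div (s - 1) < r \<and> 0 < Suc (i mod (s - 1)) \<and> Suc (i mod (s - 1)) < s then f (i div (s - 1) * (s - 1) + (Suc (i mod (s - 1)) - 1)) else 0) else 0) = f"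
    using f * by (auto simp: seq_space_def supp_below_def fun_eq_iff div_mult_mod_eq)
qed (auto simp: seq_space_def grid_col0_space_def grid_space_def supp_below_def fun_eq_iff)


section \<open>The modules A and B in coordinates\<close>

text \<open>
  The coefficients of the pencils \<open>c\<^sub>1 + d\<^sub>1 N\<close> and \<open>c\<^sub>2 + d\<^sub>2 N\<close> belonging to \<open>A\<^sub>x(r)\<close>, including the
  convention for \<open>x\<^sub>1 = x\<^sub>2\<close>, where the module does not depend on the scale of \<open>x\<close>.
\<close>

definition A_c1 :: "'k \<times> 'k \<Rightarrow> 'k::field" where "A_c1 x = (if fst x \<noteq> snd x then fst x else 1)"
definition A_d1 :: "'k \<times> 'k \<Rightarrow> 'k::field" where "A_d1 x = (if fst x \<noteq> snd x then snd x else 0)"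
definition A_c2 :: "'k \<times> 'k \<Rightarrow> 'k::field" where "A_c2 x = (if fst x \<noteq> snd x then snd x else 1)"
definition A_d2 :: "'k \<times> 'k \<Rightarrow> 'k::field" where "A_d2 x = (if fst x \<noteq> snd x then fst x else 1)"

lemma um_A_simps [simp]: "mdim (um_A x r) = 4 * r" "act_a (um_A x r) \<in> carrier_mat (4 * r) (4 * r)"
  "act_b (um_A x r) \<in> carrier_mat (4 * r) (4 * r)" "act_c (um_A x r) \<in> carrier_mat (4 * r) (4 * r)"
  by (simp_all add: um_A_def Let_def)

lemma um_A_dims [simp]: 
  "dim_row (act_a (um_A x r)) = 4 * r" "dim_col (act_a (um_A x r)) = 4 * r"
  "dim_row (act_b (um_A x r)) = 4 * r" "dim_col (act_b (um_A x r)) = 4 * r"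
  "dim_row (act_c (um_A x r)) = 4 * r" "dim_col (act_c (um_A x r)) = 4 * r"
  using um_A_simps[of x r] by blast+

lemma mod4_cases:
  fixes j :: nat
  obtains l where "j = 4 * l" | l where "j = 4 * l + 1" | l where "j = 4 * l + 2" | l where "j = 4 * l + 3"
proof -
  have "j = 4 * (j div 4) + j mod 4" by simp
  moreover have "j mod 4 = 0 \<or> j mod 4 = 1 \<or> j mod 4 = 2 \<or> j mod 4 = 3" by auto
  ultimately show thesis using that by (metis add_0_right)
qed

lemma mod4_simps: "Suc (4 * l) mod 4 = 1" "Suc (Suc (4 * l)) mod 4 = 2" "Suc (Suc (Suc (4 * l))) mod 4 = 3"
  "Suc (Suc (Suc (Suc (4 * l)))) mod 4 = 0" "(4 * l + 2) mod 4 = (2::nat)" "(4 * l + 3) mod 4 = (3::nat)"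
  by presburger+

text \<open>Row and column i belong to z (i + 1), so the head vectors sit at the multiples of 4 and
  each is followed by its copy of V1. The coefficients of N appear three places to the right of the
  diagonal for a and one place for b.\<close>

lemma act_A_entry:
  fixes x :: "'k::field \<times> 'k"
  assumes "i < 4 * r" "j < 4 * r"
  shows "act_a (um_A x r) $$ (i, j) = (if i mod 4 = 1 then (if i = j + 1 then A_c1 x else if j = i + 3 then A_d1 x else 0)
      else if i mod 4 = 0 then 0 else if i = j + 1 then 1 else 0)" (is ?a)
    and "act_b (um_A x r) $$ (i, j) = (if i mod 4 = 3 then (if i = j + 3 then A_c2 x else if j = i + 1 then A_d2 x else 0)
      else if i mod 4 = 0 then 0 else if j = i + 1 then 1 else 0)" (is ?b)
    and "act_c (um_A x r) $$ (i, j) = (if i = j \<and> odd i then 1 else 0)" (is ?c)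
proof -
  let ?z = "basis_vec (4 * r) :: nat \<Rightarrow> 'k vec"
  have z: "?z m $ i = (if Suc i = m then 1 else 0)" if "i < 4 * r" "0 < m" "m \<le> 4 * r" for i m
    using that by (auto simp: basis_vec_def unit_vec_def)
  have zc: "?z l \<in> carrier_vec (4 * r)" "dim_vec (?z l) = 4 * r" for l
    by (auto simp: basis_vec_def)
  have n: "endo_mat (4 * r) f $$ (i, j) = f (j + 1) $ i" if "\<And>i. f i \<in> carrier_vec (4 * r)" for f :: "nat \<Rightarrow> 'k vec"
    using endo_mat_nth[OF assms] that by blast
  have sc: "c \<cdot>\<^sub>v ?z l \<in> carrier_vec (4 * r)" for c l by (simp add: zc)
  have even: "even l \<longleftrightarrow> l mod 4 = 0 \<or> l mod 4 = 2" for l :: nat by presburger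
  have "act_c (um_A x r) $$ (i, j) = (if odd j then ?z (Suc j) else 0\<^sub>v (4 * r)) $ i"
    by (simp add: um_A_def Let_def n zc)
  then show ?c
    using assms z[of i "Suc j"] by auto
  have a: "act_a (um_A x r) $$ (i, j) = (if (j + 1) mod 4 = 2 then ?z (j + 1 + 1) else if (j + 1) mod 4 = 3 then ?z (j + 1 + 1)
     else if (j + 1) mod 4 = 0 then 0\<^sub>v (4 * r) else if fst x \<noteq> snd x then
       (if j + 1 = 1 then fst x \<cdot>\<^sub>v ?z 2 else fst x \<cdot>\<^sub>v ?z (j + 1 + 1) + snd x \<cdot>\<^sub>v ?z (j + 1 - 3))
     else (if j + 1 = 1 then ?z 2 else ?z (j + 1 + 1))) $ i"
    unfolding um_A_def Let_def um_rep.simps by (rule n) (simp add: zc)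
  have b: "act_b (um_A x r) $$ (i, j) = (if (j + 1) mod 4 = 2 then 0\<^sub>v (4 * r) else if (j + 1) mod 4 = 3 then ?z (j + 1 - 1)
     else if (j + 1) mod 4 = 0 then ?z (j + 1 - 1) else if fst x \<noteq> snd x then
       (if j + 1 = 1 then snd x \<cdot>\<^sub>v ?z 4 else fst x \<cdot>\<^sub>v ?z (j + 1 - 1) + snd x \<cdot>\<^sub>v ?z (j + 1 + 3))
     else (if j + 1 = 1 then ?z 4 else ?z (j + 1 - 1) + ?z (j + 1 + 3))) $ i"
    unfolding um_A_def Let_def um_rep.simps by (rule n) (simp add: zc)
  have dim: "i < 4 * r" by fact
  show ?a
  proof (rule mod4_cases[of j])
    fix l assume j: "j = 4 * l"
    then have l: "l < r" using assms by simp
    show ?a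
    proof (cases l)
      case 0
      then show ?thesis using l dim unfolding a unfolding j by (rule_tac mod4_cases[of i]; auto simp: z zc mod4_simps A_c1_def A_d1_def; presburger)
    next
      case (Suc l')
      then show ?thesis using l dim unfolding a unfolding j by (rule_tac mod4_cases[of i]; auto simp: z zc mod4_simps A_c1_def A_d1_def; presburger)
    qed
  next
    fix l assume j: "j = 4 * l + 1"
    then have l: "l < r" using assms by simp
    show ?a using l dim unfolding a unfolding j by (rule_tac mod4_cases[of i]; auto simp: z zc mod4_simps; presburger)
  next
    fix l assume j: "j = 4 * l + 2"
    then have l: "l < r" using assms by simp
    show ?a using l dim unfolding a unfolding j by (rule_tac mod4_cases[of i]; auto simp: z zc mod4_simps; presburger)
  next
    fix l assume j: "j = 4 * l + 3"
    then have l: "l < r" using assms by simp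
    show ?a using l dim unfolding a unfolding j by (rule_tac mod4_cases[of i]; auto simp: z zc mod4_simps; presburger)
  qed
  show ?b
  proof (rule mod4_cases[of j])
    fix l assume j: "j = 4 * l"
    then have l: "l < r" using assms by simp
    show ?b
    proof (cases l)
      case 0
      then show ?thesis using l dim unfolding b unfolding j by (rule_tac mod4_cases[of i]; auto simp: z zc mod4_simps A_c2_def A_d2_def; presburger)
    next
      case (Suc l')
      then show ?thesis using l dim unfolding b unfolding j by (rule_tac mod4_cases[of i]; auto simp: z zc mod4_simps A_c2_def A_d2_def; presburger)
    qed
  next
    fix l assume j: "j = 4 * l + 1"
    then have l: "l < r" using assms by simp
    show ?b using l dim unfolding b unfolding j by (rule_tac mod4_cases[of i]; auto simp: z zc mod4_simps; presburger)
  next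
    fix l assume j: "j = 4 * l + 2"
    then have l: "l < r" using assms by simp
    show ?b using l dim unfolding b unfolding j by (rule_tac mod4_cases[of i]; auto simp: z zc mod4_simps; presburger)
  next
    fix l assume j: "j = 4 * l + 3"
    then have l: "l < r" using assms by simp
    show ?b using l dim unfolding b unfolding j by (rule_tac mod4_cases[of i]; auto simp: z zc mod4_simps; presburger)
  qed
qed

lemma sum_two_deltas:
  fixes f :: "nat \<Rightarrow> 'k::comm_semiring_1"
  assumes "\<And>j. j < N \<Longrightarrow> g j = (if j = a then u else if j = b then v else 0)" "a \<noteq> b" "a < N"
  shows "(\<Sum>j<N. g j * f j) = u * f a + (if b < N then v * f b else 0)"
proof -
  have "(\<Sum>j<N. g j * f j) = (\<Sum>j<N. (if j = a then u * f j else 0) + (if j = b then v * f j else 0))"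
    using assms by (intro sum.cong) auto
  then show ?thesis
    using assms by (simp add: sum.distrib)
qed

lemma sum_one_delta:
  fixes f :: "nat \<Rightarrow> 'k::comm_semiring_1"
  assumes "\<And>j. j < N \<Longrightarrow> g j = (if j = a then 1 else 0)" "a < N"
  shows "(\<Sum>j<N. g j * f j) = f a"
proof -
  have "(\<Sum>j<N. g j * f j) = (\<Sum>j<N. if j = a then f j else 0)"
    using assms by (intro sum.cong) auto
  then show ?thesis
    using assms by simp
qed

lemma mat_fun_act_A:
  fixes x :: "'k::field \<times> 'k"
  assumes "k < r"
  shows "mat_fun (act_a (um_A x r)) f (4 * k) = 0"
    "mat_fun (act_a (um_A x r)) f (4 * k + 1) = A_c1 x * f (4 * k) + (if Suc k < r then A_d1 x * f (4 * Suc k) else 0)"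
    "mat_fun (act_a (um_A x r)) f (4 * k + 2) = f (4 * k + 1)"
    "mat_fun (act_a (um_A x r)) f (4 * k + 3) = f (4 * k + 2)"
    "mat_fun (act_b (um_A x r)) f (4 * k) = 0"
    "mat_fun (act_b (um_A x r)) f (4 * k + 1) = f (4 * k + 2)"
    "mat_fun (act_b (um_A x r)) f (4 * k + 2) = f (4 * k + 3)"
    "mat_fun (act_b (um_A x r)) f (4 * k + 3) = A_c2 x * f (4 * k) + (if Suc k < r then A_d2 x * f (4 * Suc k) else 0)"
proof -
  have o: "mat_fun X f i = (\<Sum>j<4 * r. X $$ (i, j) * f j)" if "i < 4 * r" "X \<in> carrier_mat (4 * r) (4 * r)" for X i
    using that by (auto simp: mat_fun_def)
  show "mat_fun (act_a (um_A x r)) f (4 * k) = 0" "mat_fun (act_b (um_A x r)) f (4 * k) = 0"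
    using assms by (simp_all add: o act_A_entry)
  show "mat_fun (act_a (um_A x r)) f (4 * k + 2) = f (4 * k + 1)" "mat_fun (act_a (um_A x r)) f (4 * k + 3) = f (4 * k + 2)"
     "mat_fun (act_b (um_A x r)) f (4 * k + 1) = f (4 * k + 2)" "mat_fun (act_b (um_A x r)) f (4 * k + 2) = f (4 * k + 3)"
    using assms by (subst o; (simp; fail)?; subst sum_one_delta; auto simp: act_A_entry mod_simps; presburger)+
  show "mat_fun (act_a (um_A x r)) f (4 * k + 1) = A_c1 x * f (4 * k) + (if Suc k < r then A_d1 x * f (4 * Suc k) else 0)"
    using assms by (subst o; (simp; fail)?; subst sum_two_deltas[of _ _ "4 * k" "A_c1 x" "4 * Suc k" "A_d1 x"]; auto simp: act_A_entry)
  show "mat_fun (act_b (um_A x r)) f (4 * k + 3) = A_c2 x * f (4 * k) + (if Suc k < r then A_d2 x * f (4 * Suc k) else 0)"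
    using assms by (subst o; (simp; fail)?; subst sum_two_deltas[of _ _ "4 * k" "A_c2 x" "4 * Suc k" "A_d2 x"]; auto simp: act_A_entry)
qed

text \<open>Transposition reverses every arrow: coordinates 4k + 3, 4k + 2, 4k + 1 now form the V1
  on top, coordinate 4k is the socle, and the shift refers to block k - 1 instead of k + 1.\<close>

lemma mat_fun_act_B:
  fixes x :: "'k::field \<times> 'k"
  assumes 2: "CHAR('k) = 2" and "k < r"
  shows "mat_fun (act_a (um_B x r)) f (4 * k + 3) = 0"
    "mat_fun (act_a (um_B x r)) f (4 * k + 2) = f (4 * k + 3)"
    "mat_fun (act_a (um_B x r)) f (4 * k + 1) = f (4 * k + 2)"
    "mat_fun (act_a (um_B x r)) f (4 * k) = A_c1 x * f (4 * k + 1) + (if 0 < k then A_d1 x * f (4 * (k - 1) + 1) else 0)"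
    "mat_fun (act_b (um_B x r)) f (4 * k + 3) = f (4 * k + 2)"
    "mat_fun (act_b (um_B x r)) f (4 * k + 2) = f (4 * k + 1)"
    "mat_fun (act_b (um_B x r)) f (4 * k + 1) = 0"
    "mat_fun (act_b (um_B x r)) f (4 * k) = A_c2 x * f (4 * k + 3) + (if 0 < k then A_d2 x * f (4 * (k - 1) + 3) else 0)"
proof -
  have neg: "- y = (y :: 'k)" for y
    using char2_add_self[OF 2, of y] by (simp add: eq_neg_iff_add_eq_0 flip: eq_neg_iff_add_eq_0)
  have o: "mat_fun (- transpose_mat X) f i = (\<Sum>j<4 * r. X $$ (j, i) * f j)" if "i < 4 * r" "X \<in> carrier_mat (4 * r) (4 * r)" for X i
    using that by (auto simp: mat_fun_def neg)
  have B: "act_a (um_B x r) = - transpose_mat (act_a (um_A x r))" "act_b (um_B x r) = - transpose_mat (act_b (um_A x r))"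
    by (simp_all add: um_B_def um_dual_def)
  show "mat_fun (act_a (um_B x r)) f (4 * k + 3) = 0" "mat_fun (act_b (um_B x r)) f (4 * k + 1) = 0"
    using assms unfolding B by (subst o; (simp; fail)?; auto simp: act_A_entry intro!: sum.neutral; presburger)+
  show "mat_fun (act_a (um_B x r)) f (4 * k + 2) = f (4 * k + 3)" "mat_fun (act_a (um_B x r)) f (4 * k + 1) = f (4 * k + 2)"
     "mat_fun (act_b (um_B x r)) f (4 * k + 3) = f (4 * k + 2)" "mat_fun (act_b (um_B x r)) f (4 * k + 2) = f (4 * k + 1)"
    using assms unfolding B by (subst o; (simp; fail)?; subst sum_one_delta; auto simp: act_A_entry mod_simps; presburger)+
  show "mat_fun (act_a (um_B x r)) f (4 * k) = A_c1 x * f (4 * k + 1) + (if 0 < k then A_d1 x * f (4 * (k - 1) + 1) else 0)"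
  proof (cases k)
    case 0
    have "mat_fun (act_a (um_B x r)) f (4 * k) = A_c1 x * f 1 + (if 4 * r < 4 * r then 0 * f (4 * r) else 0)"
      unfolding B using 0 assms by (subst o; (simp; fail)?; subst sum_two_deltas[of _ _ 1 "A_c1 x" "4 * r" 0]; auto simp: act_A_entry; presburger)
    then show ?thesis using 0 by simp
  next
    case (Suc k')
    have "mat_fun (act_a (um_B x r)) f (4 * k) = A_c1 x * f (4 * k + 1) + (if 4 * k' + 1 < 4 * r then A_d1 x * f (4 * k' + 1) else 0)"
      unfolding B using Suc assms by (subst o; (simp; fail)?; subst sum_two_deltas[of _ _ "4 * k + 1" "A_c1 x" "4 * k' + 1" "A_d1 x"]; auto simp: act_A_entry; presburger)
    then show ?thesis using Suc assms by simp
  qed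
  show "mat_fun (act_b (um_B x r)) f (4 * k) = A_c2 x * f (4 * k + 3) + (if 0 < k then A_d2 x * f (4 * (k - 1) + 3) else 0)"
  proof (cases k)
    case 0
    have "mat_fun (act_b (um_B x r)) f (4 * k) = A_c2 x * f 3 + (if 4 * r < 4 * r then 0 * f (4 * r) else 0)"
      unfolding B using 0 assms by (subst o; (simp; fail)?; subst sum_two_deltas[of _ _ 3 "A_c2 x" "4 * r" 0]; auto simp: act_A_entry; presburger)
    then show ?thesis using 0 by simp
  next
    case (Suc k')
    have "mat_fun (act_b (um_B x r)) f (4 * k) = A_c2 x * f (4 * k + 3) + (if 4 * k' + 3 < 4 * r then A_d2 x * f (4 * k' + 3) else 0)"
      unfolding B using Suc assms by (subst o; (simp; fail)?; subst sum_two_deltas[of _ _ "4 * k + 3" "A_c2 x" "4 * k' + 3" "A_d2 x"]; auto simp: act_A_entry; presburger)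
    then show ?thesis using Suc assms by simp
  qed
qed


section \<open>Tensor products in coordinates\<close>

lemma div4_simps: "Suc (4 * l) div 4 = l" "Suc (Suc (4 * l)) div 4 = l" "Suc (Suc (Suc (4 * l))) div 4 = l"
  "(4 * l + 2) div 4 = (l::nat)" "(4 * l + 3) div 4 = (l::nat)"
  by presburger+

lemma mat_fun_outside: "X \<in> carrier_mat n m \<Longrightarrow> \<not> i < n \<Longrightarrow> mat_fun X f i = 0"
  by (auto simp: mat_fun_def)

section \<open>The module relations for A\<close>

lemma mat_fun_anticommutator:
  assumes "X \<in> carrier_mat n n" "Y \<in> carrier_mat n n"
  shows "mat_fun (X * Y + Y * X) f = (\<lambda>i. mat_fun X (mat_fun Y f) i + mat_fun Y (mat_fun X f) i)"
  unfolding mat_fun_add_mat[OF mult_carrier_mat[OF assms] mult_carrier_mat[OF assms(2,1)]]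
    mat_fun_mult[OF assms] mat_fun_mult[OF assms(2,1)] ..

text \<open>The relations are checked in R with c read as ab + ba. They pull back because the
  isomorphism intertwines a and b and is injective.\<close>

lemma um_module_of_rep_iso:
  fixes M :: "'k::field um_rep" and R :: "('k, 'v::ab_group_add) op_rep"
  assumes 2: "CHAR('k) = 2" and M: "um_pre M" and iso: "rep_iso (fun_rep M) R"
    and rel: "\<And>x. x \<in> carr R \<Longrightarrow> (let a = opa R; b = opb R; c = (\<lambda>x. a (b x) + b (a x)) in
       a (c x) + c (a x) = a x \<and> b (c x) + c (b x) = b x \<and> a (a (a (a x))) = 0 \<and> b (b (b (b x))) = 0 \<and> c (c x) + c x = 0)"
  shows "um_module M"
proof -
  let ?S = "supp_below (mdim M) :: (nat \<Rightarrow> 'k) set"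
  define a b where "a = mat_fun (act_a M)" and "b = mat_fun (act_b M)"
  define c where "c x = a (b x) + b (a x)" for x
  have carrier: "act_a M \<in> carrier_mat (mdim M) (mdim M)" "act_b M \<in> carrier_mat (mdim M) (mdim M)" "act_c M \<in> carrier_mat (mdim M) (mdim M)"
    and C: "act_a M * act_b M + act_b M * act_a M = act_c M"
    using M by (auto simp: um_pre_def)
  have oc: "mat_fun (act_c M) = c"
    unfolding C[symmetric] c_def a_def b_def plus_fun_def
    using carrier by (intro ext) (simp add: mat_fun_add_mat[of _ "mdim M" "mdim M"] mat_fun_mult[OF carrier(1,2)] mat_fun_mult[OF carrier(2,1)])
  obtain f g where fg: "lin_iso f g (fun_rep M) R" and int: "\<And>x. x \<in> ?S \<Longrightarrow> f (a x) = opa R (f x)" "\<And>x. x \<in> ?S \<Longrightarrow> f (b x) = opb R (f x)"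
    using iso unfolding rep_iso_def a_def b_def fun_rep_def by auto
  have cl: "a x \<in> ?S" "b x \<in> ?S" for x
    using carrier mat_fun_supp by (auto simp: a_def b_def)
  have plus: "x + y \<in> ?S" if "x \<in> ?S" "y \<in> ?S" for x y
    using that by (auto simp: supp_below_def)
  have fadd: "f (x + y) = f x + f y" if "x \<in> ?S" "y \<in> ?S" for x y
    using fg that by (auto simp: lin_iso_def lin_map_def fun_rep_def)
  have mem: "f x \<in> carr R" if "x \<in> ?S" for x
    using fg that by (auto simp: lin_iso_def lin_map_def fun_rep_def)
  have inj: "x = y" if "f x = f y" "x \<in> ?S" "y \<in> ?S" for x y
    using fg that by (metis lin_iso_def fun_rep_def kspace.select_convs(1))
  have f0: "f 0 = 0"
    using lin_map_0[of "fun_rep M" R f] fg by (auto simp: lin_iso_def fun_rep_def)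
  have cS: "c x \<in> ?S" for x unfolding c_def by (intro plus cl)
  have fc: "f (c x) = opa R (opb R (f x)) + opb R (opa R (f x))" if "x \<in> ?S" for x
    unfolding c_def using that by (simp add: fadd cl int)
  show ?thesis
  proof (rule um_moduleI[OF 2 carrier refl])
    fix x :: "nat \<Rightarrow> 'k" assume x: "x \<in> ?S"
    note R = rel[OF mem[OF x], unfolded Let_def]
    have 1: "a (c x) + c (a x) = a x"
      by (rule inj) (use x R in \<open>simp_all add: fadd cl cS int fc plus\<close>)
    have 2: "b (c x) + c (b x) = b x"
      by (rule inj) (use x R in \<open>simp_all add: fadd cl cS int fc plus\<close>)
    have 3: "a (a (a (a x))) = 0" "b (b (b (b x))) = 0"
      by (rule inj; use x R in \<open>simp add: cl int f0\<close>)+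
    have 4: "c (c x) + c x = 0"
      by (rule inj) (use x R in \<open>simp_all add: fadd cl cS int fc plus f0\<close>)
    show "let a = mat_fun (act_a M); b = mat_fun (act_b M); c = mat_fun (act_c M) in
       (\<lambda>i. a (b x) i + b (a x) i) = c x \<and> (\<lambda>i. a (c x) i + c (a x) i) = a x \<and> (\<lambda>i. b (c x) i + c (b x) i) = b x \<and>
       a (a (a (a x))) = (\<lambda>_. 0) \<and> b (b (b (b x))) = (\<lambda>_. 0) \<and> (\<lambda>i. c (c x) i + c x i) = (\<lambda>_. 0)"
      unfolding Let_def oc a_def[symmetric] b_def[symmetric]
      using c_def[of x] 1 2 3 4 by (simp only: plus_fun_def zero_fun_def simp_thms)
  qed
qed

lemma um_pre_A:
  assumes 2: "CHAR('k::field) = 2"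
  shows "um_pre (um_A (x :: 'k \<times> 'k) r)"
proof -
  let ?A = "act_a (um_A x r)" and ?B = "act_b (um_A x r)" and ?C = "act_c (um_A x r)"
  note dbl = char2_add_self[OF 2]
  have c: "mat_fun ?C f i = (if odd i then f i else 0)" if "i < 4 * r" for f i
  proof -
    have "mat_fun ?C f i = (\<Sum>j<4 * r. if j = i then (if odd i then f i else 0) else 0)"
      unfolding mat_fun_def using that by (auto simp: act_A_entry if_distrib[of "\<lambda>t. t * _"] cong: if_cong)
    then show ?thesis using that by simp
  qed
  have "?A * ?B + ?B * ?A = ?C"
  proof (rule mat_fun_eqI[of _ "4 * r" "4 * r"])
    fix f :: "nat \<Rightarrow> 'k" assume f: "f \<in> supp_below (4 * r)"
    have *: "mat_fun ?A (mat_fun ?B f) i + mat_fun ?B (mat_fun ?A f) i = mat_fun ?C f i" if "i < 4 * r" for i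
    proof (rule mod4_cases[of i])
      fix k assume i: "i = 4 * k"
      then have k: "k < r" using that by simp
      show ?thesis unfolding c[OF that] unfolding i mat_fun_act_A[OF k] by simp
    next
      fix k assume i: "i = 4 * k + 1"
      then have k: "k < r" using that by simp
      \<comment> \<open>The image of b has no head coordinates, so the term that reaches into the
        next block disappears.\<close>
      have "(if Suc k < r then A_d1 x * mat_fun ?B f (4 * Suc k) else 0) = 0"
        using mat_fun_act_A(5)[of "Suc k" r x f] by simp
      then show ?thesis unfolding c[OF that] unfolding i mat_fun_act_A[OF k] by simp
    next
      fix k assume i: "i = 4 * k + 2"
      then have k: "k < r" using that by simp
      show ?thesis unfolding c[OF that] unfolding i mat_fun_act_A[OF k] dbl by simp
    next
      fix k assume i: "i = 4 * k + 3"
      then have k: "k < r" using that by simp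
      have "(if Suc k < r then A_d2 x * mat_fun ?A f (4 * Suc k) else 0) = 0"
        using mat_fun_act_A(1)[of "Suc k" r x f] by simp
      then show ?thesis unfolding c[OF that] unfolding i mat_fun_act_A[OF k] by simp
    qed
    show "mat_fun (?A * ?B + ?B * ?A) f = mat_fun ?C f"
    proof
      fix i
      show "mat_fun (?A * ?B + ?B * ?A) f i = mat_fun ?C f i"
      proof (cases "i < 4 * r")
        case True
        show ?thesis
          using *[OF True] unfolding mat_fun_anticommutator[OF um_A_simps(2,3)] .
      next
        case False
        show ?thesis
          unfolding mat_fun_anticommutator[OF um_A_simps(2,3)] mat_fun_outside[OF um_A_simps(2) False]
            mat_fun_outside[OF um_A_simps(3) False] mat_fun_outside[OF um_A_simps(4) False] by simp
      qed
    qed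
  qed auto
  then show ?thesis by (simp add: um_pre_def)
qed

lemma fun_rep_A:
  assumes 2: "CHAR('k::field) = 2"
  shows "rep_iso (fun_rep (um_A (x :: 'k \<times> 'k) r)) (A_pencil (pencil (A_c1 x) (A_d1 x)) (pencil (A_c2 x) (A_d2 x)) (seq_space r))"
proof (rule rep_isoI[OF fun_rep_ok[OF um_pre_A[OF 2]]])
  let ?f = "\<lambda>f. (\<lambda>k. f (4 * k), \<lambda>k. f (4 * k + 1), \<lambda>k. f (4 * k + 2), \<lambda>k. f (4 * k + 3)) :: (nat \<Rightarrow> 'k) \<times> (nat \<Rightarrow> 'k) \<times> (nat \<Rightarrow> 'k) \<times> (nat \<Rightarrow> 'k)"
  let ?g = "\<lambda>(w, x, y, z) i. (if i mod 4 = 0 then w else if i mod 4 = 1 then x else if i mod 4 = 2 then y else z) (i div 4) :: 'k"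
  let ?R = "A_pencil (pencil (A_c1 x) (A_d1 x)) (pencil (A_c2 x) (A_d2 x)) (seq_space r)"
  have gf: "?g (?f h) = h" for h
  proof
    fix i show "?g (?f h) i = h i"
      by (rule mod4_cases[of i]) (auto simp: mod4_simps div4_simps)
  qed
  show "lin_iso ?f ?g (fun_rep (um_A x r)) ?R"
  proof (rule lin_isoI[OF op_rep_ok_subsp[OF fun_rep_ok[OF um_pre_A[OF 2]]]])
    fix y assume "y \<in> carr ?R"
    then show "?g y \<in> carr (fun_rep (um_A x r))" "?f (?g y) = y"
      by (auto simp: A_pencil_def fun_rep_def seq_space_def supp_below_def mod4_simps div4_simps)
  qed (use gf in \<open>auto simp: A_pencil_def fun_rep_def seq_space_def supp_below_def\<close>)
  fix f assume "f \<in> carr (fun_rep (um_A x r))"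
  then have f: "f i = 0" if "i \<ge> 4 * r" for i using that by (auto simp: fun_rep_def supp_below_def)
  have z: "mat_fun (act_a (um_A x r)) f i = 0" "mat_fun (act_b (um_A x r)) f i = 0" if "i \<ge> 4 * r" for i
    using that by (auto simp: mat_fun_def)
  have 1: "mat_fun (act_a (um_A x r)) f (4 * k) = 0" "mat_fun (act_a (um_A x r)) f (4 * k + 1) = A_c1 x * f (4 * k) + A_d1 x * f (4 * Suc k)"
    "mat_fun (act_a (um_A x r)) f (4 * k + 2) = f (4 * k + 1)" "mat_fun (act_a (um_A x r)) f (4 * k + 3) = f (4 * k + 2)" 
    "mat_fun (act_b (um_A x r)) f (4 * k) = 0" "mat_fun (act_b (um_A x r)) f (4 * k + 1) = f (4 * k + 2)"
    "mat_fun (act_b (um_A x r)) f (4 * k + 2) = f (4 * k + 3)" "mat_fun (act_b (um_A x r)) f (4 * k + 3) = A_c2 x * f (4 * k) + A_d2 x * f (4 * Suc k)" for k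
    using mat_fun_act_A[of k r x f] f z by (cases "k < r"; auto)+
  show "?f (opa (fun_rep (um_A x r)) f) = opa ?R (?f f)" "?f (opb (fun_rep (um_A x r)) f) = opb ?R (?f f)"
    unfolding fun_rep_def op_rep.simps kspace.simps 1 by (auto simp: A_pencil_def pencil_def zero_fun_def)
qed

lemma um_module_A:
  assumes 2: "CHAR('k::field) = 2"
  shows "um_module (um_A (x :: 'k \<times> 'k) r)"
proof (rule um_module_of_rep_iso[OF 2 um_pre_A[OF 2] fun_rep_A[OF 2]])
  have d: "f + f = 0" for f :: "nat \<Rightarrow> 'k"
    using pencil_pair.two[OF pencil_pair_grid_space[OF 2], of "\<lambda>_. f"] by (simp add: fun_eq_iff)
  show "let a = opa (A_pencil (pencil (A_c1 x) (A_d1 x)) (pencil (A_c2 x) (A_d2 x)) (seq_space r)); b = opb (A_pencil (pencil (A_c1 x) (A_d1 x)) (pencil (A_c2 x) (A_d2 x)) (seq_space r)); c = (\<lambda>x. a (b x) + b (a x)) in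
       a (c y) + c (a y) = a y \<and> b (c y) + c (b y) = b y \<and> a (a (a (a y))) = 0 \<and> b (b (b (b y))) = 0 \<and> c (c y) + c y = 0" 
    for y :: "(nat \<Rightarrow> 'k) \<times> (nat \<Rightarrow> 'k) \<times> (nat \<Rightarrow> 'k) \<times> (nat \<Rightarrow> 'k)"
  proof -
    have p0: "pencil e g (0 :: nat \<Rightarrow> 'k) = 0" for e g by (auto simp: pencil_def)
    show ?thesis
      by (cases y) (auto simp: Let_def A_pencil_def d p0 zero_prod_def)
  qed
qed

section \<open>Kronecker products acting on rows\<close>

lemma mat_fun_cong: "(\<And>j. j < dim_col X \<Longrightarrow> f j = g j) \<Longrightarrow> mat_fun X f = mat_fun X g"
  by (auto simp: mat_fun_def intro!: ext sum.cong)

lemma sum_lessThan_times: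
  "(\<Sum>q<n * m. g q) = (\<Sum>i<n. \<Sum>j<m. g (i * m + j) :: 'k::comm_monoid_add)" for n m :: nat
proof -
  have "(\<Sum>i<n. \<Sum>j<m. g (i * m + j)) = (\<Sum>(i, j)\<in>{..<n} \<times> {..<m}. g (i * m + j))"
    by (simp add: sum.cartesian_product)
  also have "\<dots> = (\<Sum>q<n * m. g q)"
    by (rule sum.reindex_bij_witness[of _ "\<lambda>q. (q div m, q mod m)" "\<lambda>(i, j). i * m + j"]) (auto simp: index_lt dest: div_mod_lt)
  finally show ?thesis by simp
qed

lemma kronecker_carrier: "X \<in> carrier_mat n n \<Longrightarrow> Y \<in> carrier_mat m m \<Longrightarrow> kronecker X Y \<in> carrier_mat (n * m) (n * m)"
  by (auto simp: kronecker_def)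

lemma mat_fun_kronecker:
  assumes X: "X \<in> carrier_mat n n" and Y: "Y \<in> carrier_mat m m" and i: "i < n" "j < m"
  shows "mat_fun (kronecker X Y) f (i * m + j) = (\<Sum>i'<n. \<Sum>j'<m. X $$ (i, i') * Y $$ (j, j') * f (i' * m + j'))"
  using X Y i by (auto simp: mat_fun_def kronecker_def sum_lessThan_times index_lt intro!: sum.cong)

lemma mat_fun_prim:
  fixes X Y :: "'k::field mat"
  assumes X: "X \<in> carrier_mat n n" and Y: "Y \<in> carrier_mat m m" and i: "i < n" "j < m"
  shows "mat_fun (kronecker X (1\<^sub>m m) + kronecker (1\<^sub>m n) Y) f (i * m + j) = mat_fun X (\<lambda>i'. f (i' * m + j)) i + mat_fun Y (\<lambda>j'. f (i * m + j')) j"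
proof -
  have "mat_fun (kronecker X (1\<^sub>m m)) f (i * m + j) = (\<Sum>i'<n. \<Sum>j'<m. if j' = j then X $$ (i, i') * f (i' * m + j') else 0)"
    unfolding mat_fun_kronecker[OF X one_carrier_mat i] using i by (intro sum.cong) auto
  then have 1: "mat_fun (kronecker X (1\<^sub>m m)) f (i * m + j) = mat_fun X (\<lambda>i'. f (i' * m + j)) i"
    using X i by (simp add: mat_fun_def)
  have "mat_fun (kronecker (1\<^sub>m n) Y) f (i * m + j) = (\<Sum>i'<n. if i' = i then (\<Sum>j'<m. Y $$ (j, j') * f (i' * m + j')) else 0)"
    unfolding mat_fun_kronecker[OF one_carrier_mat Y i] using i by (intro sum.cong) auto
  then have 2: "mat_fun (kronecker (1\<^sub>m n) Y) f (i * m + j) = mat_fun Y (\<lambda>j'. f (i * m + j')) j"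
    using Y i by (simp add: mat_fun_def)
  show ?thesis
    unfolding mat_fun_add_mat[OF kronecker_carrier[OF X one_carrier_mat] kronecker_carrier[OF one_carrier_mat Y]] 1 2 ..
qed

text \<open>Operators on different indices of a double family commute, which is the interchange of
  two finite sums.\<close>

lemma mat_fun_commute:
  "mat_fun X (\<lambda>i'. mat_fun Y (\<lambda>j'. f i' j') j) i = mat_fun Y (\<lambda>j'. mat_fun X (\<lambda>i'. f i' j') i) j"
  unfolding mat_fun_def by (auto simp: sum_distrib_left mult.left_commute intro: sum.swap)

lemma um_tensor_simps [simp]:
  "mdim (um_tensor M N) = mdim M * mdim N"
  "act_a (um_tensor M N) = kronecker (act_a M) (1\<^sub>m (mdim N)) + kronecker (1\<^sub>m (mdim M)) (act_a N)"
  "act_b (um_tensor M N) = kronecker (act_b M) (1\<^sub>m (mdim N)) + kronecker (1\<^sub>m (mdim M)) (act_b N)"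
  "act_c (um_tensor M N) = kronecker (act_c M) (1\<^sub>m (mdim N)) + kronecker (1\<^sub>m (mdim M)) (act_c N)"
  by (simp_all add: um_tensor_def Let_def)

text \<open>In ab + ba for primitive a and b the mixed terms, one operator on each factor, occur
  twice and cancel. The anticommutators of the two factors remain.\<close>

lemma um_pre_tensor:
  fixes M N :: "'k::field um_rep"
  assumes 2: "CHAR('k) = 2" and M: "um_pre M" and N: "um_pre N"
  shows "um_pre (um_tensor M N)"
proof -
  let ?n = "mdim M" and ?m = "mdim N"
  let ?P = "\<lambda>X Y. kronecker X (1\<^sub>m ?m) + kronecker (1\<^sub>m ?n) Y"
  have A: "act_a M \<in> carrier_mat ?n ?n" "act_b M \<in> carrier_mat ?n ?n" "act_c M \<in> carrier_mat ?n ?n" "act_a M * act_b M + act_b M * act_a M = act_c M"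
    and B: "act_a N \<in> carrier_mat ?m ?m" "act_b N \<in> carrier_mat ?m ?m" "act_c N \<in> carrier_mat ?m ?m" "act_a N * act_b N + act_b N * act_a N = act_c N"
    using M N by (auto simp: um_pre_def)
  have Pc: "?P X Y \<in> carrier_mat (?n * ?m) (?n * ?m)" if "X \<in> carrier_mat ?n ?n" "Y \<in> carrier_mat ?m ?m" for X Y :: "'k mat"
    using kronecker_carrier[OF that(1) one_carrier_mat] kronecker_carrier[OF one_carrier_mat that(2)] by simp
  have comp: "mat_fun (?P X Y) (mat_fun (?P X' Y') f) (i * ?m + j) =
      mat_fun X (mat_fun X' (\<lambda>i'. f (i' * ?m + j))) i + mat_fun X (\<lambda>i'. mat_fun Y' (\<lambda>j'. f (i' * ?m + j')) j) i +
      (mat_fun X' (\<lambda>i'. mat_fun Y (\<lambda>j'. f (i' * ?m + j')) j) i + mat_fun Y (mat_fun Y' (\<lambda>j'. f (i * ?m + j'))) j)"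
    if c: "X \<in> carrier_mat ?n ?n" "Y \<in> carrier_mat ?m ?m" "X' \<in> carrier_mat ?n ?n" "Y' \<in> carrier_mat ?m ?m" and i: "i < ?n" "j < ?m"
    for X Y X' Y' :: "'k mat" and f i j
  proof -
    have 1: "mat_fun X (\<lambda>i'. mat_fun (?P X' Y') f (i' * ?m + j)) = mat_fun X (\<lambda>i'. mat_fun X' (\<lambda>i'. f (i' * ?m + j)) i' + mat_fun Y' (\<lambda>j'. f (i' * ?m + j')) j)"
      using c i by (intro mat_fun_cong) (simp add: mat_fun_prim)
    have 2: "mat_fun Y (\<lambda>j'. mat_fun (?P X' Y') f (i * ?m + j')) = mat_fun Y (\<lambda>j'. mat_fun X' (\<lambda>i'. f (i' * ?m + j')) i + mat_fun Y' (\<lambda>j'. f (i * ?m + j')) j')"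
      using c i by (intro mat_fun_cong) (simp add: mat_fun_prim)
    show ?thesis
      unfolding mat_fun_prim[OF c(1,2) i] 1 2 mat_fun_add
      by (simp add: mat_fun_commute[of Y X'])
  qed
  have "?P (act_a M) (act_a N) * ?P (act_b M) (act_b N) + ?P (act_b M) (act_b N) * ?P (act_a M) (act_a N) = ?P (act_c M) (act_c N)"
  proof (rule mat_fun_eqI[of _ "?n * ?m" "?n * ?m"])
    fix f :: "nat \<Rightarrow> 'k"
    show "mat_fun (?P (act_a M) (act_a N) * ?P (act_b M) (act_b N) + ?P (act_b M) (act_b N) * ?P (act_a M) (act_a N)) f = mat_fun (?P (act_c M) (act_c N)) f" (is "mat_fun ?L f = mat_fun ?C f")
    proof
      fix q
      show "mat_fun ?L f q = mat_fun ?C f q"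
      proof (cases "q < ?n * ?m")
        case True
        define i j where "i = q div ?m" and "j = q mod ?m"
        have ij: "i < ?n" "j < ?m" and q: "q = i * ?m + j"
          using div_mod_lt[OF True] by (auto simp: i_def j_def)
        have L: "mat_fun ?L f q = mat_fun (?P (act_a M) (act_a N)) (mat_fun (?P (act_b M) (act_b N)) f) q + mat_fun (?P (act_b M) (act_b N)) (mat_fun (?P (act_a M) (act_a N)) f) q"
          unfolding mat_fun_anticommutator[OF Pc[OF A(1) B(1)] Pc[OF A(2) B(2)]] ..
        have c1: "mat_fun (act_c M) g = (\<lambda>i. mat_fun (act_a M) (mat_fun (act_b M) g) i + mat_fun (act_b M) (mat_fun (act_a M) g) i)" for g
          unfolding A(4)[symmetric] by (rule mat_fun_anticommutator[OF A(1,2)])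
        have c2: "mat_fun (act_c N) g = (\<lambda>i. mat_fun (act_a N) (mat_fun (act_b N) g) i + mat_fun (act_b N) (mat_fun (act_a N) g) i)" for g
          unfolding B(4)[symmetric] by (rule mat_fun_anticommutator[OF B(1,2)])
        have canc: "(s + u + (v + t)) + (s' + v + (u + t')) = (s + s') + (t + t')" for s t u v s' t' :: 'k
        proof -
          have "(s + u + (v + t)) + (s' + v + (u + t')) = (s + s') + (t + t') + ((u + u) + (v + v))" by (simp add: algebra_simps)
          then show ?thesis by (simp only: char2_add_self[OF 2] add_0_right)
        qed
        show ?thesis
          unfolding L unfolding q comp[OF A(1) B(1) A(2) B(2) ij] comp[OF A(2) B(2) A(1) B(1) ij] mat_fun_prim[OF A(3) B(3) ij] c1 c2
          by (rule canc)
      next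
        case False
        show ?thesis
          unfolding mat_fun_anticommutator[OF Pc[OF A(1) B(1)] Pc[OF A(2) B(2)]] mat_fun_outside[OF Pc[OF A(1) B(1)] False]
            mat_fun_outside[OF Pc[OF A(2) B(2)] False] mat_fun_outside[OF Pc[OF A(3) B(3)] False] by simp
      qed
    qed
  qed (use Pc[OF A(1) B(1)] Pc[OF A(2) B(2)] Pc[OF A(3) B(3)] in auto)
  then show ?thesis
    unfolding um_pre_def um_tensor_simps using Pc[OF A(1) B(1)] Pc[OF A(2) B(2)] Pc[OF A(3) B(3)] by blast
qed

definition fin_supp :: "nat \<Rightarrow> 'v set \<Rightarrow> (nat \<Rightarrow> 'v::zero) set" where
  "fin_supp r X = {F. (\<forall>k<r. F k \<in> X) \<and> (\<forall>k\<ge>r. F k = 0)}"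

text \<open>The first factor A_x(r) is written in coordinates and the second is left abstract, so
  the products with A and with B come from a single computation.\<close>

definition tensor_A :: "'k \<Rightarrow> 'k \<Rightarrow> 'k \<Rightarrow> 'k \<Rightarrow> nat \<Rightarrow> ('k, 'v::ab_group_add) op_rep \<Rightarrow>
    ('k, (nat \<Rightarrow> 'v) \<times> (nat \<Rightarrow> 'v) \<times> (nat \<Rightarrow> 'v) \<times> (nat \<Rightarrow> 'v)) op_rep" where
  "tensor_A c1 d1 c2 d2 r R =
     \<lparr> carr = fin_supp r (carr R) \<times> fin_supp r (carr R) \<times> fin_supp r (carr R) \<times> fin_supp r (carr R),
       smul = (\<lambda>c (w, x, y, z). (\<lambda>k. smul R c (w k), \<lambda>k. smul R c (x k), \<lambda>k. smul R c (y k), \<lambda>k. smul R c (z k))),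
       opa = (\<lambda>(w, x, y, z). (\<lambda>k. opa R (w k), \<lambda>k. smul R c1 (w k) + smul R d1 (w (Suc k)) + opa R (x k),
          \<lambda>k. x k + opa R (y k), \<lambda>k. y k + opa R (z k))),
       opb = (\<lambda>(w, x, y, z). (\<lambda>k. opb R (w k), \<lambda>k. y k + opb R (x k),
          \<lambda>k. z k + opb R (y k), \<lambda>k. smul R c2 (w k) + smul R d2 (w (Suc k)) + opb R (z k))) \<rparr>"

definition tensor_row :: "nat \<Rightarrow> (nat \<Rightarrow> 'k::zero) \<Rightarrow> nat \<Rightarrow> nat \<Rightarrow> 'k" where
  "tensor_row m f i = (\<lambda>j. if j < m then f (i * m + j) else 0)"

lemma tensor_row_act:
  assumes X: "X \<in> carrier_mat n n" and Y: "Y \<in> carrier_mat m m" and i: "i < n"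
  shows "tensor_row m (mat_fun (kronecker X (1\<^sub>m m) + kronecker (1\<^sub>m n) Y) f) i
      = (\<lambda>j. mat_fun X (\<lambda>i'. tensor_row m f i' j) i + mat_fun Y (tensor_row m f i) j)"
proof
  fix j
  have "mat_fun Y (\<lambda>j'. f (i * m + j')) = mat_fun Y (tensor_row m f i)"
    using Y by (intro mat_fun_cong) (auto simp: tensor_row_def)
  then show "tensor_row m (mat_fun (kronecker X (1\<^sub>m m) + kronecker (1\<^sub>m n) Y) f) i j = mat_fun X (\<lambda>i'. tensor_row m f i' j) i + mat_fun Y (tensor_row m f i) j"
    using mat_fun_prim[OF X Y i, of j f] Y by (cases "j < m") (auto simp: tensor_row_def mat_fun_def)
qed

lemma fun_rep_tensor_A:
  fixes x :: "'k::field \<times> 'k" and N :: "'k um_rep"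
  assumes 2: "CHAR('k) = 2" and N: "um_pre N"
  shows "rep_iso (fun_rep (um_tensor (um_A x r) N)) (tensor_A (A_c1 x) (A_d1 x) (A_c2 x) (A_d2 x) r (fun_rep N))"
proof -
  let ?m = "mdim N" and ?T = "um_tensor (um_A x r) N" and ?R = "tensor_A (A_c1 x) (A_d1 x) (A_c2 x) (A_d2 x) r (fun_rep N)"
  have ok: "op_rep_ok (fun_rep ?T)"
    by (rule fun_rep_ok[OF um_pre_tensor[OF 2 um_pre_A[OF 2] N]])
  have B: "act_a N \<in> carrier_mat ?m ?m" "act_b N \<in> carrier_mat ?m ?m"
    using N by (auto simp: um_pre_def)
  let ?f = "\<lambda>f. (\<lambda>k. tensor_row ?m f (4 * k), \<lambda>k. tensor_row ?m f (4 * k + 1), \<lambda>k. tensor_row ?m f (4 * k + 2), \<lambda>k. tensor_row ?m f (4 * k + 3)) ::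
     (nat \<Rightarrow> nat \<Rightarrow> 'k) \<times> (nat \<Rightarrow> nat \<Rightarrow> 'k) \<times> (nat \<Rightarrow> nat \<Rightarrow> 'k) \<times> (nat \<Rightarrow> nat \<Rightarrow> 'k)"
  let ?h = "\<lambda>(w, x, y, z) i. (if i mod 4 = 0 then w else if i mod 4 = 1 then x else if i mod 4 = 2 then y else z) (i div 4) :: nat \<Rightarrow> 'k"
  let ?g = "\<lambda>t q. if q < 4 * r * ?m then ?h t (q div ?m) (q mod ?m) else 0"
  have hf: "?h (?f f) i = tensor_row ?m f i" for f i
    by (rule mod4_cases[of i]) (auto simp: mod4_simps div4_simps)
  have rg: "tensor_row ?m (?g t) i = ?h t i" if t: "t \<in> carr ?R" for t i
  proof -
    obtain w x y z where tt: "t = (w, x, y, z)" by (cases t) auto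
    have out: "?h t i = 0" if "i \<ge> 4 * r"
    proof -
      have "i div 4 \<ge> r" using that by simp
      then show ?thesis using t unfolding tt by (auto simp: tensor_A_def fin_supp_def)
    qed
    have s: "?h t i j = 0" if "j \<ge> ?m" for j
    proof (cases "i < 4 * r")
      case True
      then have "i div 4 < r" by (simp add: less_mult_imp_div_less mult.commute)
      then show ?thesis using t that unfolding tt by (auto simp: tensor_A_def fin_supp_def fun_rep_def supp_below_def)
    qed (use out in auto)
    show ?thesis
    proof
      fix j
      show "tensor_row ?m (?g t) i j = ?h t i j"
      proof (cases "j < ?m")
        case j: True
        show ?thesis
        proof (cases "i < 4 * r")
          case True
          then show ?thesis using j index_lt[OF True j] by (simp add: tensor_row_def)
        next
          case False
          then have "\<not> i * ?m + j < 4 * r * ?m"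
            by (metis add_lessD1 mult_less_cancel2)
          then show ?thesis using j out False by (simp add: tensor_row_def)
        qed
      qed (use s in \<open>simp add: tensor_row_def\<close>)
    qed
  qed
  have r0: "tensor_row ?m f i = 0" if "f \<in> supp_below (4 * r * ?m)" "i \<ge> 4 * r" for f :: "nat \<Rightarrow> 'k" and i
  proof
    fix j
    have "4 * r * ?m \<le> i * ?m + j" using that(2) by (meson mult_le_mono1 trans_le_add1)
    then show "tensor_row ?m f i j = 0 j" using that(1) by (auto simp: tensor_row_def supp_below_def)
  qed
  have rs: "tensor_row ?m f i \<in> supp_below ?m" for f :: "nat \<Rightarrow> 'k" and i by (auto simp: tensor_row_def supp_below_def)
  have 3: "lin_iso ?f ?g (fun_rep ?T) ?R"
  proof (rule lin_isoI[OF op_rep_ok_subsp[OF ok]])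
    fix f assume "f \<in> carr (fun_rep ?T)"
    then have f: "f \<in> supp_below (4 * r * ?m)" by (simp add: fun_rep_def)
    then show "?f f \<in> carr ?R"
      using r0[OF f] rs by (simp add: tensor_A_def fin_supp_def fun_rep_def)
    show "?g (?f f) = f"
    proof
      fix q show "?g (?f f) q = f q"
      proof (cases "q < 4 * r * ?m")
        case True
        then have "q mod ?m < ?m" using div_mod_lt[OF True] by simp
        then show ?thesis unfolding hf using True by (simp add: tensor_row_def)
      qed (use f in \<open>auto simp: supp_below_def\<close>)
    qed
    show "?f (smul (fun_rep ?T) c f) = smul ?R c (?f f)" for c
      by (auto simp: tensor_A_def fin_supp_def fun_rep_def tensor_row_def fun_eq_iff)
  next
    fix f g :: "nat \<Rightarrow> 'k"
    show "?f (f + g) = ?f f + ?f g"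
      by (auto simp: tensor_row_def fun_eq_iff)
  next
    fix t assume t: "t \<in> carr ?R"
    show "?g t \<in> carr (fun_rep ?T)" by (auto simp: fun_rep_def supp_below_def)
    obtain w x y z where tt: "t = (w, x, y, z)" by (cases t) auto
    show "?f (?g t) = t"
      unfolding rg[OF t] unfolding tt by (auto simp: mod4_simps div4_simps)
  qed
  have out: "mat_fun X f i = 0" if "X \<in> carrier_mat (4 * r) (4 * r)" "i \<ge> 4 * r" for X :: "'k mat" and f i
    using that by (auto simp: mat_fun_def)
  show ?thesis
  proof (rule rep_isoI[OF ok 3])
    fix f assume "f \<in> carr (fun_rep ?T)"
    then have f: "f \<in> supp_below (4 * r * ?m)" by (simp add: fun_rep_def)
    have aT: "mat_fun (act_a ?T) f \<in> supp_below (4 * r * ?m)" "mat_fun (act_b ?T) f \<in> supp_below (4 * r * ?m)"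
      using um_pre_tensor[OF 2 um_pre_A[OF 2] N, of x r] mat_fun_supp unfolding um_pre_def by auto
    \<comment> \<open>The row in block k + 1 vanishes beyond r, so the case distinction at the last
      block may be dropped.\<close>
    have dd: "c * tensor_row ?m f (4 * Suc k) j = (if Suc k < r then c * tensor_row ?m f (4 * Suc k) j else 0)" for c k j
      using r0[OF f, of "4 * Suc k"] by auto
    have o0: "mat_fun Y 0 = 0" for Y :: "'k mat" by (auto simp: mat_fun_def)
    have ra: "tensor_row ?m (mat_fun (act_a ?T) f) (4 * k + t) = (\<lambda>j. mat_fun (act_a (um_A x r)) (\<lambda>i'. tensor_row ?m f i' j) (4 * k + t) + mat_fun (act_a N) (tensor_row ?m f (4 * k + t)) j)"
      and rb: "tensor_row ?m (mat_fun (act_b ?T) f) (4 * k + t) = (\<lambda>j. mat_fun (act_b (um_A x r)) (\<lambda>i'. tensor_row ?m f i' j) (4 * k + t) + mat_fun (act_b N) (tensor_row ?m f (4 * k + t)) j)"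
      if "k < r" "t < 4" for k t
      using tensor_row_act[OF um_A_simps(2) B(1), of "4 * k + t"] tensor_row_act[OF um_A_simps(3) B(2), of "4 * k + t"] that by auto
    have za: "tensor_row ?m (mat_fun (act_a ?T) f) i = 0" and zb: "tensor_row ?m (mat_fun (act_b ?T) f) i = 0" and z: "tensor_row ?m f i = 0" if "i \<ge> 4 * r" for i
      using r0[OF aT(1) that] r0[OF aT(2) that] r0[OF f that] by auto
    have R1: "tensor_row ?m (mat_fun (act_a ?T) f) (4 * k) = mat_fun (act_a N) (tensor_row ?m f (4 * k))" for k
    proof (cases "k < r")
      case True
      show ?thesis
        using ra[OF True, of 0] dd[of _ k] unfolding plus_fun_def by (simp only: mat_fun_act_A[OF True] add_0_right add_0_left; simp)
    next
      case False
      then show ?thesis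
        using z za by (simp add: o0 zero_fun_def[symmetric])
    qed
    have R2: "tensor_row ?m (mat_fun (act_a ?T) f) (4 * k + 1) = (\<lambda>j. A_c1 x * tensor_row ?m f (4 * k) j) + (\<lambda>j. A_d1 x * tensor_row ?m f (4 * Suc k) j) + mat_fun (act_a N) (tensor_row ?m f (4 * k + 1))" for k
    proof (cases "k < r")
      case True
      show ?thesis
        using ra[OF True, of 1] dd[of _ k] unfolding plus_fun_def by (simp only: mat_fun_act_A[OF True] add_0_right add_0_left; simp)
    next
      case False
      then show ?thesis
        using z za by (simp add: o0 zero_fun_def[symmetric])
    qed
    have R3: "tensor_row ?m (mat_fun (act_a ?T) f) (4 * k + 2) = tensor_row ?m f (4 * k + 1) + mat_fun (act_a N) (tensor_row ?m f (4 * k + 2))" for k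
    proof (cases "k < r")
      case True
      show ?thesis
        using ra[OF True, of 2] dd[of _ k] unfolding plus_fun_def by (simp only: mat_fun_act_A[OF True] add_0_right add_0_left; simp)
    next
      case False
      then show ?thesis
        using z za by (simp add: o0 zero_fun_def[symmetric])
    qed
    have R4: "tensor_row ?m (mat_fun (act_a ?T) f) (4 * k + 3) = tensor_row ?m f (4 * k + 2) + mat_fun (act_a N) (tensor_row ?m f (4 * k + 3))" for k
    proof (cases "k < r")
      case True
      show ?thesis
        using ra[OF True, of 3] dd[of _ k] unfolding plus_fun_def by (simp only: mat_fun_act_A[OF True] add_0_right add_0_left; simp)
    next
      case False
      then show ?thesis
        using z za by (simp add: o0 zero_fun_def[symmetric])
    qed
    have R5: "tensor_row ?m (mat_fun (act_b ?T) f) (4 * k) = mat_fun (act_b N) (tensor_row ?m f (4 * k))" for k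
    proof (cases "k < r")
      case True
      show ?thesis
        using rb[OF True, of 0] dd[of _ k] unfolding plus_fun_def by (simp only: mat_fun_act_A[OF True] add_0_right add_0_left; simp)
    next
      case False
      then show ?thesis
        using z zb by (simp add: o0 zero_fun_def[symmetric])
    qed
    have R6: "tensor_row ?m (mat_fun (act_b ?T) f) (4 * k + 1) = tensor_row ?m f (4 * k + 2) + mat_fun (act_b N) (tensor_row ?m f (4 * k + 1))" for k
    proof (cases "k < r")
      case True
      show ?thesis
        using rb[OF True, of 1] dd[of _ k] unfolding plus_fun_def by (simp only: mat_fun_act_A[OF True] add_0_right add_0_left; simp)
    next
      case False
      then show ?thesis
        using z zb by (simp add: o0 zero_fun_def[symmetric])
    qed
    have R7: "tensor_row ?m (mat_fun (act_b ?T) f) (4 * k + 2) = tensor_row ?m f (4 * k + 3) + mat_fun (act_b N) (tensor_row ?m f (4 * k + 2))" for k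
    proof (cases "k < r")
      case True
      show ?thesis
        using rb[OF True, of 2] dd[of _ k] unfolding plus_fun_def by (simp only: mat_fun_act_A[OF True] add_0_right add_0_left; simp)
    next
      case False
      then show ?thesis
        using z zb by (simp add: o0 zero_fun_def[symmetric])
    qed
    have R8: "tensor_row ?m (mat_fun (act_b ?T) f) (4 * k + 3) = (\<lambda>j. A_c2 x * tensor_row ?m f (4 * k) j) + (\<lambda>j. A_d2 x * tensor_row ?m f (4 * Suc k) j) + mat_fun (act_b N) (tensor_row ?m f (4 * k + 3))" for k
    proof (cases "k < r")
      case True
      show ?thesis
        using rb[OF True, of 3] dd[of _ k] unfolding plus_fun_def by (simp only: mat_fun_act_A[OF True] add_0_right add_0_left; simp)
    next
      case False
      then show ?thesis
        using z zb by (simp add: o0 zero_fun_def[symmetric])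
    qed
    show "?f (opa (fun_rep ?T) f) = opa ?R (?f f)" "?f (opb (fun_rep ?T) f) = opb ?R (?f f)"
      unfolding fun_rep_def[of ?T] op_rep.simps kspace.simps R1 R2 R3 R4 R5 R6 R7 R8
      by (simp_all add: tensor_A_def fin_supp_def fun_rep_def)
  qed
qed


section \<open>Duality\<close>

text \<open>Applying the isomorphism of the second factor to every value commutes with the operators
  of the first, which are scalars and index shifts. Well-formedness of the product over R is a
  hypothesis because it involves laws of scalars not contained in \<open>op_rep_ok R\<close>; it is
  available from the isomorphism that produced the product.\<close>

lemma tensor_A_cong:
  fixes R :: "('k, 'v::ab_group_add) op_rep" and S :: "('k, 'w::ab_group_add) op_rep"
  assumes ok: "op_rep_ok (tensor_A c1 d1 c2 d2 r R)" and iso: "rep_iso R S"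
  shows "rep_iso (tensor_A c1 d1 c2 d2 r R) (tensor_A c1 d1 c2 d2 r S)"
proof -
  obtain f g where fg: "lin_iso f g R S" and int: "\<And>x. x \<in> carr R \<Longrightarrow> f (opa R x) = opa S (f x)" "\<And>x. x \<in> carr R \<Longrightarrow> f (opb R x) = opb S (f x)"
    using iso unfolding rep_iso_def by auto
  note okR = rep_iso_okD(1)[OF iso]
  have R: "0 \<in> carr R" "\<And>c x. x \<in> carr R \<Longrightarrow> smul R c x \<in> carr R" "\<And>x y. x \<in> carr R \<Longrightarrow> y \<in> carr R \<Longrightarrow> x + y \<in> carr R"
      "\<And>x. x \<in> carr R \<Longrightarrow> opa R x \<in> carr R" "\<And>x. x \<in> carr R \<Longrightarrow> opb R x \<in> carr R"
    using okR by (auto simp: op_rep_ok_def subsp_def lin_map_def)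
  have f: "\<And>x. x \<in> carr R \<Longrightarrow> f x \<in> carr S" "\<And>x. x \<in> carr R \<Longrightarrow> g (f x) = x" "\<And>c x. x \<in> carr R \<Longrightarrow> f (smul R c x) = smul S c (f x)"
      "\<And>x y. x \<in> carr R \<Longrightarrow> y \<in> carr R \<Longrightarrow> f (x + y) = f x + f y"
    and g: "\<And>y. y \<in> carr S \<Longrightarrow> g y \<in> carr R" "\<And>y. y \<in> carr S \<Longrightarrow> f (g y) = y"
    using fg by (auto simp: lin_iso_def lin_map_def)
  have f0: "f 0 = 0"
    using lin_map_0[of R S f] fg R(1) by (auto simp: lin_iso_def)
  have g0: "g 0 = 0"
    using f(2)[OF R(1)] f0 by simp
  have S0: "0 \<in> carr S" using f(1)[OF R(1)] f0 by simp
  let ?f = "\<lambda>(w, x, y, z). (\<lambda>k. f (w k), \<lambda>k. f (x k), \<lambda>k. f (y k), \<lambda>k. f (z k))"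
  let ?g = "\<lambda>(w, x, y, z). (\<lambda>k. g (w k), \<lambda>k. g (x k), \<lambda>k. g (y k), \<lambda>k. g (z k))"
  let ?R = "tensor_A c1 d1 c2 d2 r R" and ?T = "tensor_A c1 d1 c2 d2 r S"
  have tensor_A_E: thesis if "t \<in> carr (tensor_A c1 d1 c2 d2 r R')" "0 \<in> carr R'" 
    "\<And>w x y z. t = (w, x, y, z) \<Longrightarrow> (\<And>k. w k \<in> carr R') \<Longrightarrow> (\<And>k. x k \<in> carr R') \<Longrightarrow> (\<And>k. y k \<in> carr R') \<Longrightarrow> (\<And>k. z k \<in> carr R') \<Longrightarrow> thesis"
    for R' :: "('k, 'x::ab_group_add) op_rep" and t thesis
  proof -
    obtain w x y z where t: "t = (w, x, y, z)" by (cases t) auto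
    have "F k \<in> carr R'" if "F \<in> fin_supp r (carr R')" for F k
      using that \<open>0 \<in> carr R'\<close> by (cases "k < r") (auto simp: fin_supp_def)
    then show thesis using that(1,3) unfolding t by (auto simp: tensor_A_def)
  qed
  have ff: "(\<lambda>k. f (w k)) \<in> fin_supp r (carr S)" if "w \<in> fin_supp r (carr R)" for w
    using that f(1) f0 by (auto simp: fin_supp_def)
  have gg: "(\<lambda>k. g (w k)) \<in> fin_supp r (carr R)" if "w \<in> fin_supp r (carr S)" for w
    using that g(1) g0 by (auto simp: fin_supp_def)
  show ?thesis
  proof (rule rep_isoI[OF ok])
    show "lin_iso ?f ?g ?R ?T"
    proof (rule lin_isoI[OF op_rep_ok_subsp[OF ok]])
      show "?f t \<in> carr ?T" if "t \<in> carr ?R" for t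
        using that ff by (auto simp: tensor_A_def)
      show "?g t \<in> carr ?R" if "t \<in> carr ?T" for t
        using that gg by (auto simp: tensor_A_def)
      show "?f (smul ?R c t) = smul ?T c (?f t)" if "t \<in> carr ?R" for c t
        using that R(1) by (rule tensor_A_E) (simp add: tensor_A_def f(3))
      show "?f (t + t') = ?f t + ?f t'" if "t \<in> carr ?R" "t' \<in> carr ?R" for t t'
        using that(1) R(1) by (rule tensor_A_E, use that(2) R(1) in \<open>rule tensor_A_E\<close>) (simp add: plus_fun_def f(4))
      show "?g (?f t) = t" if "t \<in> carr ?R" for t
        using that R(1) by (rule tensor_A_E) (simp add: f(2))
      show "?f (?g t) = t" if "t \<in> carr ?T" for t
        using that S0 by (rule tensor_A_E) (simp add: g(2))
    qed
    show "?f (opa ?R t) = opa ?T (?f t)" "?f (opb ?R t) = opb ?T (?f t)" if "t \<in> carr ?R" for t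
      using that R(1) by (rule tensor_A_E; simp add: tensor_A_def R f int)+
  qed
qed

section \<open>The product as sixteen grids\<close>

lemma fin_supp_Times:
  "w \<in> fin_supp r (A \<times> B) \<longleftrightarrow> (\<lambda>k. fst (w k)) \<in> fin_supp r A \<and> (\<lambda>k. snd (w k)) \<in> fin_supp r B"
  by (auto simp: fin_supp_def mem_Times_iff prod_eq_iff)

lemma carr_grid_space_fin_supp: "carr (grid_space r s) = fin_supp r (supp_below s)"
  unfolding grid_space_def supp_below_def fin_supp_def by (auto simp: fun_eq_iff) (meson not_less)

context
  fixes c1 d1 c2 d2 c1' d1' c2' d2' :: "'k::field" and r s :: nat
  assumes 2: "CHAR('k) = 2"
begin

interpretation P: pencil_pair "grid_space r s" "pencil_left c1 d1" "pencil_left c2 d2" "pencil_right c1' d1'" "pencil_right c2' d2'"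
  by (rule pencil_pair_grid_space[OF 2])

lemma tensor_A_pencil_A:
  assumes ok: "op_rep_ok (tensor_A c1 d1 c2 d2 r (A_pencil (pencil c1' d1') (pencil c2' d2') (seq_space s)))"
  shows "rep_iso (tensor_A c1 d1 c2 d2 r (A_pencil (pencil c1' d1') (pencil c2' d2') (seq_space s))) P.tensor_AA"
proof (rule rep_isoI[OF ok])
  let ?s = "\<lambda>w :: nat \<Rightarrow> (nat \<Rightarrow> 'k) \<times> (nat \<Rightarrow> 'k) \<times> (nat \<Rightarrow> 'k) \<times> (nat \<Rightarrow> 'k). (\<lambda>k. fst (w k), \<lambda>k. fst (snd (w k)), \<lambda>k. fst (snd (snd (w k))), \<lambda>k. snd (snd (snd (w k))))"
  let ?m = "\<lambda>(w1, w2, w3, w4) k. (w1 k, w2 k, w3 k, w4 k) :: (nat \<Rightarrow> 'k) \<times> (nat \<Rightarrow> 'k) \<times> (nat \<Rightarrow> 'k) \<times> (nat \<Rightarrow> 'k)"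
  show "lin_iso (\<lambda>(w, x, y, z). (?s w, ?s x, ?s y, ?s z)) (\<lambda>(w, x, y, z). (?m w, ?m x, ?m y, ?m z)) (tensor_A c1 d1 c2 d2 r (A_pencil (pencil c1' d1') (pencil c2' d2') (seq_space s))) P.tensor_AA"
    by (rule lin_isoI[OF op_rep_ok_subsp[OF ok]])
      (auto simp: tensor_A_def A_pencil_def P.tensor_AA_def P.T_carr_def P.T_smul_def carr_grid_space_fin_supp fin_supp_Times seq_space_def, auto simp: grid_space_def plus_fun_def split_beta)
qed (auto simp: tensor_A_def A_pencil_def P.tensor_AA_def seq_space_def split_beta pencil_left_def pencil_right_def pencil_def fun_eq_iff)

lemma tensor_A_pencil_B:
  assumes ok: "op_rep_ok (tensor_A c1 d1 c2 d2 r (B_pencil (pencil c1' d1') (pencil c2' d2') (seq_space s)))"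
  shows "rep_iso (tensor_A c1 d1 c2 d2 r (B_pencil (pencil c1' d1') (pencil c2' d2') (seq_space s))) P.tensor_AB"
proof (rule rep_isoI[OF ok])
  let ?s = "\<lambda>w :: nat \<Rightarrow> (nat \<Rightarrow> 'k) \<times> (nat \<Rightarrow> 'k) \<times> (nat \<Rightarrow> 'k) \<times> (nat \<Rightarrow> 'k). (\<lambda>k. fst (w k), \<lambda>k. fst (snd (w k)), \<lambda>k. fst (snd (snd (w k))), \<lambda>k. snd (snd (snd (w k))))"
  let ?m = "\<lambda>(w1, w2, w3, w4) k. (w1 k, w2 k, w3 k, w4 k) :: (nat \<Rightarrow> 'k) \<times> (nat \<Rightarrow> 'k) \<times> (nat \<Rightarrow> 'k) \<times> (nat \<Rightarrow> 'k)"
  show "lin_iso (\<lambda>(w, x, y, z). (?s w, ?s x, ?s y, ?s z)) (\<lambda>(w, x, y, z). (?m w, ?m x, ?m y, ?m z)) (tensor_A c1 d1 c2 d2 r (B_pencil (pencil c1' d1') (pencil c2' d2') (seq_space s))) P.tensor_AB"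
    by (rule lin_isoI[OF op_rep_ok_subsp[OF ok]])
      (auto simp: tensor_A_def B_pencil_def P.tensor_AB_def P.T_carr_def P.T_smul_def carr_grid_space_fin_supp fin_supp_Times seq_space_def, auto simp: grid_space_def plus_fun_def split_beta)
qed (auto simp: tensor_A_def B_pencil_def P.tensor_AB_def seq_space_def split_beta pencil_left_def pencil_right_def pencil_def fun_eq_iff)

end

section \<open>Duals of modules, sums, copies and tensor products\<close>

lemma uminus_mat_char2:
  assumes "CHAR('k::field) = 2"
  shows "- X = (X :: 'k mat)"
proof -
  have "- y = y" for y :: 'k
    using char2_add_self[OF assms, of y] by (metis add_eq_0_iff)
  then show ?thesis by (intro eq_matI) auto
qed

lemma um_dual_simps [simp]: "mdim (um_dual M) = mdim M" "act_a (um_dual M) = - transpose_mat (act_a M)"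
  "act_b (um_dual M) = - transpose_mat (act_b M)" "act_c (um_dual M) = - transpose_mat (act_c M)"
  by (simp_all add: um_dual_def)

text \<open>Transposition reverses products, and all defining relations are invariant under
  reversal: they are anticommutators or powers. The sign of the dual action is trivial in
  characteristic 2.\<close>

lemma um_module_dual:
  fixes M :: "'k::field um_rep"
  assumes 2: "CHAR('k) = 2" and M: "um_module M"
  shows "um_module (um_dual M)"
proof -
  let ?n = "mdim M"
  have c: "act_a M \<in> carrier_mat ?n ?n" "act_b M \<in> carrier_mat ?n ?n" "act_c M \<in> carrier_mat ?n ?n"
    and rel: "act_a M * act_b M + act_b M * act_a M = act_c M" "act_a M * act_c M + act_c M * act_a M = act_a M"
    "act_b M * act_c M + act_c M * act_b M = act_b M" "act_a M * act_a M * act_a M * act_a M = 0\<^sub>m ?n ?n"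
    "act_b M * act_b M * act_b M * act_b M = 0\<^sub>m ?n ?n" "act_c M * act_c M + act_c M = 0\<^sub>m ?n ?n"
    using M by (auto simp: um_module_def Let_def pow_mat_4[of _ ?n] pow_mat_2[of _ ?n])
  have t: "transpose_mat X * transpose_mat Y + transpose_mat Y * transpose_mat X = transpose_mat Z"
    if "X \<in> carrier_mat ?n ?n" "Y \<in> carrier_mat ?n ?n" "X * Y + Y * X = Z" for X Y Z :: "'k mat"
  proof -
    have "transpose_mat (X * Y + Y * X) = transpose_mat (X * Y) + transpose_mat (Y * X)"
      using that by (intro transpose_add[of _ ?n ?n]) auto
    also have "\<dots> = transpose_mat Y * transpose_mat X + transpose_mat X * transpose_mat Y"
      using that by (simp add: transpose_mult[of _ ?n ?n _ ?n])
    finally show ?thesis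
      using that by (simp add: comm_add_mat[of _ ?n ?n])
  qed
  have q: "transpose_mat X * transpose_mat X * transpose_mat X * transpose_mat X = 0\<^sub>m ?n ?n"
    if X: "X \<in> carrier_mat ?n ?n" and "X * X * X * X = 0\<^sub>m ?n ?n" for X :: "'k mat"
  proof -
    have "transpose_mat (X * X * X * X) = transpose_mat X * (transpose_mat X * (transpose_mat X * transpose_mat X))"
      using X by (simp add: transpose_mult[of _ ?n ?n _ ?n])
    also have "\<dots> = transpose_mat X * transpose_mat X * transpose_mat X * transpose_mat X"
      using X by (simp add: assoc_mult_mat[of _ ?n ?n _ ?n _ ?n])
    finally show ?thesis using that by simp
  qed
  have "transpose_mat (act_c M) * transpose_mat (act_c M) + transpose_mat (act_c M) = transpose_mat (act_c M * act_c M + act_c M)"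
    using c(3) by (simp add: transpose_add[of _ ?n ?n] transpose_mult[of _ ?n ?n _ ?n])
  then have s: "transpose_mat (act_c M) * transpose_mat (act_c M) + transpose_mat (act_c M) = 0\<^sub>m ?n ?n"
    by (simp add: rel(6))
  show ?thesis
    unfolding um_module_def Let_def um_dual_simps uminus_mat_char2[OF 2]
    using c t[OF c(1,2) rel(1)] t[OF c(1,3) rel(2)] t[OF c(2,3) rel(3)] q[OF c(1) rel(4)] q[OF c(2) rel(5)] s
    by (simp add: pow_mat_4[of _ ?n] pow_mat_2[of _ ?n])
qed

lemma um_dual_iso:
  fixes M N :: "'k::field um_rep"
  assumes 2: "CHAR('k) = 2" and iso: "um_iso M N"
  shows "um_iso (um_dual M) (um_dual N)"
proof -
  obtain F where M: "um_module M" and N: "um_module N" and F: "F \<in> um_hom M N" and inv: "invertible_mat F"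
    using iso unfolding um_iso_def by auto
  let ?n = "mdim M"
  have cF: "F \<in> carrier_mat (mdim N) ?n" and a: "F * act_a M = act_a N * F" and b: "F * act_b M = act_b N * F"
    using F unfolding um_hom_def by auto
  obtain G where n: "mdim N = ?n" and G: "G \<in> carrier_mat ?n ?n" and FG: "F * G = 1\<^sub>m ?n" and GF: "G * F = 1\<^sub>m ?n"
    using invertible_matE[OF inv cF] by metis
  have c: "F \<in> carrier_mat ?n ?n" using cF n by simp
  have A: "act_a M \<in> carrier_mat ?n ?n" "act_b M \<in> carrier_mat ?n ?n" "act_a N \<in> carrier_mat ?n ?n" "act_b N \<in> carrier_mat ?n ?n"
    using um_module_pre[OF M] um_module_pre[OF N] n by (auto simp: um_pre_def)
  have tr: "transpose_mat Y * transpose_mat X = transpose_mat (X * Y)" if "X \<in> carrier_mat ?n ?n" "Y \<in> carrier_mat ?n ?n" for X Y :: "'k mat"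
    using that by (simp add: transpose_mult[of _ ?n ?n _ ?n])
  have "um_iso (um_dual N) (um_dual M)"
  proof (rule um_isoI)
    show "transpose_mat F \<in> carrier_mat (mdim (um_dual M)) (mdim (um_dual N))" "transpose_mat G \<in> carrier_mat (mdim (um_dual N)) (mdim (um_dual M))"
      using c G n by auto
    show "transpose_mat F * transpose_mat G = 1\<^sub>m (mdim (um_dual M))" "transpose_mat G * transpose_mat F = 1\<^sub>m (mdim (um_dual N))"
      using c G n FG GF by (auto simp: tr)
    show "transpose_mat F * act_a (um_dual N) = act_a (um_dual M) * transpose_mat F" "transpose_mat F * act_b (um_dual N) = act_b (um_dual M) * transpose_mat F"
      using c A a b by (auto simp: uminus_mat_char2[OF 2] tr)
  qed (use um_module_dual[OF 2 M] um_module_dual[OF 2 N] um_module_pre in auto)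
  then show ?thesis by (rule um_iso_sym)
qed

lemma um_rep_eqI:
  "mdim M = mdim N \<Longrightarrow> act_a M = act_a N \<Longrightarrow> act_b M = act_b N \<Longrightarrow> act_c M = act_c N \<Longrightarrow> M = (N :: 'k um_rep)"
  by (cases M; cases N) auto

lemma um_dual_dual: "um_dual (um_dual M) = M"
  by (rule um_rep_eqI) (auto intro!: eq_matI)

lemma um_dual_sum:
  assumes "um_pre M" "um_pre N"
  shows "um_dual (um_sum M N) = um_sum (um_dual M) (um_dual N)"
proof -
  have "- transpose_mat (diag_sum X Y) = diag_sum (- transpose_mat X) (- transpose_mat Y)"
    if "X \<in> carrier_mat n n" "Y \<in> carrier_mat m m" for X Y :: "'a mat" and n m
    using that by (intro eq_matI) (auto simp: diag_sum_def)
  then show ?thesis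
    using assms by (intro um_rep_eqI) (auto simp: um_pre_def)
qed

lemma um_dual_copies:
  assumes 2: "CHAR('k::field) = 2" and M: "um_module (M :: 'k um_rep)"
  shows "um_dual (um_copies n M) = um_copies n (um_dual M)"
proof (induction n)
  case 0
  show ?case by (rule um_rep_eqI) (auto intro!: eq_matI)
next
  case (Suc n)
  then show ?case
    using um_dual_sum[OF um_module_pre[OF M] um_module_pre[OF um_copies_module[OF 2 M]]] by simp
qed

text \<open>With the product basis fixed, transposition acts on each Kronecker factor separately, so
  this is an equality of matrices and not merely an isomorphism.\<close>

lemma um_dual_tensor:
  assumes "um_pre M" "um_pre N"
  shows "um_dual (um_tensor M N) = um_tensor (um_dual M) (um_dual N)"
proof -
  have "- transpose_mat (kronecker X (1\<^sub>m m) + kronecker (1\<^sub>m n) Y) = kronecker (- transpose_mat X) (1\<^sub>m m) + kronecker (1\<^sub>m n) (- transpose_mat Y)"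
    if "X \<in> carrier_mat n n" "Y \<in> carrier_mat m m" for X Y :: "'a mat" and n m
  proof (rule eq_matI)
    fix i j
    assume "i < dim_row (kronecker (- transpose_mat X) (1\<^sub>m m) + kronecker (1\<^sub>m n) (- transpose_mat Y))"
      "j < dim_col (kronecker (- transpose_mat X) (1\<^sub>m m) + kronecker (1\<^sub>m n) (- transpose_mat Y))"
    then have ij: "i < n * m" "j < n * m"
      using that by (auto simp: kronecker_def)
    have "i div m < n" "i mod m < m" "j div m < n" "j mod m < m"
      using div_mod_lt[OF ij(1)] div_mod_lt[OF ij(2)] by auto
    then show "(- transpose_mat (kronecker X (1\<^sub>m m) + kronecker (1\<^sub>m n) Y)) $$ (i, j) =
        (kronecker (- transpose_mat X) (1\<^sub>m m) + kronecker (1\<^sub>m n) (- transpose_mat Y)) $$ (i, j)"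
      using that ij by (auto simp: kronecker_def)
  qed (use that in \<open>auto simp: kronecker_def\<close>)
  then show ?thesis
    using assms by (intro um_rep_eqI) (auto simp: um_pre_def)
qed

section \<open>Self-duality of the models and coordinates for B\<close>

lemma dual_sparse: 
  assumes "CHAR('k::field) = 2"
  shows "- transpose_mat (sparse S) = (sparse (S\<inverse>) :: 'k mat)"
  unfolding uminus_mat_char2[OF assms] by (intro eq_matI) (auto simp: sparse_def)

text \<open>Both models are numbered so that reversing the basis carries the transposed actions of a
  and b to the original ones.\<close>

definition flip8 :: "'k::field mat" where
  "flip8 = sparse {(0, 7), (1, 6), (2, 5), (3, 4), (4, 3), (5, 2), (6, 1), (7, 0)}"

lemma mat_fun_flip8: "mat_fun flip8 (fun8 x0 x1 x2 x3 x4 x5 x6 x7) = fun8 x7 x6 x5 x4 x3 x2 x1 x0"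
  unfolding flip8_def by (subst mat_fun_sparse[OF refl]; simp add: lessThan_8 fun8_nth)

lemma flip8_intertwines:
  fixes X Y :: "'k::field mat"
  assumes "X \<in> carrier_mat 8 8" "Y \<in> carrier_mat 8 8"
    "\<And>x0 x1 x2 x3 x4 x5 x6 x7. mat_fun flip8 (mat_fun X (fun8 x0 x1 x2 x3 x4 x5 x6 x7)) = mat_fun Y (fun8 x7 x6 x5 x4 x3 x2 x1 x0)"
  shows "flip8 * X = Y * flip8"
proof (rule mat_fun_eqI[of _ 8 8])
  have c: "(flip8 :: 'k mat) \<in> carrier_mat 8 8" by (simp add: flip8_def)
  show "flip8 * X \<in> carrier_mat 8 8" "Y * flip8 \<in> carrier_mat 8 8"
    using assms(1,2) c by auto
  fix f :: "nat \<Rightarrow> 'k" assume "f \<in> supp_below 8"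
  then obtain x0 x1 x2 x3 x4 x5 x6 x7 where f: "f = fun8 x0 x1 x2 x3 x4 x5 x6 x7" by (rule supp8E)
  show "mat_fun (flip8 * X) f = mat_fun (Y * flip8) f"
    unfolding mat_fun_mult[OF c assms(1)] mat_fun_mult[OF assms(2) c] f mat_fun_flip8 by (rule assms(3))
qed

lemma dual_P0c:
  assumes 2: "CHAR('k::field) = 2"
  shows "um_iso (um_dual (P0c :: 'k um_rep)) P0c"
proof (rule um_isoI[of _ _ flip8 flip8])
  have c: "(flip8 :: 'k mat) \<in> carrier_mat 8 8" by (simp add: flip8_def)
  have o: "mat_fun (act_a (um_dual P0c)) (fun8 x0 x1 x2 x3 x4 x5 x6 x7) = fun8 x1 x2 x3 0 x5 x6 x7 0"
    "mat_fun (act_b (um_dual P0c)) (fun8 x0 x1 x2 x3 x4 x5 x6 x7) = fun8 x6 x7 x1 x2 0 x4 x5 0" for x0 x1 x2 x3 x4 x5 x6 x7 :: 'k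
    unfolding P0c_def um_dual_simps um_rep.simps dual_sparse[OF 2]
    by (subst mat_fun_sparse[OF refl]; simp add: lessThan_8 fun8_nth)+
  have cd: "act_a (um_dual (P0c :: 'k um_rep)) \<in> carrier_mat 8 8" "act_b (um_dual (P0c :: 'k um_rep)) \<in> carrier_mat 8 8"
    by auto
  show "flip8 * flip8 = (1\<^sub>m (mdim (P0c :: 'k um_rep)) :: 'k mat)" "flip8 * flip8 = (1\<^sub>m (mdim (um_dual (P0c :: 'k um_rep))) :: 'k mat)"
    using c by (auto intro!: mat_fun_eqI[of _ 8 8] elim!: supp8E simp: mat_fun_mult[OF c c] mat_fun_flip8 mat_fun_one fun8_supp)
  show "flip8 * act_a (um_dual (P0c :: 'k um_rep)) = act_a P0c * flip8"
    by (rule flip8_intertwines[OF cd(1) Pc_carrier(2)]) (simp only: o mat_fun_flip8 mat_fun_P0c)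
  show "flip8 * act_b (um_dual (P0c :: 'k um_rep)) = act_b P0c * flip8"
    by (rule flip8_intertwines[OF cd(2) Pc_carrier(3)]) (simp only: o mat_fun_flip8 mat_fun_P0c add.commute)
qed (use um_module_dual[OF 2 P0c_module[OF 2]] P0c_module[OF 2] um_module_pre in \<open>auto simp: flip8_def\<close>)

lemma dual_P1c:
  assumes 2: "CHAR('k::field) = 2"
  shows "um_iso (um_dual (P1c :: 'k um_rep)) P1c"
proof (rule um_isoI[of _ _ flip8 flip8])
  have c: "(flip8 :: 'k mat) \<in> carrier_mat 8 8" by (simp add: flip8_def)
  have o: "mat_fun (act_a (um_dual P1c)) (fun8 x0 x1 x2 x3 x4 x5 x6 x7) = fun8 x1 x2 x3 0 x5 x6 x7 0"
    "mat_fun (act_b (um_dual P1c)) (fun8 x0 x1 x2 x3 x4 x5 x6 x7) = fun8 x4 (x0 + x5) (x1 + x6) x7 0 0 x5 x6" for x0 x1 x2 x3 x4 x5 x6 x7 :: 'k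
    unfolding P1c_def um_dual_simps um_rep.simps dual_sparse[OF 2]
    by (subst mat_fun_sparse[OF refl]; simp add: lessThan_8 fun8_nth)+
  have cd: "act_a (um_dual (P1c :: 'k um_rep)) \<in> carrier_mat 8 8" "act_b (um_dual (P1c :: 'k um_rep)) \<in> carrier_mat 8 8"
    by auto
  show "flip8 * flip8 = (1\<^sub>m (mdim (P1c :: 'k um_rep)) :: 'k mat)" "flip8 * flip8 = (1\<^sub>m (mdim (um_dual (P1c :: 'k um_rep))) :: 'k mat)"
    using c by (auto intro!: mat_fun_eqI[of _ 8 8] elim!: supp8E simp: mat_fun_mult[OF c c] mat_fun_flip8 mat_fun_one fun8_supp)
  show "flip8 * act_a (um_dual (P1c :: 'k um_rep)) = act_a P1c * flip8"
    by (rule flip8_intertwines[OF cd(1) Pc_carrier(6)]) (simp only: o mat_fun_flip8 mat_fun_P1c)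
  show "flip8 * act_b (um_dual (P1c :: 'k um_rep)) = act_b P1c * flip8"
    by (rule flip8_intertwines[OF cd(2) Pc_carrier(7)]) (simp only: o mat_fun_flip8 mat_fun_P1c add.commute)
qed (use um_module_dual[OF 2 P1c_module[OF 2]] P1c_module[OF 2] um_module_pre in \<open>auto simp: flip8_def\<close>)

lemma fun_rep_B:
  assumes 2: "CHAR('k::field) = 2"
  shows "rep_iso (fun_rep (um_B (x :: 'k \<times> 'k) r)) (B_pencil (pencil (A_c1 x) (A_d1 x)) (pencil (A_c2 x) (A_d2 x)) (seq_space r))"
proof -
  have ok: "op_rep_ok (fun_rep (um_B x r))"
    unfolding um_B_def by (rule fun_rep_ok[OF um_module_pre[OF um_module_dual[OF 2 um_module_A[OF 2]]]])
  \<comment> \<open>The dual shift runs from block k - 1 to block k, whereas \<open>pencil\<close>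
    refers to k + 1. Numbering the blocks backwards by r - Suc k reconciles the two; within a block
    V1 is likewise read in the order 3, 2, 1.\<close>
  let ?t = "\<lambda>f j k. if k < r then f (4 * (r - Suc k) + j) else 0 :: 'k"
  let ?f = "\<lambda>f. (?t f 3, ?t f 2, ?t f 1, ?t f 0)"
  let ?g = "\<lambda>(x, y, z, w) i. if i < 4 * r then (if i mod 4 = 3 then x else if i mod 4 = 2 then y else if i mod 4 = 1 then z else w) (r - Suc (i div 4)) else 0 :: 'k"
  let ?R = "B_pencil (pencil (A_c1 x) (A_d1 x)) (pencil (A_c2 x) (A_d2 x)) (seq_space r)"
  have d: "mdim (um_B x r) = 4 * r" by (simp add: um_B_def)
  show ?thesis
  proof (rule rep_isoI[OF ok])
    show "lin_iso ?f ?g (fun_rep (um_B x r)) ?R"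
    proof (rule lin_isoI[OF op_rep_ok_subsp[OF ok]])
      fix f assume f: "f \<in> carr (fun_rep (um_B x r))"
      show "?g (?f f) = f"
      proof
        fix i show "?g (?f f) i = f i"
          by (rule mod4_cases[of i]) (use f in \<open>auto simp: mod4_simps div4_simps fun_rep_def d supp_below_def\<close>)
      qed
    next
      fix t assume t: "t \<in> carr ?R"
      show "?f (?g t) = t"
        using t by (auto simp: B_pencil_def seq_space_def supp_below_def fun_eq_iff mod4_simps div4_simps)
    qed (auto simp: B_pencil_def fun_rep_def seq_space_def supp_below_def fun_eq_iff d)
    fix f :: "nat \<Rightarrow> 'k"
    note B = mat_fun_act_B[OF 2, of _ r x f]
    have s: "Suc k < r \<Longrightarrow> r - Suc k - 1 = r - Suc (Suc k)" for k by simp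
    have p: "k < r \<Longrightarrow> 0 < r - Suc k \<longleftrightarrow> Suc k < r" for k by auto
    have e: "?t (mat_fun (act_a (um_B x r)) f) 3 = 0" "?t (mat_fun (act_a (um_B x r)) f) 2 = ?t f 3" "?t (mat_fun (act_a (um_B x r)) f) 1 = ?t f 2"
      "?t (mat_fun (act_a (um_B x r)) f) 0 = pencil (A_c1 x) (A_d1 x) (?t f 1)" 
      "?t (mat_fun (act_b (um_B x r)) f) 1 = 0" "?t (mat_fun (act_b (um_B x r)) f) 2 = ?t f 1" "?t (mat_fun (act_b (um_B x r)) f) 3 = ?t f 2"
      "?t (mat_fun (act_b (um_B x r)) f) 0 = pencil (A_c2 x) (A_d2 x) (?t f 3)"
      using B by (auto simp: pencil_def fun_eq_iff)
    show "?f (opa (fun_rep (um_B x r)) f) = opa ?R (?f f)" "?f (opb (fun_rep (um_B x r)) f) = opb ?R (?f f)"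
      unfolding fun_rep_def op_rep.simps kspace.simps e by (simp_all add: B_pencil_def)
  qed
qed


section \<open>The decompositions\<close>

abbreviation pencil_quad :: "'k::field \<times> 'k \<Rightarrow> 'k \<times> 'k \<Rightarrow> nat \<Rightarrow> nat \<Rightarrow> ('k, nat \<Rightarrow> nat \<Rightarrow> 'k, (nat \<Rightarrow> nat \<Rightarrow> 'k) \<times> (nat \<Rightarrow> nat \<Rightarrow> 'k), nat \<Rightarrow> nat \<Rightarrow> 'k) quad" where
  "pencil_quad x y r s \<equiv> pencil_pair.quad_tensor (grid_space r s) (pencil_left (A_c1 x) (A_d1 x)) (pencil_left (A_c2 x) (A_d2 x)) (pencil_right (A_c1 y) (A_d1 y)) (pencil_right (A_c2 y) (A_d2 y))"

section \<open>Points of the projective line and the coefficients of the pencils\<close>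

lemma proj_point_eqD: 
  assumes "proj_point x = proj_point y"
  obtains l where "l \<noteq> 0" "fst y = l * fst x" "snd y = l * snd x"
proof -
  have "y \<in> proj_point y" unfolding proj_point_def by (auto intro!: exI[of _ 1] prod_eqI)
  then have "y \<in> {(l * fst x, l * snd x) |l. l \<noteq> 0}"
    unfolding assms[symmetric] by (simp only: proj_point_def)
  then obtain l where "l \<noteq> 0" "y = (l * fst x, l * snd x)" by auto
  then show thesis using that[of l] by simp
qed

lemma proj_point_eqI:
  assumes "l \<noteq> 0" "fst y = l * fst x" "snd y = l * snd x"
  shows "proj_point x = proj_point y"
  unfolding proj_point_def
proof (intro equalityI subsetI)
  fix z assume "z \<in> {(k * fst x, k * snd x) |k. k \<noteq> 0}"
  then obtain k where "k \<noteq> 0" "z = (k * fst x, k * snd x)" by auto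
  then have "k / l \<noteq> 0" "z = (k / l * fst y, k / l * snd y)" using assms by auto
  then show "z \<in> {(k * fst y, k * snd y) |k. k \<noteq> 0}" by blast
next
  fix z assume "z \<in> {(k * fst y, k * snd y) |k. k \<noteq> 0}"
  then obtain k where "k \<noteq> 0" "z = (k * fst y, k * snd y)" by auto
  then have "k * l \<noteq> 0" "z = (k * l * fst x, k * l * snd x)" using assms by auto
  then show "z \<in> {(k * fst x, k * snd x) |k. k \<noteq> 0}" by blast
qed

lemma char2_eqI:
  assumes "CHAR('k::field) = 2" "a + b = (0 :: 'k)"
  shows "a = b"
  using char2_cancel(1)[OF assms(1), of a b] by (simp only: assms(2) add_0_right)

text \<open>For x1 \<noteq> x2 the determinant is x1^2 + x2^2 = (x1 + x2)^2, which is nonzero; under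
  the convention for x1 = x2 it is 1. This is the scalar \<open>dt\<close> by which the reduction at
  equal points divides.\<close>

lemma pencil_det:
  assumes 2: "CHAR('k::field) = 2"
  shows "A_c1 x * A_d2 x + A_c2 x * A_d1 x \<noteq> (0 :: 'k)"
proof (cases "fst x = snd x")
  case False
  have "fst x * fst x + snd x * snd x = (fst x + snd x) * (fst x + snd x) - 2 * (fst x * snd x)"
    by (simp add: algebra_simps)
  then have e: "fst x * fst x + snd x * snd x = (fst x + snd x) * (fst x + snd x)"
    by (simp add: char2_cancel(2)[OF 2])
  have "fst x + snd x \<noteq> 0"
    using False char2_eqI[OF 2] by blast
  then show ?thesis using False e by (simp add: A_c1_def A_c2_def A_d1_def A_d2_def)
qed (simp add: A_c1_def A_c2_def A_d1_def A_d2_def)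

lemma pencil_unimodular:
  assumes 2: "CHAR('k::field) = 2"
  obtains m n where "m * A_c1 x + n * A_c2 x = (1 :: 'k)"
proof (cases "A_c1 x = 0")
  case True
  then have "A_c2 x \<noteq> 0" using pencil_det[OF 2, of x] by auto
  then show thesis using that[of 0 "1 / A_c2 x"] by simp
next
  case False
  then show thesis using that[of "1 / A_c1 x" 0] by simp
qed

text \<open>For x1 \<noteq> x2 all four coefficients scale with x. For x1 = x2 the convention has
  already normalised them, and the factor is 1.\<close>

lemma pencil_same_point:
  assumes "proj_point x = proj_point y"
  obtains l :: "'k::field" where "l \<noteq> 0" "A_c1 y = l * A_c1 x" "A_d1 y = l * A_d1 x" "A_c2 y = l * A_c2 x" "A_d2 y = l * A_d2 x"
proof -
  obtain l where l: "l \<noteq> 0" "fst y = l * fst x" "snd y = l * snd x"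
    using proj_point_eqD[OF assms] .
  show thesis
  proof (cases "fst x = snd x")
    case True
    then show thesis using l by (intro that[of 1]) (auto simp: A_c1_def A_c2_def A_d1_def A_d2_def)
  next
    case False
    then show thesis using l by (intro that[of l]) (auto simp: A_c1_def A_c2_def A_d1_def A_d2_def)
  qed
qed

lemma pencil_distinct_points:
  fixes x y :: "'k::field \<times> 'k"
  assumes 2: "CHAR('k) = 2" and ne: "proj_point x \<noteq> proj_point y" and x: "x \<noteq> (0, 0)" and y: "y \<noteq> (0, 0)"
  shows "A_c1 x * A_c2 y + A_c2 x * A_c1 y \<noteq> 0"
proof -
  have "fst x * snd y \<noteq> snd x * fst y"
  proof
    assume e: "fst x * snd y = snd x * fst y"
    show False
    proof (cases "fst x = 0")
      case True
      then have "snd x \<noteq> 0" using x by (metis prod.collapse)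
      then have "fst y = 0" using e True by auto
      then have "snd y \<noteq> 0" using y by (metis prod.collapse)
      then show False
        using ne proj_point_eqI[of "snd y / snd x" y x] True \<open>snd x \<noteq> 0\<close> \<open>fst y = 0\<close> by auto
    next
      case False
      then have f: "snd y = fst y / fst x * snd x" using e by (simp add: field_simps)
      then have "fst y \<noteq> 0" using y by (metis prod.collapse divide_eq_0_iff mult_eq_0_iff)
      then show False
        using ne proj_point_eqI[of "fst y / fst x" y x] f False by auto
    qed
  qed
  then have "A_c1 x * A_c2 y \<noteq> A_c2 x * A_c1 y"
    by (auto simp: A_c1_def A_c2_def)
  then show ?thesis
    using char2_eqI[OF 2] by blast
qed

lemma pencil_quad_distinct:
  fixes x y :: "'k::field \<times> 'k"
  assumes "CHAR('k) = 2" "proj_point x \<noteq> proj_point y" "x \<noteq> (0, 0)" "y \<noteq> (0, 0)"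
  shows "quad_iso (pencil_quad x y r s) (quad_P (grid_space r s))"
  by (rule quad_iso_distinct[OF assms(1) pencil_distinct_points[OF assms]])

text \<open>Scaling makes the two points literally equal, and transposing the grid reduces r > s to
  the treated case. The space V has dimension r (s - 1) or s (r - 1), in both cases r s - min r
  s.\<close>

lemma pencil_quad_same:
  fixes x y :: "'k::field \<times> 'k"
  assumes 2: "CHAR('k) = 2" and xy: "proj_point x = proj_point y" and r: "0 < r" and s: "0 < s"
  shows "\<exists>V f g. klin V \<and> lin_iso f g V (seq_space (r * s - min r s)) \<and>
    quad_iso (pencil_quad x y r s) (qprod (quad_A (pencil (A_c1 x) (A_d1 x)) (pencil (A_c2 x) (A_d2 x)) (seq_space (min r s)))
      (qprod (quad_B (pencil (A_c1 x) (A_d1 x)) (pencil (A_c2 x) (A_d2 x)) (seq_space (min r s))) (quad_P (V :: ('k, nat \<Rightarrow> nat \<Rightarrow> 'k) kspace))))"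
proof -
  obtain l where l: "l \<noteq> 0" "A_c1 y = l * A_c1 x" "A_d1 y = l * A_d1 x" "A_c2 y = l * A_c2 x" "A_d2 y = l * A_d2 x"
    using pencil_same_point[OF xy] .
  obtain m n where mn: "m * A_c1 x + n * A_c2 x = 1"
    using pencil_unimodular[OF 2] .
  have scale: "quad_iso (pencil_quad x y r s) (pencil_quad x x r s)"
    unfolding l by (rule quad_iso_scale[OF 2 l(1)])
  have main: "quad_iso (pencil_quad x x r s) (qprod (quad_A (pencil (A_c1 x) (A_d1 x)) (pencil (A_c2 x) (A_d2 x)) (seq_space r))
      (qprod (quad_B (pencil (A_c1 x) (A_d1 x)) (pencil (A_c2 x) (A_d2 x)) (seq_space r)) (quad_P (grid_col0_space r s))))" if "r \<le> s" "0 < s" for r s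
  proof -
    interpret same_point r s "A_c1 x" "A_d1 x" "A_c2 x" "A_d2 x" m n
      by unfold_locales (use 2 that mn pencil_det[OF 2, of x] in auto)
    show ?thesis by (rule quad_iso_same)
  qed
  show ?thesis
  proof (cases "r \<le> s")
    case True
    have "r * s - min r s = r * (s - 1)" using True by (simp add: diff_mult_distrib2)
    moreover have "min r s = r" using True by simp
    ultimately show ?thesis
      using quad_iso_trans[OF scale main[OF True s]] lin_iso_grid_col0_space[of r s] klin_grid_col0_space[of r s]
      by (intro exI[of _ "grid_col0_space r s"] exI conjI) (assumption | simp)+
  next
    case False
    have "r * s - min r s = s * (r - 1)" using False by (simp add: diff_mult_distrib2 mult.commute)
    moreover have "min r s = s" using False by simp
    moreover have "s \<le> r" using False by simp
    ultimately show ?thesis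
      using quad_iso_trans[OF scale quad_iso_trans[OF quad_iso_flip[OF 2] main[OF \<open>s \<le> r\<close> r]]] lin_iso_grid_col0_space[of s r] klin_grid_col0_space[of s r]
      by (intro exI[of _ "grid_col0_space s r"] exI conjI) (assumption | simp)+
  qed
qed

section \<open>Tensor products as layered modules\<close>

lemma fun_rep_AA:
  fixes x y :: "'k::field \<times> 'k"
  assumes 2: "CHAR('k) = 2"
  shows "rep_iso (fun_rep (um_tensor (um_A x r) (um_A y s))) (rep_prod (layers_010 (pencil_quad x y r s)) (layers_101 (quad_P (grid_space r s))))"
proof -
  have 1: "rep_iso (fun_rep (um_tensor (um_A x r) (um_A y s))) (tensor_A (A_c1 x) (A_d1 x) (A_c2 x) (A_d2 x) r (fun_rep (um_A y s)))"
    by (rule fun_rep_tensor_A[OF 2 um_pre_A[OF 2]])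
  have 3: "rep_iso (tensor_A (A_c1 x) (A_d1 x) (A_c2 x) (A_d2 x) r (fun_rep (um_A y s))) (tensor_A (A_c1 x) (A_d1 x) (A_c2 x) (A_d2 x) r (A_pencil (pencil (A_c1 y) (A_d1 y)) (pencil (A_c2 y) (A_d2 y)) (seq_space s)))"
    by (rule tensor_A_cong[OF rep_iso_okD(2)[OF 1] fun_rep_A[OF 2]])
  show ?thesis
    by (rule rep_iso_trans[OF 1 rep_iso_trans[OF 3 rep_iso_trans[OF tensor_A_pencil_A[OF 2 rep_iso_okD(2)[OF 3]] pencil_pair.tensor_AA_iso[OF pencil_pair_grid_space[OF 2]]]]])
qed

lemma fun_rep_AB:
  fixes x y :: "'k::field \<times> 'k"
  assumes 2: "CHAR('k) = 2"
  shows "rep_iso (fun_rep (um_tensor (um_A x r) (um_B y s))) (rep_prod (layers_101 (pencil_quad x y r s)) (layers_101 (quad_P (grid_space r s))))"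
proof -
  have B: "um_pre (um_B y s)"
    unfolding um_B_def by (rule um_module_pre[OF um_module_dual[OF 2 um_module_A[OF 2]]])
  have 1: "rep_iso (fun_rep (um_tensor (um_A x r) (um_B y s))) (tensor_A (A_c1 x) (A_d1 x) (A_c2 x) (A_d2 x) r (fun_rep (um_B y s)))"
    by (rule fun_rep_tensor_A[OF 2 B])
  have 3: "rep_iso (tensor_A (A_c1 x) (A_d1 x) (A_c2 x) (A_d2 x) r (fun_rep (um_B y s))) (tensor_A (A_c1 x) (A_d1 x) (A_c2 x) (A_d2 x) r (B_pencil (pencil (A_c1 y) (A_d1 y)) (pencil (A_c2 y) (A_d2 y)) (seq_space s)))"
    by (rule tensor_A_cong[OF rep_iso_okD(2)[OF 1] fun_rep_B[OF 2]])
  show ?thesis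
    by (rule rep_iso_trans[OF 1 rep_iso_trans[OF 3 rep_iso_trans[OF tensor_A_pencil_B[OF 2 rep_iso_okD(2)[OF 3]] pencil_pair.tensor_AB_iso[OF pencil_pair_grid_space[OF 2]]]]])
qed

section \<open>Rearranging direct sums\<close>

lemma copies_add:
  fixes P :: "'k::field um_rep"
  assumes 2: "CHAR('k) = 2" and P: "um_module P"
  shows "rep_iso (rep_prod (fun_rep (um_copies m P)) (fun_rep (um_copies n P))) (fun_rep (um_copies (m + n) P))"
proof (induction m)
  case 0
  have ok: "op_rep_ok (fun_rep (um_copies n P))" "op_rep_ok (fun_rep (um_copies 0 P))"
    by (rule fun_rep_ok[OF um_module_pre[OF um_copies_module[OF 2 P]]])+
  show ?case
  proof (rule rep_isoI[OF rep_prod_ok[OF ok(2,1)]])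
    show "lin_iso snd (\<lambda>f. (0, f)) (rep_prod (fun_rep (um_copies 0 P)) (fun_rep (um_copies n P))) (fun_rep (um_copies (0 + n) P))"
      by (rule lin_isoI[OF op_rep_ok_subsp[OF rep_prod_ok[OF ok(2,1)]]]) (auto simp: rep_prod_def fun_rep_def supp_below_def fun_eq_iff)
  qed (auto simp: rep_prod_def fun_rep_def)
next
  case (Suc m)
  note mod = um_copies_module[OF 2 P]
  note ok = fun_rep_ok[OF um_module_pre[OF P]] fun_rep_ok[OF um_module_pre[OF mod]]
  have "rep_iso (rep_prod (fun_rep (um_copies (Suc m) P)) (fun_rep (um_copies n P))) (rep_prod (rep_prod (fun_rep P) (fun_rep (um_copies m P))) (fun_rep (um_copies n P)))"
    using rep_prod_cong[OF rep_iso_sym[OF fun_rep_sum[OF um_module_pre[OF P] um_module_pre[OF mod]]] rep_iso_refl[OF ok(2)]] by simp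
  also have "rep_iso \<dots> (rep_prod (fun_rep P) (rep_prod (fun_rep (um_copies m P)) (fun_rep (um_copies n P))))"
    by (rule rep_prod_assoc[OF ok(1) ok(2) ok(2)])
  also have "rep_iso \<dots> (rep_prod (fun_rep P) (fun_rep (um_copies (m + n) P)))"
    by (rule rep_prod_cong[OF rep_iso_refl[OF ok(1)] Suc])
  also have "rep_iso \<dots> (fun_rep (um_copies (Suc m + n) P))"
    using fun_rep_sum[OF um_module_pre[OF P] um_module_pre[OF mod]] by simp
  finally show ?case .
qed

text \<open>Supplies the summand P(0, n) in its literal form, a sum whose first term is the zero
  module.\<close>

lemma copies_zero_sum:
  fixes P Q :: "'k::field um_rep"
  assumes 2: "CHAR('k) = 2" and Q: "um_module Q"
  shows "rep_iso (fun_rep Q) (fun_rep (um_sum (um_copies 0 P) Q))"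
proof -
  have Z: "um_module (um_copies 0 P)"
    by (auto simp: um_module_def Let_def pow_mat_4[of _ 0] pow_mat_2[of _ 0])
  note ok = fun_rep_ok[OF um_module_pre[OF Q]] fun_rep_ok[OF um_module_pre[OF Z]]
  have "rep_iso (fun_rep Q) (rep_prod (fun_rep (um_copies 0 P)) (fun_rep Q))"
  proof (rule rep_isoI[OF ok(1)])
    show "lin_iso (\<lambda>f. (0, f)) snd (fun_rep Q) (rep_prod (fun_rep (um_copies 0 P)) (fun_rep Q))"
      by (rule lin_isoI[OF op_rep_ok_subsp[OF ok(1)]]) (auto simp: rep_prod_def fun_rep_def supp_below_def fun_eq_iff)
  qed (auto simp: rep_prod_def fun_rep_def mat_fun_def)
  also have "rep_iso \<dots> (fun_rep (um_sum (um_copies 0 P) Q))"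
    by (rule fun_rep_sum[OF um_module_pre[OF Z] um_module_pre[OF Q]])
  finally show ?thesis .
qed

lemma fun_rep_sum_cong:
  assumes "rep_iso R (fun_rep M)" "rep_iso S (fun_rep N)" "um_module M" "um_module N"
  shows "rep_iso (rep_prod R S) (fun_rep (um_sum M N))"
  by (rule rep_iso_trans[OF rep_prod_cong[OF assms(1,2)] fun_rep_sum[OF um_module_pre[OF assms(3)] um_module_pre[OF assms(4)]]])

lemma um_sum_cong:
  fixes M N :: "'k::field um_rep"
  assumes 2: "CHAR('k) = 2" and MN: "um_iso M M'" "um_iso N N'"
  shows "um_iso (um_sum M N) (um_sum M' N')"
proof -
  note m = um_iso_modules[OF MN(1)] um_iso_modules[OF MN(2)]
  show ?thesis
    unfolding um_iso_iff_rep_iso[OF um_module_sum[OF 2 m(1,3)] um_module_sum[OF 2 m(2,4)]]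
    by (rule rep_iso_trans[OF rep_iso_sym[OF fun_rep_sum[OF um_module_pre[OF m(1)] um_module_pre[OF m(3)]]]
          fun_rep_sum_cong[OF rep_iso_of_um_iso[OF MN(1)] rep_iso_of_um_iso[OF MN(2)] m(2,4)]])
qed

lemma um_iso_refl: "um_module M \<Longrightarrow> um_iso M M"
  using um_iso_iff_rep_iso rep_iso_refl[OF fun_rep_ok[OF um_module_pre]] by blast

lemma um_iso_trans: "um_iso M N \<Longrightarrow> um_iso N K \<Longrightarrow> um_iso M K"
  using um_iso_iff_rep_iso um_iso_modules rep_iso_trans by metis

lemma um_copies_cong:
  fixes M N :: "'k::field um_rep"
  assumes 2: "CHAR('k) = 2" and MN: "um_iso M N"
  shows "um_iso (um_copies n M) (um_copies n N)"
proof (induction n)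
  case 0
  have "um_module (um_copies 0 M)"
    by (rule um_copies_module[OF 2 um_iso_modules(1)[OF MN]])
  then show ?case using um_iso_refl by simp
qed (simp add: um_sum_cong[OF 2 MN])

lemma um_sum_swap3:
  fixes M N K :: "'k::field um_rep"
  assumes 2: "CHAR('k) = 2" and "um_module M" "um_module N" "um_module K"
  shows "um_iso (um_sum M (um_sum N K)) (um_sum N (um_sum M K))"
proof -
  note pre = um_module_pre[OF assms(2)] um_module_pre[OF assms(3)] um_module_pre[OF assms(4)]
  note ok = fun_rep_ok[OF pre(1)] fun_rep_ok[OF pre(2)] fun_rep_ok[OF pre(3)]
  note ms = um_module_sum[OF 2 assms(3,4)] um_module_sum[OF 2 assms(2,4)]
  have "rep_iso (fun_rep (um_sum M (um_sum N K))) (rep_prod (fun_rep M) (rep_prod (fun_rep N) (fun_rep K)))"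
    using rep_iso_sym[OF fun_rep_sum_cong[OF rep_iso_refl[OF ok(1)] fun_rep_sum[OF pre(2,3)] assms(2) ms(1)]] .
  also have "rep_iso \<dots> (rep_prod (rep_prod (fun_rep M) (fun_rep N)) (fun_rep K))"
    by (rule rep_iso_sym[OF rep_prod_assoc[OF ok]])
  also have "rep_iso \<dots> (rep_prod (rep_prod (fun_rep N) (fun_rep M)) (fun_rep K))"
    by (rule rep_prod_cong[OF rep_prod_swap[OF ok(1,2)] rep_iso_refl[OF ok(3)]])
  also have "rep_iso \<dots> (rep_prod (fun_rep N) (rep_prod (fun_rep M) (fun_rep K)))"
    by (rule rep_prod_assoc[OF ok(2,1,3)])
  also have "rep_iso \<dots> (fun_rep (um_sum N (um_sum M K)))"
    using fun_rep_sum_cong[OF rep_iso_refl[OF ok(2)] fun_rep_sum[OF pre(1,3)] assms(3) ms(2)] .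
  finally show ?thesis
    using um_iso_iff_rep_iso[OF um_module_sum[OF 2 assms(2) ms(1)] um_module_sum[OF 2 assms(3) ms(2)]] by simp
qed

section \<open>Assembly of the decompositions\<close>

context
  fixes P0 P1 :: "'k::field um_rep" and x y :: "'k \<times> 'k" and r s :: nat
  assumes 2: "CHAR('k) = 2" and P0: "um_iso P0 P0c" and P1: "um_iso P1 P1c" and r: "0 < r" and s: "0 < s"
    and x: "x \<noteq> (0, 0)" and y: "y \<noteq> (0, 0)"
begin

lemma module_B: "um_module (um_B z n)" for z :: "'k \<times> 'k"
  unfolding um_B_def by (rule um_module_dual[OF 2 um_module_A[OF 2]])

lemma P_modules: "um_module (um_copies n P0)" "um_module (um_copies n P1)"
  using um_copies_module[OF 2] um_iso_modules[OF P0] um_iso_modules[OF P1] by auto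

lemma AA_distinct:
  assumes "proj_point x \<noteq> proj_point y"
  shows "um_iso (um_tensor (um_A x r) (um_A y s)) (um_sum (um_copies (r * s) P0) (um_copies (r * s) P1))"
proof (rule um_iso_of_rep_iso)
  show "um_pre (um_tensor (um_A x r) (um_A y s))"
    by (rule um_pre_tensor[OF 2 um_pre_A[OF 2] um_pre_A[OF 2]])
  show "um_module (um_sum (um_copies (r * s) P0) (um_copies (r * s) P1))"
    by (rule um_module_sum[OF 2 P_modules])
  have 1: "rep_iso (layers_010 (pencil_quad x y r s)) (fun_rep (um_copies (r * s) P0))"
    by (rule rep_iso_trans[OF layers_010_cong[OF pencil_quad_distinct[OF 2 assms x y]] fun_rep_copies_P0c[OF 2 P0 lin_iso_grid_space klin_grid_space]])
      (simp add: pencil_pair.quad_tensor_def[OF pencil_pair_grid_space[OF 2]] klin_grid_space)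
  show "rep_iso (fun_rep (um_tensor (um_A x r) (um_A y s))) (fun_rep (um_sum (um_copies (r * s) P0) (um_copies (r * s) P1)))"
    by (rule rep_iso_trans[OF fun_rep_AA[OF 2] fun_rep_sum_cong[OF 1 fun_rep_copies_P1c[OF 2 P1 lin_iso_grid_space klin_grid_space] P_modules]])
qed

lemma AB_distinct:
  assumes "proj_point x \<noteq> proj_point y"
  shows "um_iso (um_tensor (um_A x r) (um_B y s)) (um_copies (2 * r * s) P1)"
proof (rule um_iso_of_rep_iso)
  show "um_pre (um_tensor (um_A x r) (um_B y s))"
    by (rule um_pre_tensor[OF 2 um_pre_A[OF 2] um_module_pre[OF module_B]])
  show "um_module (um_copies (2 * r * s) P1)"
    by (rule P_modules)
  have 1: "rep_iso (layers_101 (pencil_quad x y r s)) (fun_rep (um_copies (r * s) P1))"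
    by (rule rep_iso_trans[OF layers_101_cong[OF pencil_quad_distinct[OF 2 assms x y]] fun_rep_copies_P1c[OF 2 P1 lin_iso_grid_space klin_grid_space]])
      (simp_all add: pencil_pair.quad_tensor_def[OF pencil_pair_grid_space[OF 2]] klin_grid_space)
  have "rep_iso (fun_rep (um_tensor (um_A x r) (um_B y s))) (rep_prod (fun_rep (um_copies (r * s) P1)) (fun_rep (um_copies (r * s) P1)))"
    by (rule rep_iso_trans[OF fun_rep_AB[OF 2] rep_prod_cong[OF 1 fun_rep_copies_P1c[OF 2 P1 lin_iso_grid_space klin_grid_space]]])
  also have "rep_iso \<dots> (fun_rep (um_copies (2 * r * s) P1))"
    using copies_add[OF 2 um_iso_modules(1)[OF P1], of "r * s" "r * s"] by (simp only: mult_2 add_mult_distrib)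
  finally show "rep_iso (fun_rep (um_tensor (um_A x r) (um_B y s))) (fun_rep (um_copies (2 * r * s) P1))" .
qed

text \<open>The free summand contributes r s copies of P1. The square contributes A_x(t), B_x(t)
  and, from the complement of the kernel, r s - t copies of P0.\<close>

lemma AA_same:
  assumes xy: "proj_point x = proj_point y"
  defines "t \<equiv> min r s"
  shows "um_iso (um_tensor (um_A x r) (um_A y s))
    (um_sum (um_A x t) (um_sum (um_B x t) (um_sum (um_copies (r * s - t) P0) (um_copies (r * s) P1))))"
proof (rule um_iso_of_rep_iso)
  show "um_pre (um_tensor (um_A x r) (um_A y s))"
    by (rule um_pre_tensor[OF 2 um_pre_A[OF 2] um_pre_A[OF 2]])
  note mods = um_module_A[OF 2, of x t] module_B[of x t] P_modules(1)[of "r * s - t"] P_modules(2)[of "r * s"]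
  note m1 = um_module_sum[OF 2 mods(3,4)] um_module_sum[OF 2 mods(2) um_module_sum[OF 2 mods(3,4)]]
  show "um_module (um_sum (um_A x t) (um_sum (um_B x t) (um_sum (um_copies (r * s - t) P0) (um_copies (r * s) P1))))"
    by (rule um_module_sum[OF 2 mods(1) m1(2)])
  let ?p = "pencil (A_c1 x) (A_d1 x)" and ?q = "pencil (A_c2 x) (A_d2 x)"
  obtain V :: "('k, nat \<Rightarrow> nat \<Rightarrow> 'k) kspace" and f g where V: "klin V" "lin_iso f g V (seq_space (r * s - t))"
    and iso: "quad_iso (pencil_quad x y r s) (qprod (quad_A ?p ?q (seq_space t)) (qprod (quad_B ?p ?q (seq_space t)) (quad_P V)))"
    using pencil_quad_same[OF 2 xy r s] unfolding t_def by blast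
  note okA = quad_A_ok[OF klin_seq_space lin_pencil lin_pencil] and okB = quad_B_ok[OF klin_seq_space lin_pencil lin_pencil]
  have kU: "klin (qU (quad_A ?p ?q (seq_space t)))" "klin (qU (quad_B ?p ?q (seq_space t)))" "klin (qU (quad_P V))"
    by (simp_all add: quad_A_def quad_B_def quad_P_def klin_kzero klin_seq_space V)
  have "rep_iso (layers_010 (pencil_quad x y r s)) (layers_010 (qprod (quad_A ?p ?q (seq_space t)) (qprod (quad_B ?p ?q (seq_space t)) (quad_P V))))"
    by (rule layers_010_cong[OF iso]) (simp add: pencil_pair.quad_tensor_def[OF pencil_pair_grid_space[OF 2]] klin_grid_space)
  also have "rep_iso \<dots> (rep_prod (layers_010 (quad_A ?p ?q (seq_space t))) (layers_010 (qprod (quad_B ?p ?q (seq_space t)) (quad_P V))))"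
    by (rule layers_010_qprod[OF okA quad_ok_qprod[OF okB quad_P_ok[OF V(1)]] kU(1)]) (simp add: qprod_def klin_kpair kU)
  also have "rep_iso \<dots> (rep_prod (fun_rep (um_A x t)) (rep_prod (fun_rep (um_B x t)) (fun_rep (um_copies (r * s - t) P0))))"
    by (intro rep_prod_cong rep_iso_trans[OF layers_010_qprod[OF okB quad_P_ok[OF V(1)] kU(2,3)]]
        rep_iso_trans[OF layers_010_quad_A[OF klin_seq_space lin_pencil lin_pencil] rep_iso_sym[OF fun_rep_A[OF 2]]]
        rep_iso_trans[OF layers_010_quad_B[OF klin_seq_space lin_pencil lin_pencil] rep_iso_sym[OF fun_rep_B[OF 2]]] fun_rep_copies_P0c[OF 2 P0 V(2,1)])
  finally have 1: "rep_iso (layers_010 (pencil_quad x y r s)) (rep_prod (fun_rep (um_A x t)) (rep_prod (fun_rep (um_B x t)) (fun_rep (um_copies (r * s - t) P0))))" .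
  note pre = um_module_pre[OF mods(1)] um_module_pre[OF mods(2)] um_module_pre[OF mods(3)] um_module_pre[OF mods(4)]
  note ok = fun_rep_ok[OF pre(1)] fun_rep_ok[OF pre(2)] fun_rep_ok[OF pre(3)] fun_rep_ok[OF pre(4)]
  have "rep_iso (fun_rep (um_tensor (um_A x r) (um_A y s)))
      (rep_prod (rep_prod (fun_rep (um_A x t)) (rep_prod (fun_rep (um_B x t)) (fun_rep (um_copies (r * s - t) P0)))) (fun_rep (um_copies (r * s) P1)))"
    by (rule rep_iso_trans[OF fun_rep_AA[OF 2] rep_prod_cong[OF 1 fun_rep_copies_P1c[OF 2 P1 lin_iso_grid_space klin_grid_space]]])
  also have "rep_iso \<dots> (rep_prod (fun_rep (um_A x t)) (rep_prod (rep_prod (fun_rep (um_B x t)) (fun_rep (um_copies (r * s - t) P0))) (fun_rep (um_copies (r * s) P1))))"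
    by (rule rep_prod_assoc[OF ok(1) rep_prod_ok[OF ok(2,3)] ok(4)])
  also have "rep_iso \<dots> (rep_prod (fun_rep (um_A x t)) (rep_prod (fun_rep (um_B x t)) (rep_prod (fun_rep (um_copies (r * s - t) P0)) (fun_rep (um_copies (r * s) P1)))))"
    by (rule rep_prod_cong[OF rep_iso_refl[OF ok(1)] rep_prod_assoc[OF ok(2,3,4)]])
  also have "rep_iso \<dots> (fun_rep (um_sum (um_A x t) (um_sum (um_B x t) (um_sum (um_copies (r * s - t) P0) (um_copies (r * s) P1)))))"
    by (intro fun_rep_sum_cong rep_iso_refl ok mods m1)
  finally show "rep_iso (fun_rep (um_tensor (um_A x r) (um_A y s)))
      (fun_rep (um_sum (um_A x t) (um_sum (um_B x t) (um_sum (um_copies (r * s - t) P0) (um_copies (r * s) P1)))))" .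
qed

text \<open>With V0 and V1 exchanged the complement yields r s - t copies of P1, which join the r s
  copies from the free summand. The kernel now gives B and the cokernel A, so a final exchange of
  summands is needed.\<close>

lemma AB_same:
  assumes xy: "proj_point x = proj_point y"
  defines "t \<equiv> min r s"
  shows "um_iso (um_tensor (um_A x r) (um_B y s))
    (um_sum (um_A x t) (um_sum (um_B x t) (um_sum (um_copies 0 P0) (um_copies (2 * r * s - t) P1))))"
proof -
  note mods = um_module_A[OF 2, of x t] module_B[of x t] P_modules(2)[of "r * s - t"] P_modules(2)[of "r * s"] P_modules(2)[of "2 * r * s - t"] P_modules(1)[of 0]
  let ?P = "um_sum (um_copies 0 P0) (um_copies (2 * r * s - t) P1)"
  note m1 = um_module_sum[OF 2 mods(6,5)] um_module_sum[OF 2 mods(1) um_module_sum[OF 2 mods(6,5)]]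
  have "um_iso (um_tensor (um_A x r) (um_B y s)) (um_sum (um_B x t) (um_sum (um_A x t) ?P))"
  proof (rule um_iso_of_rep_iso)
    show "um_pre (um_tensor (um_A x r) (um_B y s))"
      by (rule um_pre_tensor[OF 2 um_pre_A[OF 2] um_module_pre[OF module_B]])
    show "um_module (um_sum (um_B x t) (um_sum (um_A x t) ?P))"
      by (rule um_module_sum[OF 2 mods(2) m1(2)])
    let ?p = "pencil (A_c1 x) (A_d1 x)" and ?q = "pencil (A_c2 x) (A_d2 x)"
    obtain V :: "('k, nat \<Rightarrow> nat \<Rightarrow> 'k) kspace" and f g where V: "klin V" "lin_iso f g V (seq_space (r * s - t))"
      and iso: "quad_iso (pencil_quad x y r s) (qprod (quad_A ?p ?q (seq_space t)) (qprod (quad_B ?p ?q (seq_space t)) (quad_P V)))"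
      using pencil_quad_same[OF 2 xy r s] unfolding t_def by blast
    note okA = quad_A_ok[OF klin_seq_space lin_pencil lin_pencil] and okB = quad_B_ok[OF klin_seq_space lin_pencil lin_pencil]
    have kU: "klin (qU (quad_A ?p ?q (seq_space t)))" "klin (qU (quad_B ?p ?q (seq_space t)))" "klin (qU (quad_P V))"
      "klin (qZ (quad_A ?p ?q (seq_space t)))" "klin (qZ (quad_B ?p ?q (seq_space t)))" "klin (qZ (quad_P V))"
      by (simp_all add: quad_A_def quad_B_def quad_P_def klin_kzero klin_seq_space V)
    have "rep_iso (layers_101 (pencil_quad x y r s)) (layers_101 (qprod (quad_A ?p ?q (seq_space t)) (qprod (quad_B ?p ?q (seq_space t)) (quad_P V))))"
      by (rule layers_101_cong[OF iso]) (simp_all add: pencil_pair.quad_tensor_def[OF pencil_pair_grid_space[OF 2]] klin_grid_space)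
    also have "rep_iso \<dots> (rep_prod (layers_101 (quad_A ?p ?q (seq_space t))) (layers_101 (qprod (quad_B ?p ?q (seq_space t)) (quad_P V))))"
      by (rule layers_101_qprod[OF okA quad_ok_qprod[OF okB quad_P_ok[OF V(1)]] kU(1) _ kU(4)]) (simp_all add: qprod_def klin_kpair kU)
    also have "rep_iso \<dots> (rep_prod (fun_rep (um_B x t)) (rep_prod (fun_rep (um_A x t)) (fun_rep (um_copies (r * s - t) P1))))"
      by (intro rep_prod_cong rep_iso_trans[OF layers_101_qprod[OF okB quad_P_ok[OF V(1)] kU(2,3,5,6)]]
          rep_iso_trans[OF layers_101_quad_A[OF klin_seq_space lin_pencil lin_pencil] rep_iso_sym[OF fun_rep_B[OF 2]]]
          rep_iso_trans[OF layers_101_quad_B[OF klin_seq_space lin_pencil lin_pencil] rep_iso_sym[OF fun_rep_A[OF 2]]] fun_rep_copies_P1c[OF 2 P1 V(2,1)])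
    finally have 1: "rep_iso (layers_101 (pencil_quad x y r s)) (rep_prod (fun_rep (um_B x t)) (rep_prod (fun_rep (um_A x t)) (fun_rep (um_copies (r * s - t) P1))))" .
    note pre = um_module_pre[OF mods(1)] um_module_pre[OF mods(2)] um_module_pre[OF mods(3)] um_module_pre[OF mods(4)]
    note ok = fun_rep_ok[OF pre(1)] fun_rep_ok[OF pre(2)] fun_rep_ok[OF pre(3)] fun_rep_ok[OF pre(4)]
    have "t \<le> r * s"
      using r s by (simp add: t_def min.coboundedI1)
    \<comment> \<open>The subtraction on \<open>nat\<close> is exact because t \<le> r s, which
      holds since r and s are positive.\<close>
    then have "r * s - t + r * s = 2 * r * s - t" by simp
    then have add: "rep_iso (rep_prod (fun_rep (um_copies (r * s - t) P1)) (fun_rep (um_copies (r * s) P1))) (fun_rep ?P)"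
      using rep_iso_trans[OF copies_add[OF 2 um_iso_modules(1)[OF P1]] copies_zero_sum[OF 2 P_modules(2)]] by metis
    have "rep_iso (fun_rep (um_tensor (um_A x r) (um_B y s)))
        (rep_prod (rep_prod (fun_rep (um_B x t)) (rep_prod (fun_rep (um_A x t)) (fun_rep (um_copies (r * s - t) P1)))) (fun_rep (um_copies (r * s) P1)))"
      by (rule rep_iso_trans[OF fun_rep_AB[OF 2] rep_prod_cong[OF 1 fun_rep_copies_P1c[OF 2 P1 lin_iso_grid_space klin_grid_space]]])
    also have "rep_iso \<dots> (rep_prod (fun_rep (um_B x t)) (rep_prod (rep_prod (fun_rep (um_A x t)) (fun_rep (um_copies (r * s - t) P1))) (fun_rep (um_copies (r * s) P1))))"
      by (rule rep_prod_assoc[OF ok(2) rep_prod_ok[OF ok(1,3)] ok(4)])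
    also have "rep_iso \<dots> (rep_prod (fun_rep (um_B x t)) (rep_prod (fun_rep (um_A x t)) (rep_prod (fun_rep (um_copies (r * s - t) P1)) (fun_rep (um_copies (r * s) P1)))))"
      by (rule rep_prod_cong[OF rep_iso_refl[OF ok(2)] rep_prod_assoc[OF ok(1,3,4)]])
    also have "rep_iso \<dots> (fun_rep (um_sum (um_B x t) (um_sum (um_A x t) ?P)))"
      by (intro fun_rep_sum_cong[OF _ fun_rep_sum_cong[OF _ add]] rep_iso_refl ok mods m1)
    finally show "rep_iso (fun_rep (um_tensor (um_A x r) (um_B y s))) (fun_rep (um_sum (um_B x t) (um_sum (um_A x t) ?P)))" .
  qed
  then show ?thesis
    by (rule um_iso_trans[OF _ um_sum_swap3[OF 2 mods(2,1) m1(1)]])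
qed

lemma P_self_dual: "um_iso (um_dual P0) P0" "um_iso (um_dual P1) P1"
  using um_iso_trans[OF um_dual_iso[OF 2 P0] um_iso_trans[OF dual_P0c[OF 2] um_iso_sym[OF P0]]]
    um_iso_trans[OF um_dual_iso[OF 2 P1] um_iso_trans[OF dual_P1c[OF 2] um_iso_sym[OF P1]]] by auto

lemma dual_P: "um_iso (um_dual (um_sum (um_copies m P0) (um_copies n P1))) (um_sum (um_copies m P0) (um_copies n P1))"
proof -
  note pre = um_module_pre[OF P_modules(1)] um_module_pre[OF P_modules(2)]
  show ?thesis
    unfolding um_dual_sum[OF pre] um_dual_copies[OF 2 um_iso_modules(1)[OF P0]] um_dual_copies[OF 2 um_iso_modules(1)[OF P1]]
    by (intro um_sum_cong um_copies_cong P_self_dual 2)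
qed

lemma BB_dual: "um_tensor (um_B x r) (um_B y s) = um_dual (um_tensor (um_A x r) (um_A y s))"
  unfolding um_B_def by (rule um_dual_tensor[OF um_pre_A[OF 2] um_pre_A[OF 2], symmetric])

lemma BB_distinct:
  assumes "proj_point x \<noteq> proj_point y"
  shows "um_iso (um_tensor (um_B x r) (um_B y s)) (um_sum (um_copies (r * s) P0) (um_copies (r * s) P1))"
  unfolding BB_dual by (rule um_iso_trans[OF um_dual_iso[OF 2 AA_distinct[OF assms]] dual_P])

text \<open>Dualising the decomposition of A \<otimes> A exchanges A_x(t) with B_x(t) and preserves
  the projective part, because P0 and P1 are self-dual.\<close>

lemma BB_same:
  assumes xy: "proj_point x = proj_point y"
  defines "t \<equiv> min r s"
  shows "um_iso (um_tensor (um_B x r) (um_B y s))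
    (um_sum (um_A x t) (um_sum (um_B x t) (um_sum (um_copies (r * s - t) P0) (um_copies (r * s) P1))))"
proof -
  let ?P = "um_sum (um_copies (r * s - t) P0) (um_copies (r * s) P1)"
  note mods = um_module_A[OF 2, of x t] module_B[of x t] um_module_sum[OF 2 P_modules(1)[of "r * s - t"] P_modules(2)[of "r * s"]]
  have BP: "um_module (um_sum (um_B x t) ?P)" by (rule um_module_sum[OF 2 mods(2,3)])
  have e: "um_dual (um_sum (um_A x t) (um_sum (um_B x t) ?P)) = um_sum (um_B x t) (um_sum (um_A x t) (um_dual ?P))"
    unfolding um_dual_sum[OF um_module_pre[OF mods(1)] um_module_pre[OF BP]] um_dual_sum[OF um_module_pre[OF mods(2)] um_module_pre[OF mods(3)]]
    by (simp add: um_B_def um_dual_dual)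
  have "um_iso (um_tensor (um_B x r) (um_B y s)) (um_sum (um_B x t) (um_sum (um_A x t) (um_dual ?P)))"
    unfolding BB_dual e[symmetric] unfolding t_def by (rule um_dual_iso[OF 2 AA_same[OF xy]])
  moreover have "um_iso (um_sum (um_B x t) (um_sum (um_A x t) (um_dual ?P))) (um_sum (um_B x t) (um_sum (um_A x t) ?P))"
    by (intro um_sum_cong um_iso_refl mods dual_P 2)
  moreover have "um_iso (um_sum (um_B x t) (um_sum (um_A x t) ?P)) (um_sum (um_A x t) (um_sum (um_B x t) ?P))"
    by (rule um_sum_swap3[OF 2 mods(2,1,3)])
  ultimately show ?thesis
    using um_iso_trans by blast
qed

end

theorem proposition4p15:
  fixes x y :: "'k::alg_closed_field \<times> 'k"
    and P0 P1 :: "'k um_rep"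
    and r s :: nat
  defines "P \<equiv> (\<lambda>m n. um_copies m P0 \<oplus>\<^sub>u um_copies n P1)"
    and "t \<equiv> min r s"
  assumes "CHAR('k) = 2"
    and "um_projective_cover P0 um_V0"
    and "um_projective_cover P1 um_V1"
    and "r \<ge> 1" and "s \<ge> 1"
    and "x \<noteq> (0, 0)" and "y \<noteq> (0, 0)"
  shows
    "(proj_point x \<noteq> proj_point y \<longrightarrow> um_A x r \<otimes>\<^sub>u um_A y s \<simeq>\<^sub>u P (r * s) (r * s)) \<and>
     (proj_point x = proj_point y \<longrightarrow>
       um_A x r \<otimes>\<^sub>u um_A y s \<simeq>\<^sub>u um_A x t \<oplus>\<^sub>u um_B x t \<oplus>\<^sub>u P (r * s - t) (r * s)) \<and>
     (proj_point x \<noteq> proj_point y \<longrightarrow>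
       um_A x r \<otimes>\<^sub>u um_B y s \<simeq>\<^sub>u um_copies (2 * r * s) P1) \<and>
     (proj_point x = proj_point y \<longrightarrow>
       um_A x r \<otimes>\<^sub>u um_B y s \<simeq>\<^sub>u um_A x t \<oplus>\<^sub>u um_B x t \<oplus>\<^sub>u P 0 (2 * r * s - t)) \<and>
     (proj_point x \<noteq> proj_point y \<longrightarrow> um_B x r \<otimes>\<^sub>u um_B y s \<simeq>\<^sub>u P (r * s) (r * s)) \<and>
     (proj_point x = proj_point y \<longrightarrow>
       um_B x r \<otimes>\<^sub>u um_B y s \<simeq>\<^sub>u um_A x t \<oplus>\<^sub>u um_B x t \<oplus>\<^sub>u P (r * s - t) (r * s))"
proof -
  note 2 = assms(3)
  \<comment> \<open>Uniqueness of projective covers replaces the given P0 and P1 by the explicit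
    models.\<close>
  have P0: "um_iso P0 P0c" and P1: "um_iso P1 P1c"
    using projective_cover_unique[OF assms(4) P0c_cover[OF 2] V0_module]
      projective_cover_unique[OF assms(5) P1c_cover[OF 2] V1_module[OF 2]] by auto
  have pos: "0 < r" "0 < s" using assms(6,7) by auto
  note hyps = 2 P0 P1 pos assms(8,9)
  show ?thesis
    unfolding P_def t_def
    using AA_distinct[OF hyps] AA_same[OF hyps] AB_distinct[OF hyps] AB_same[OF hyps] BB_distinct[OF hyps] BB_same[OF hyps]
    by blast
qed


end
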